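(* Let $D=D'\times(0,\lambda)$, where $\lambda>0$ and $D'\subset\mathbb{R}^2$ is a bounded open set with $|D'|=1$, and let $D$ be an open, bounded domain with Lipschitz boundary. Let the probability space, the ergodic dynamical system $(T_x)_{x\in\mathbb{R}^3}$ and the random parameters be as in the context, and assume in addition that $$T_{(x_1,x_2,x_3)}=T_{(0,0,x_3)}\qquad\text{for all }(x_1,x_2,x_3)\in\mathbb{R}^3 .$$ If $\mathbb{E}[\kappa]=0$, then the only minimizers of $\mathcal{G}_{\mathrm{hom}}$ in $H^1(D;\mathbb{S}^2)$ are given by $$m_*(x)=\cos(\theta(x\cdot e_3))\,e_1+\sin(\theta(x\cdot e_3))\,e_2,\qquad \theta(t)=\theta_0+\mathbb{E}\left[\frac{\kappa}{a}\right]t\quad\text{for every }t\in\mathbb{R},$$ with $\theta_0\in\mathbb{R}$ arbitrary.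
   Context: **Stochastic setting.** $(\Omega,\Sigma,\mathbb{P})$ is a probability space, $\Omega$ is a compact metric space, $\Sigma$ is a complete $\sigma$-algebra on $\Omega$, and $\mathbb{E}[f]=\int_\Omega f\,d\mathbb{P}$. $(T_x)_{x\in\mathbb{R}^3}$ is a family of measurable bijections $T_x:\Omega\to\Omega$ with: $T_0=\mathrm{Id}$ and $T_{x+y}=T_x\circ T_y$; $\mathbb{P}(T_x^{-1}(B))=\mathbb{P}(B)$ for all $x\in\mathbb{R}^3$, $B\in\Sigma$; $(x,\omega)\mapsto T_x\omega$ is measurable and continuous from $\mathbb{R}^3\times\Omega$ to $\Omega$; ergodicity: every $A\in\Sigma$ with $T_xA=A$ (up to a null set) for all $x$ satisfies $\mathbb{P}(A)\in\{0,1\}$. **Parameters.** The exchange coefficient $a\in L^\infty(\Omega)$ and the DMI (Dzyaloshinskii-Moriya interaction) constant $\kappa\in L^\infty(\Omega)$ satisfy $0<c_{\mathrm{ex}}\le a(\omega)\le C_{\mathrm{ex}}$ and $|\kappa(\omega)|\le C_{\mathrm{DMI}}$ for all $\omega\in\Omega$, for some positive constants $c_{\mathrm{ex}},C_{\mathrm{ex}},C_{\mathrm{DMI}}$. (The remaining parameters of the full micromagnetic model, saturation magnetization and anisotropy density, do not enter $\mathcal{G}_{\mathrm{hom}}$.) **Spaces on $\Omega$ and correctors.** $C^1(\Omega)$ is the set of $u\in C(\Omega)$ for which $D_iu(\omega)=\lim_{\delta\to0}(u(T_{\delta e_i}\omega)-u(\omega))/\delta$ exists for every $\omega\in\Omega$,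 $i=1,2,3$, and is continuous in $\omega$. For $u\in C^1(\Omega;\mathbb{R}^3)$, $(\nabla_\omega u)_{ij}=D_iu_j$. $L^2_{\mathrm{pot}}(\Omega;\mathbb{R}^3)$ is the closure of $\{\nabla_\omega u:u\in C^1(\Omega;\mathbb{R}^3)\}$ in $L^2(\Omega;\mathbb{R}^{3\times3})$, and $L^2_{\mathrm{sol}}(\Omega;\mathbb{R}^3)$ is its orthogonal complement in $L^2(\Omega;\mathbb{R}^{3\times3})$ for the scalar product $(A,B)=\int_\Omega A:B\,d\mathbb{P}$, where $A:B=\sum_{i,j}A_{ij}B_{ij}$. $\Theta_a,\Theta_\kappa\in L^2_{\mathrm{pot}}(\Omega;\mathbb{R}^3)$ are the unique elements with $a\Theta_a+a\,\mathrm{Id}\in L^2_{\mathrm{sol}}(\Omega;\mathbb{R}^3)$ and $a\Theta_\kappa+\kappa\,\mathrm{Id}\in L^2_{\mathrm{sol}}(\Omega;\mathbb{R}^3)$. **Energy.** $\mathbb{S}^2$ is the unit sphere in $\mathbb{R}^3$; $e_1,e_2,e_3$ is the canonical basis; $H^1(D;\mathbb{S}^2)$ is the set of $m\in H^1(D;\mathbb{R}^3)$ with $m(x)\in\mathbb{S}^2$ a.e.; $(\nabla m)_{ij}=\partial_im_j$; $\boldsymbol\chi(s)$ is the matrix with rows $e_1\times s,e_2\times s,e_3\times s$. $\mathcal{G}_{\mathrm{hom}}:H^1(D;\mathbb{S}^2)\to\mathbb{R}$ is $$\mathcal{G}_{\mathrm{hom}}(m)=\frac12\int_D\nabla m:\mathbb{E}[a\,\mathrm{Id}-\Theta_a^\intercal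 a\Theta_a]\nabla m\,dx-\int_D\nabla m:\mathbb{E}[\kappa\,\mathrm{Id}-\Theta_a^\intercal a\Theta_\kappa]\boldsymbol\chi(m)\,dx-\frac12\int_D\boldsymbol\chi(m):\mathbb{E}[\Theta_\kappa^\intercal a\Theta_\kappa]\boldsymbol\chi(m)\,dx ,$$ the almost sure $\Gamma$-limit, with respect to the weak topology of $H^1(D;\mathbb{S}^2)$, of the sum of the exchange energy and the bulk DMI energy of the composite with stationary ergodic coefficients $a(T_{x/\varepsilon}\tilde\omega)$, $\kappa(T_{x/\varepsilon}\tilde\omega)$ as $\varepsilon\to0$.
   Formalization: Uniqueness is claimed only when κ is not almost surely zero (if κ=0 a.s., every constant unit vector, e.g. e_3, is also a minimizer); that every m_* is a minimizer is kept in all cases. Σ is taken to be the completion of the Borel σ-algebra of Ω. *)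

theory Defs
  imports "HOL-Probability.Probability"
begin

section \<open>Ergodic dynamical system on a compact metric probability space\<close>

text \<open>
  The probability space is the whole type, assumed to be compact; its sigma-algebra is the
  completion of the Borel sigma-algebra, so that it is complete and the continuous
  functions are square integrable and dense in the square integrable ones. Joint measurability of
  the action refers to the completed product: with respect to the uncompleted product it would
  fail for ordinary examples such as a linear flow on a torus, because null sets need not be Borel.
\<close>

locale ergodic_system = prob_space M
  for M :: "'w::metric_space measure" +
  fixes T :: "real^3 \<Rightarrow> 'w \<Rightarrow> 'w"
  assumes compact_space: "compact (UNIV :: 'w set)"
    and borel_completion: "\<exists>N. sets N = sets borel \<and> M = completion N"
    and T_measurable: "\<And>x. T x \<in> measurable M M"
    and T_bij: "\<And>x. bij (T x)"
    and T_zero: "T 0 = id"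
    and T_add: "\<And>x y. T (x + y) = T x \<circ> T y"
    and T_invariant: "\<And>x B. B \<in> sets M \<Longrightarrow> measure M (T x -` B \<inter> space M) = measure M B"
    and T_jointly_measurable:
      "(\<lambda>(x, w). T x w) \<in> measurable (completion (lborel \<Otimes>\<^sub>M M)) M"
    and T_jointly_continuous: "continuous_on UNIV (\<lambda>(x, w). T x w)"
    and T_ergodic:
      "\<And>A. A \<in> sets M \<Longrightarrow> (\<And>x. sym_diff (T x ` A) A \<in> null_sets M) \<Longrightarrow> measure M A \<in> {0, 1}"


section \<open>Square integrable functions, potential and solenoidal fields, correctors\<close>

text \<open>
  Elements of the Lebesgue spaces are represented by functions. On \<^typ>\<open>real^3^3\<close> the
  library's inner product is \<open>A : B\<close> and its norm is the Frobenius norm; \<open>A $ i\<close> is the \<open>i\<close>-th row.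
\<close>

definition L2 :: "'x measure \<Rightarrow> ('x \<Rightarrow> 'b::euclidean_space) set" where
  "L2 M = {f \<in> borel_measurable M. integrable M (\<lambda>w. (norm (f w))\<^sup>2)}"

definition diff_quot ::
  "(real^3 \<Rightarrow> 'w \<Rightarrow> 'w) \<Rightarrow> ('w \<Rightarrow> 'b::euclidean_space) \<Rightarrow> 3 \<Rightarrow> 'w \<Rightarrow> real \<Rightarrow> 'b" where
  "diff_quot T u i w \<delta> = (u (T (\<delta> *\<^sub>R axis i 1) w) - u w) /\<^sub>R \<delta>"

definition C1 ::
  "(real^3 \<Rightarrow> 'w::metric_space \<Rightarrow> 'w) \<Rightarrow> ('w \<Rightarrow> 'b::euclidean_space) set" where
  "C1 T = {u. continuous_on UNIV u \<and>
     (\<forall>i. \<exists>v. continuous_on UNIV v \<and> (\<forall>w. (diff_quot T u i w \<longlongrightarrow> v w) (at 0)))}"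

definition grad_\<omega> ::
  "(real^3 \<Rightarrow> 'w::metric_space \<Rightarrow> 'w) \<Rightarrow> ('w \<Rightarrow> real^3) \<Rightarrow> 'w \<Rightarrow> real^3^3" where
  "grad_\<omega> T u w = (\<chi> i. Lim (at 0) (diff_quot T u i w))"

definition L2_pot ::
  "'w::metric_space measure \<Rightarrow> (real^3 \<Rightarrow> 'w \<Rightarrow> 'w) \<Rightarrow> ('w \<Rightarrow> real^3^3) set" where
  "L2_pot M T = {\<Theta> \<in> L2 M. \<forall>\<epsilon>>0. \<exists>u\<in>C1 T.
     sqrt (\<integral>w. (norm (\<Theta> w - grad_\<omega> T u w))\<^sup>2 \<partial>M) < \<epsilon>}"

definition L2_sol ::
  "'w::metric_space measure \<Rightarrow> (real^3 \<Rightarrow> 'w \<Rightarrow> 'w) \<Rightarrow> ('w \<Rightarrow> real^3^3) set" where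
  "L2_sol M T = {B \<in> L2 M. \<forall>A \<in> L2_pot M T. (\<integral>w. A w \<bullet> B w \<partial>M) = 0}"

text \<open>
  \<open>\<Theta>\<^sub>a\<close> is the corrector with \<open>k = a\<close>, and \<open>\<Theta>\<^sub>\<kappa>\<close> is the one with \<open>k = \<kappa>\<close>.
\<close>

definition is_corrector ::
  "'w::metric_space measure \<Rightarrow> (real^3 \<Rightarrow> 'w \<Rightarrow> 'w) \<Rightarrow> ('w \<Rightarrow> real) \<Rightarrow> ('w \<Rightarrow> real)
     \<Rightarrow> ('w \<Rightarrow> real^3^3) \<Rightarrow> bool" where
  "is_corrector M T a k \<Theta> \<longleftrightarrow>
     \<Theta> \<in> L2_pot M T \<and> (\<lambda>w. a w *\<^sub>R \<Theta> w + k w *\<^sub>R mat 1) \<in> L2_sol M T"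


section \<open>Domains and Sobolev maps into the sphere\<close>

text \<open>
  Around each boundary point, and after an orthogonal change of coordinates, the set is the strict epigraph of a
  Lipschitz function of two variables.
\<close>

definition Lipschitz_boundary :: "(real^3) set \<Rightarrow> bool" where
  "Lipschitz_boundary D \<longleftrightarrow>
     (\<forall>p \<in> frontier D. \<exists>U (Q :: real^3 \<Rightarrow> real^3) L (\<gamma> :: real^2 \<Rightarrow> real).
        open U \<and> p \<in> U \<and> orthogonal_transformation Q \<and> L-lipschitz_on UNIV \<gamma> \<and>
        D \<inter> U = {x \<in> U. \<gamma> (vector [Q x $ 1, Q x $ 2]) < Q x $ 3})"

definition cylinder :: "(real^2) set \<Rightarrow> real \<Rightarrow> (real^3) set" where
  "cylinder D' h = {x. vector [x $ 1, x $ 2] \<in> D' \<and> 0 < x $ 3 \<and> x $ 3 < h}"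

primrec Ck :: "nat \<Rightarrow> (real^3 \<Rightarrow> real) \<Rightarrow> bool" where
  "Ck 0 f \<longleftrightarrow> continuous_on UNIV f"
| "Ck (Suc k) f \<longleftrightarrow>
     (\<exists>f'. (\<forall>x. (f has_derivative f' x) (at x)) \<and> (\<forall>v. Ck k (\<lambda>x. f' x v)))"

definition test_functions :: "(real^3) set \<Rightarrow> (real^3 \<Rightarrow> real) set" where
  "test_functions D = {\<phi>. (\<forall>k. Ck k \<phi>) \<and>
     compact (closure {x. \<phi> x \<noteq> 0}) \<and> closure {x. \<phi> x \<noteq> 0} \<subseteq> D}"

text \<open>Row \<open>i\<close> of a weak gradient is \<open>\<partial>\<^sub>i m\<close>, i.e. \<open>(\<nabla>m)\<^sub>i\<^sub>j = \<partial>\<^sub>i m\<^sub>j\<close>.\<close>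

definition is_weak_grad ::
  "(real^3) set \<Rightarrow> (real^3 \<Rightarrow> real^3) \<Rightarrow> (real^3 \<Rightarrow> real^3^3) \<Rightarrow> bool" where
  "is_weak_grad D m g \<longleftrightarrow> g \<in> L2 (lebesgue_on D) \<and>
     (\<forall>\<phi> \<in> test_functions D. \<forall>i.
        (\<integral>x. frechet_derivative \<phi> (at x) (axis i 1) *\<^sub>R m x \<partial>lebesgue_on D)
          = - (\<integral>x. \<phi> x *\<^sub>R (g x $ i) \<partial>lebesgue_on D))"

definition H1 :: "(real^3) set \<Rightarrow> (real^3 \<Rightarrow> real^3) set" where
  "H1 D = {m \<in> L2 (lebesgue_on D). \<exists>g. is_weak_grad D m g}"

text \<open>The weak gradient is unique up to null sets, which do not affect the energy below.\<close>

definition weak_grad :: "(real^3) set \<Rightarrow> (real^3 \<Rightarrow> real^3) \<Rightarrow> real^3 \<Rightarrow> real^3^3" where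
  "weak_grad D m = (SOME g. is_weak_grad D m g)"

definition H1_sphere :: "(real^3) set \<Rightarrow> (real^3 \<Rightarrow> real^3) set" where
  "H1_sphere D = {m \<in> H1 D. AE x in lebesgue_on D. m x \<in> sphere 0 1}"


section \<open>The homogenized energy and the helical states\<close>

definition chi_mat :: "real^3 \<Rightarrow> real^3^3" where
  "chi_mat s = (\<chi> i. cross3 (axis i 1) s)"

definition G_hom ::
  "'w measure \<Rightarrow> ('w \<Rightarrow> real) \<Rightarrow> ('w \<Rightarrow> real) \<Rightarrow> ('w \<Rightarrow> real^3^3) \<Rightarrow> ('w \<Rightarrow> real^3^3)
     \<Rightarrow> (real^3) set \<Rightarrow> (real^3 \<Rightarrow> real^3) \<Rightarrow> real" where
  "G_hom M a \<kappa> \<Theta>\<^sub>a \<Theta>\<^sub>\<kappa> D m =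
     (let A = (\<integral>w. a w *\<^sub>R mat 1 - transpose (\<Theta>\<^sub>a w) ** (a w *\<^sub>R \<Theta>\<^sub>a w) \<partial>M);
          B = (\<integral>w. \<kappa> w *\<^sub>R mat 1 - transpose (\<Theta>\<^sub>a w) ** (a w *\<^sub>R \<Theta>\<^sub>\<kappa> w) \<partial>M);
          C = (\<integral>w. transpose (\<Theta>\<^sub>\<kappa> w) ** (a w *\<^sub>R \<Theta>\<^sub>\<kappa> w) \<partial>M);
          grad_m = weak_grad D m
      in 1/2 * (\<integral>x. grad_m x \<bullet> (A ** grad_m x) \<partial>lebesgue_on D)
         - (\<integral>x. grad_m x \<bullet> (B ** chi_mat (m x)) \<partial>lebesgue_on D)
         - 1/2 * (\<integral>x. chi_mat (m x) \<bullet> (C ** chi_mat (m x)) \<partial>lebesgue_on D))"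

definition m_star ::
  "'w measure \<Rightarrow> ('w \<Rightarrow> real) \<Rightarrow> ('w \<Rightarrow> real) \<Rightarrow> real \<Rightarrow> real^3 \<Rightarrow> real^3" where
  "m_star M a \<kappa> \<theta>\<^sub>0 x =
     (let \<theta> = (\<lambda>t. \<theta>\<^sub>0 + (\<integral>w. \<kappa> w / a w \<partial>M) * t)
      in cos (\<theta> (x \<bullet> axis 3 1)) *\<^sub>R axis 1 1 + sin (\<theta> (x \<bullet> axis 3 1)) *\<^sub>R axis 2 1)"

end

theory Submission
  imports Defs "HOL-Computational_Algebra.Polynomial"
begin

text \<open>
  In a layered medium the flow moves only along the third axis, so the first two stochastic
  derivatives vanish. A potential field therefore has, almost surely, only a third row, and that row
  has mean zero, while the third row of a solenoidal field is almost surely constant. These two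
  facts determine the correctors (\<open>corrector_explicit\<close>): the corrector for \<open>k\<close> is
  \<open>(E[k/a] / E[1/a] - k) / a\<close> times the matrix \<open>e\<^sub>3 e\<^sub>3\<^sup>T\<close>.

  Put \<open>\<alpha> = 1 / E[1/a]\<close>, \<open>\<beta> = E[\<kappa>/a]\<close> and \<open>K = E[\<kappa>\<^sup>2/a]\<close>. Since \<open>E[\<kappa>] = 0\<close>, the three effective tensors
  are \<open>diag(E[a], E[a], \<alpha>)\<close>, \<open>diag(0, 0, \<alpha> \<beta>)\<close> and \<open>diag(0, 0, K - \<alpha> \<beta>\<^sup>2)\<close>
  (\<open>homogenized_coefficients\<close>). The mixed term couples \<open>\<partial>\<^sub>3 m\<close> with \<open>e\<^sub>3 \<times> m\<close> only, and completing the square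
  shows that twice the energy is the integral of
  \<open>E[a] (|\<partial>\<^sub>1 m|\<^sup>2 + |\<partial>\<^sub>2 m|\<^sup>2) + \<alpha> |\<partial>\<^sub>3 m - \<beta> e\<^sub>3 \<times> m|\<^sup>2 + K (1 - |e\<^sub>3 \<times> m|\<^sup>2)\<close>
  minus the constant \<open>K |D|\<close> (\<open>G_hom_eq_defect\<close>). Every summand is nonnegative because \<open>|e\<^sub>3 \<times> m| \<le> |m| = 1\<close>,
  and all of them vanish for the helices, which are thus minimizers.

  Conversely, if \<open>\<kappa>\<close> is not almost surely zero, then \<open>K > 0\<close>, and a minimizer satisfies \<open>m\<^sub>3 = 0\<close>,
  \<open>\<partial>\<^sub>1 m = \<partial>\<^sub>2 m = 0\<close> and \<open>\<partial>\<^sub>3 m = \<beta> e\<^sub>3 \<times> m\<close>. Rotating \<open>m\<close> about \<open>e\<^sub>3\<close> by the angle \<open>- \<beta> x\<^sub>3\<close> cancels the last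
  derivative. The rotated field has zero weak gradient on the connected set \<open>D\<close>, so it is
  a constant unit vector in the plane (\<open>defect_eq_0_imp_AE_helix\<close>).

  Two tools carry the analysis. An integrable function that is orthogonal to all test functions
  vanishes (\<open>fundamental_lemma_calculus_of_variations\<close>); with translations of test functions and
  Fubini's theorem, this also shows that a vanishing weak gradient forces constancy
  (\<open>weak_gradient_zero_imp_const\<close>). On the probability space, primitives of continuous functions
  along the flow are admissible test functions, and testing with them shows that the third
  row of a solenoidal field is invariant under the flow, hence constant by ergodicity
  (\<open>L2_sol_row_const\<close>).
\<close>

section \<open>Smooth functions and test functions\<close>

lemma Ck_Suc_imp_Ck: "Ck (Suc k) f \<Longrightarrow> Ck k f"
proof (induction k arbitrary: f)
  case 0
  then show ?case
    by (auto simp: continuous_on_eq_continuous_at) (metis has_derivative_continuous)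
next
  case (Suc k)
  from Suc.prems obtain f' where f': "\<forall>x. (f has_derivative f' x) (at x)"
    "\<forall>v. Ck (Suc k) (\<lambda>x. f' x v)" unfolding Ck.simps(2)[of "Suc k" f] by blast
  then have "\<forall>v. Ck k (\<lambda>x. f' x v)" using Suc.IH by blast
  then show ?case unfolding Ck.simps(2)[of k f] using f' by blast
qed

lemma Ck_const: "Ck k (\<lambda>x. c)"
proof (induction k arbitrary: c)
  case (Suc k)
  then show ?case
    by (auto intro!: exI[of _ "\<lambda>x v. 0"])
qed simp

lemma Ck_add: "Ck k f \<Longrightarrow> Ck k g \<Longrightarrow> Ck k (\<lambda>x. f x + g x)"
proof (induction k arbitrary: f g)
  case 0
  then show ?case by (auto intro: continuous_intros)
next
  case (Suc k)
  from Suc.prems obtain f' g' where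
    "\<forall>x. (f has_derivative f' x) (at x)" "\<forall>v. Ck k (\<lambda>x. f' x v)"
    "\<forall>x. (g has_derivative g' x) (at x)" "\<forall>v. Ck k (\<lambda>x. g' x v)" by auto
  with Suc.IH show ?case
    by (auto intro!: exI[of _ "\<lambda>x v. f' x v + g' x v"] has_derivative_add)
qed

lemma Ck_mult: "Ck k f \<Longrightarrow> Ck k g \<Longrightarrow> Ck k (\<lambda>x. f x * g x)"
proof (induction k arbitrary: f g)
  case 0
  then show ?case by (auto intro: continuous_intros)
next
  case (Suc k)
  from Suc.prems obtain f' g' where d:
    "\<forall>x. (f has_derivative f' x) (at x)" "\<forall>v. Ck k (\<lambda>x. f' x v)"
    "\<forall>x. (g has_derivative g' x) (at x)" "\<forall>v. Ck k (\<lambda>x. g' x v)" by auto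
  have "Ck k f" "Ck k g" using Suc.prems Ck_Suc_imp_Ck by blast+
  then have "\<forall>v. Ck k (\<lambda>x. f x * g' x v + f' x v * g x)"
    using d Suc.IH by (intro allI Ck_add) auto
  moreover have "\<forall>x. ((\<lambda>x. f x * g x) has_derivative (\<lambda>v. f x * g' x v + f' x v * g x)) (at x)"
    using d by (auto intro: has_derivative_mult)
  ultimately show ?case by (auto intro!: exI[of _ "\<lambda>x v. f x * g' x v + f' x v * g x"])
qed

lemma Ck_prod: "finite I \<Longrightarrow> (\<And>i. i \<in> I \<Longrightarrow> Ck k (f i)) \<Longrightarrow> Ck k (\<lambda>x. \<Prod>i\<in>I. f i x)"
  by (induction I rule: finite_induct) (auto simp: Ck_const Ck_mult)

lemma Ck_shift: "Ck k f \<Longrightarrow> Ck k (\<lambda>x. f (x - y))"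
proof (induction k arbitrary: f)
  case 0
  then have "continuous_on UNIV f" by simp
  then have "continuous_on UNIV (\<lambda>x. f (x - y))"
    by (rule continuous_on_compose2) (auto intro: continuous_intros)
  then show ?case by simp
next
  case (Suc k)
  then obtain f' where f': "\<forall>x. (f has_derivative f' x) (at x)" "\<forall>v. Ck k (\<lambda>x. f' x v)" by auto
  have "((\<lambda>x. f (x - y)) has_derivative f' (x - y)) (at x)" for x
  proof -
    have "(f \<circ> (\<lambda>x. x - y) has_derivative f' (x - y) \<circ> (\<lambda>v. v)) (at x)"
      using f'(1) by (intro diff_chain_at) (auto intro!: derivative_eq_intros)
    then show ?thesis by (simp add: o_def)
  qed
  moreover have "\<forall>v. Ck k (\<lambda>x. f' (x - y) v)"
    using f'(2) Suc.IH by auto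
  ultimately show ?case by (auto intro!: exI[of _ "\<lambda>x. f' (x - y)"])
qed

text \<open>
  Smooth functions of three variables are built from smooth functions of one variable. A chain
  \<open>F 0, F 1, \<dots>\<close> of successive derivatives supplies all derivatives of \<open>F 0\<close> at once, which suits
  the recursive definition of \<^const>\<open>Ck\<close>.
\<close>

lemma Ck_ridge:
  assumes "\<And>n t. (F n has_real_derivative F (Suc n) t) (at t)"
  shows "Ck k (\<lambda>x. F n (x \<bullet> e + c))"
proof (induction k arbitrary: n)
  case 0
  have "continuous_on UNIV (F n)" for n
    using assms by (meson DERIV_isCont continuous_at_imp_continuous_on)
  moreover have "continuous_on UNIV (\<lambda>x. x \<bullet> e + c)" by (intro continuous_intros)
  ultimately have "continuous_on UNIV (\<lambda>x. F n (x \<bullet> e + c))"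
    by (rule continuous_on_compose2) auto
  then show ?case by simp
next
  case (Suc k)
  have "((\<lambda>x. F n (x \<bullet> e + c)) has_derivative (\<lambda>v. (v \<bullet> e) * F (Suc n) (x \<bullet> e + c))) (at x)" for x
  proof -
    have "(F n has_derivative (\<lambda>s. F (Suc n) (x \<bullet> e + c) * s)) (at (x \<bullet> e + c))"
      using assms by (simp add: has_field_derivative_def)
    moreover have "((\<lambda>x. x \<bullet> e + c) has_derivative (\<lambda>v. v \<bullet> e)) (at x)"
      by (auto intro!: derivative_eq_intros)
    ultimately have "(F n \<circ> (\<lambda>x. x \<bullet> e + c) has_derivative
       (\<lambda>s. F (Suc n) (x \<bullet> e + c) * s) \<circ> (\<lambda>v. v \<bullet> e)) (at x)"
      using diff_chain_at by blast
    then show ?thesis by (simp add: o_def mult.commute)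
  qed
  moreover have "\<forall>v. Ck k (\<lambda>x. (v \<bullet> e) * F (Suc n) (x \<bullet> e + c))"
    using Suc.IH Ck_mult[OF Ck_const] by blast
  ultimately show ?case
    by (auto intro!: exI[of _ "\<lambda>x v. (v \<bullet> e) * F (Suc n) (x \<bullet> e + c)"])
qed

lemma Ck_cos: "Ck k (\<lambda>x. cos (x \<bullet> e + c))"
proof -
  have "Ck k (\<lambda>x. cos (x \<bullet> e + c + real 0 * pi / 2))"
  proof (rule Ck_ridge[where F = "\<lambda>n t. cos (t + real n * pi / 2)"])
    \<comment> \<open>Each differentiation of the cosine advances the phase by a quarter turn.\<close>
    fix n t
    have "cos (t + real (Suc n) * pi / 2) = - sin (t + real n * pi / 2)"
      by (simp add: algebra_simps add_divide_distrib cos_add sin_add)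
    then show "((\<lambda>t. cos (t + real n * pi / 2)) has_real_derivative
        cos (t + real (Suc n) * pi / 2)) (at t)"
      by (auto intro!: derivative_eq_intros)
  qed
  then show ?thesis by simp
qed

lemma Ck_sin: "Ck k (\<lambda>x. sin (x \<bullet> e + c))"
proof -
  have "cos (x \<bullet> e + (c - pi / 2)) = sin (x \<bullet> e + c)" for x
    by (simp add: cos_diff add_diff_eq)
  then show ?thesis using Ck_cos[of k e "c - pi / 2"] by simp
qed

text \<open>
  The classical function \<open>exp (- 1/t)\<close> glued to zero, together with a polynomial factor in \<open>1/t\<close>: the
  factor makes the family closed under differentiation.
\<close>

definition flat :: "real poly \<Rightarrow> real \<Rightarrow> real" where
  "flat p t = (if 0 < t then poly p (1 / t) * exp (- (1 / t)) else 0)"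

lemma poly_times_exp_tendsto_0: "((\<lambda>u. poly p u * exp (- u)) \<longlongrightarrow> 0) at_top" for p :: "real poly"
proof -
  have "((\<lambda>u. \<Sum>i\<le>degree p. coeff p i * (u ^ i / exp u)) \<longlongrightarrow> (\<Sum>i\<le>degree p. coeff p i * 0)) at_top"
    by (intro tendsto_sum tendsto_mult tendsto_const tendsto_power_div_exp_0)
  then show ?thesis
    by (simp add: poly_altdef sum_distrib_right exp_minus field_simps sum_divide_distrib)
qed

lemma DERIV_flat: "(flat p has_real_derivative flat ([:0, 0, 1:] * (p - pderiv p)) t) (at t)"
proof -
  consider "t > 0" | "t < 0" | "t = 0" by linarith
  then show ?thesis
  proof cases
    case 1
    have "((\<lambda>t. poly p (1 / t) * exp (- (1 / t))) has_real_derivative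
        flat ([:0, 0, 1:] * (p - pderiv p)) t) (at t)"
      using 1 by (auto intro!: derivative_eq_intros simp: flat_def field_simps power2_eq_square)
    then show ?thesis
      by (rule has_field_derivative_transform_within_open[where S = "{0<..}"])
        (use 1 in \<open>auto simp: flat_def\<close>)
  next
    case 2
    have "((\<lambda>t. 0) has_real_derivative flat ([:0, 0, 1:] * (p - pderiv p)) t) (at t)"
      using 2 by (auto simp: flat_def)
    then show ?thesis
      by (rule has_field_derivative_transform_within_open[where S = "{..<0}"])
        (use 2 in \<open>auto simp: flat_def\<close>)
  next
    case 3
    \<comment> \<open>With \<open>u = 1/h\<close> the difference quotient is a polynomial in \<open>u\<close> times \<open>exp (- u)\<close>.\<close>
    have r: "((\<lambda>h. flat p h / h) \<longlongrightarrow> 0) (at_right 0)"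
    proof -
      have "((\<lambda>h. poly (p * [:0, 1:]) (inverse h) * exp (- inverse h)) \<longlongrightarrow> 0) (at_right 0)"
        by (rule filterlim_compose[OF poly_times_exp_tendsto_0 filterlim_inverse_at_top_right])
      then show ?thesis
        by (rule Lim_transform_eventually)
          (auto simp: flat_def eventually_at_filter field_simps)
    qed
    have l: "((\<lambda>h. flat p h / h) \<longlongrightarrow> 0) (at_left 0)"
      by (rule Lim_transform_eventually[OF tendsto_const])
        (auto simp: flat_def eventually_at_filter)
    have "((\<lambda>h. flat p h / h) \<longlongrightarrow> 0) (at 0)"
      using l r filterlim_at_split by blast
    then show ?thesis
      using 3 by (simp add: DERIV_def flat_def)
  qed
qed

lemma Ck_flat:
  fixes c :: real
  defines "P \<equiv> \<lambda>n. ((\<lambda>p. [:0, 0, 1:] * (p - pderiv p)) ^^ n) (1 :: real poly)"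
  shows "Ck k (\<lambda>x. flat 1 (x \<bullet> e + c))"
proof -
  have "Ck k (\<lambda>x. flat (P 0) (x \<bullet> e + c))"
    by (rule Ck_ridge[where F = "\<lambda>n. flat (P n)"]) (simp add: P_def DERIV_flat del: mult_pCons_left)
  then show ?thesis by (simp add: P_def)
qed

lemma
  assumes "\<phi> \<in> test_functions D"
  shows test_function_has_derivative: "(\<phi> has_derivative frechet_derivative \<phi> (at x)) (at x)"
    and test_function_partial_continuous: "continuous_on UNIV (\<lambda>x. frechet_derivative \<phi> (at x) v)"
    and test_function_continuous: "continuous_on UNIV \<phi>"
    and test_function_outside: "x \<notin> D \<Longrightarrow> \<phi> x = 0"
    and test_function_partial_outside: "x \<notin> closure {x. \<phi> x \<noteq> 0} \<Longrightarrow> frechet_derivative \<phi> (at x) v = 0"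
proof -
  have Ck: "Ck k \<phi>" for k using assms by (simp add: test_functions_def)
  obtain f' where f': "\<And>x. (\<phi> has_derivative f' x) (at x)" "\<And>v. continuous_on UNIV (\<lambda>x. f' x v)"
    using Ck[of "Suc 0"] by auto
  have eq: "frechet_derivative \<phi> (at x) = f' x" for x
    using frechet_derivative_at[OF f'(1)] by simp
  show "(\<phi> has_derivative frechet_derivative \<phi> (at x)) (at x)" using f' eq by simp
  show "continuous_on UNIV (\<lambda>x. frechet_derivative \<phi> (at x) v)" using f' eq by simp
  show "continuous_on UNIV \<phi>" using Ck[of 0] by simp
  show "x \<notin> D \<Longrightarrow> \<phi> x = 0"
    using assms closure_subset[of "{x. \<phi> x \<noteq> 0}"] by (auto simp: test_functions_def)
  assume x: "x \<notin> closure {x. \<phi> x \<noteq> 0}"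
  have "((\<lambda>_. 0 :: real) has_derivative (\<lambda>_. 0)) (at x)" by simp
  then have *: "(\<phi> has_derivative (\<lambda>_. 0)) (at x)"
  proof (rule has_derivative_transform_within_open[where s = "- closure {x. \<phi> x \<noteq> 0}"])
    show "0 = \<phi> y" if "y \<in> - closure {x. \<phi> x \<noteq> 0}" for y
      using that closure_subset[of "{x. \<phi> x \<noteq> 0}"] by auto
  qed (use x in auto)
  show "frechet_derivative \<phi> (at x) v = 0"
    using frechet_derivative_at[OF *, symmetric] by simp
qed

lemma test_function_compact_support:
  assumes "\<phi> \<in> test_functions D"
  obtains K where "compact K" "K \<subseteq> D" "\<And>x. x \<notin> K \<Longrightarrow> \<phi> x = 0"
    "\<And>x v. x \<notin> K \<Longrightarrow> frechet_derivative \<phi> (at x) v = 0"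
proof
  show "compact (closure {x. \<phi> x \<noteq> 0})" "closure {x. \<phi> x \<noteq> 0} \<subseteq> D"
    using assms by (auto simp: test_functions_def)
  show "x \<notin> closure {x. \<phi> x \<noteq> 0} \<Longrightarrow> \<phi> x = 0" for x
    using closure_subset[of "{x. \<phi> x \<noteq> 0}"] by auto
  show "x \<notin> closure {x. \<phi> x \<noteq> 0} \<Longrightarrow> frechet_derivative \<phi> (at x) v = 0" for x v
    by (rule test_function_partial_outside[OF assms])
qed

lemma test_function_bounded:
  assumes "\<phi> \<in> test_functions D"
  obtains C where "\<And>x. \<bar>\<phi> x\<bar> \<le> C"
proof -
  obtain K where K: "compact K" "\<And>x. x \<notin> K \<Longrightarrow> \<phi> x = 0"
    using test_function_compact_support[OF assms] by metis
  have "bounded (\<phi> ` K)"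
    using K continuous_on_subset[OF test_function_continuous[OF assms] subset_UNIV]
    by (intro compact_imp_bounded compact_continuous_image)
  then obtain C where "\<And>x. x \<in> K \<Longrightarrow> \<bar>\<phi> x\<bar> \<le> C" by (auto simp: bounded_iff)
  then have "\<bar>\<phi> x\<bar> \<le> max C 0" for x
    using K(2)[of x] by (cases "x \<in> K") (auto simp: le_max_iff_disj)
  then show ?thesis using that by blast
qed

lemma test_function_partial_bounded:
  assumes "\<phi> \<in> test_functions D"
  obtains C where "\<And>x. \<bar>frechet_derivative \<phi> (at x) v\<bar> \<le> C"
proof -
  obtain K where K: "compact K" "\<And>x. x \<notin> K \<Longrightarrow> frechet_derivative \<phi> (at x) v = 0"
    using test_function_compact_support[OF assms] by metis
  have "bounded ((\<lambda>x. frechet_derivative \<phi> (at x) v) ` K)"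
    using K continuous_on_subset[OF test_function_partial_continuous[OF assms] subset_UNIV]
    by (intro compact_imp_bounded compact_continuous_image)
  then obtain C where "\<And>x. x \<in> K \<Longrightarrow> \<bar>frechet_derivative \<phi> (at x) v\<bar> \<le> C" by (auto simp: bounded_iff)
  then have "\<bar>frechet_derivative \<phi> (at x) v\<bar> \<le> max C 0" for x
    using K(2)[of x] by (cases "x \<in> K") (auto simp: le_max_iff_disj)
  then show ?thesis using that by blast
qed

lemma test_function_partial_sum:
  assumes "\<phi> \<in> test_functions D"
  shows "frechet_derivative \<phi> (at x) v = (\<Sum>i\<in>UNIV. v $ i * frechet_derivative \<phi> (at x) (axis i 1))"
proof -
  interpret bounded_linear "frechet_derivative \<phi> (at x)"
    using test_function_has_derivative[OF assms] has_derivative_bounded_linear by blast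
  have "v = (\<Sum>i\<in>UNIV. v $ i *\<^sub>R axis i 1)"
    using basis_expansion[of v] by (simp add: scalar_mult_eq_scaleR)
  then have "frechet_derivative \<phi> (at x) v = frechet_derivative \<phi> (at x) (\<Sum>i\<in>UNIV. v $ i *\<^sub>R axis i 1)"
    by (rule arg_cong)
  then show ?thesis by (simp add: sum scaleR)
qed

lemma test_function_DERIV_along:
  assumes "\<phi> \<in> test_functions D"
  shows "((\<lambda>s. \<phi> (x + s *\<^sub>R v)) has_real_derivative frechet_derivative \<phi> (at (x + s *\<^sub>R v)) v) (at s)"
proof -
  interpret bounded_linear "frechet_derivative \<phi> (at (x + s *\<^sub>R v))"
    using test_function_has_derivative[OF assms] has_derivative_bounded_linear by blast
  have "(\<phi> \<circ> (\<lambda>s. x + s *\<^sub>R v) has_derivative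
      frechet_derivative \<phi> (at (x + s *\<^sub>R v)) \<circ> (\<lambda>h. h *\<^sub>R v)) (at s)"
    by (intro diff_chain_at test_function_has_derivative[OF assms])
      (auto intro!: derivative_eq_intros)
  then show ?thesis by (simp add: o_def scaleR has_field_derivative_def mult.commute[of _ "frechet_derivative _ _ _"])
qed

lemma test_function_lipschitz_along:
  assumes "\<phi> \<in> test_functions D"
  obtains C where "\<And>x t. \<bar>\<phi> (x + t *\<^sub>R v) - \<phi> x\<bar> \<le> C * \<bar>t\<bar>"
proof -
  obtain C where C: "\<And>x. \<bar>frechet_derivative \<phi> (at x) v\<bar> \<le> C"
    using test_function_partial_bounded[OF assms] by metis
  have "norm (\<phi> (x + t *\<^sub>R v) - \<phi> (x + 0 *\<^sub>R v)) \<le> C * norm (t - 0)" for x t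
    by (rule field_differentiable_bound[where S = UNIV])
      (use C test_function_DERIV_along[OF assms] in auto)
  then have "\<bar>\<phi> (x + t *\<^sub>R v) - \<phi> x\<bar> \<le> C * \<bar>t\<bar>" for x t by simp
  then show ?thesis by (rule that)
qed

lemma test_function_mult:
  assumes "\<phi> \<in> test_functions D" "\<And>k. Ck k \<psi>"
  shows "(\<lambda>x. \<phi> x * \<psi> x) \<in> test_functions D"
proof -
  have sub: "closure {x. \<phi> x * \<psi> x \<noteq> 0} \<subseteq> closure {x. \<phi> x \<noteq> 0}"
    by (rule closure_mono) auto
  then have "compact (closure {x. \<phi> x * \<psi> x \<noteq> 0})"
    using assms(1) by (auto simp: test_functions_def intro: bounded_subset)
  then show ?thesis
    using sub assms by (auto simp: test_functions_def Ck_mult)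
qed

lemma test_function_shift:
  assumes "\<phi> \<in> test_functions U" "\<And>x. x \<in> U \<Longrightarrow> x + y \<in> D"
  shows "(\<lambda>x. \<phi> (x - y)) \<in> test_functions D"
proof -
  have eq: "{x. \<phi> (x - y) \<noteq> 0} = (+) y ` {x. \<phi> x \<noteq> 0}"
    by (force simp: image_iff intro: exI[of _ "x - y" for x])
  have "compact (closure {x. \<phi> x \<noteq> 0})" "closure {x. \<phi> x \<noteq> 0} \<subseteq> U"
    using assms by (auto simp: test_functions_def)
  then have "compact (closure {x. \<phi> (x - y) \<noteq> 0})" "closure {x. \<phi> (x - y) \<noteq> 0} \<subseteq> D"
    using assms(2) compact_translation[of "closure {x. \<phi> x \<noteq> 0}" y]
    unfolding eq closure_translation by (auto simp: add.commute)
  then show ?thesis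
    using assms(1) by (auto simp: test_functions_def Ck_shift)
qed

lemma frechet_derivative_shift:
  assumes "\<phi> \<in> test_functions U"
  shows "frechet_derivative (\<lambda>x. \<phi> (x - y)) (at x) = frechet_derivative \<phi> (at (x - y))"
proof -
  have "(\<phi> \<circ> (\<lambda>x. x - y) has_derivative frechet_derivative \<phi> (at (x - y)) \<circ> (\<lambda>v. v)) (at x)"
    by (intro diff_chain_at test_function_has_derivative[OF assms]) (auto intro!: derivative_eq_intros)
  then have "((\<lambda>x. \<phi> (x - y)) has_derivative frechet_derivative \<phi> (at (x - y))) (at x)"
    by (simp add: o_def)
  then show ?thesis by (rule frechet_derivative_at[symmetric])
qed

section \<open>Differentiation under the integral sign\<close>

text \<open>
  The derivative is taken at one point and expressed by difference quotients, and the Lipschitz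
  bound is required only for \<open>|t| \<le> 1\<close>. For translates of a compactly supported function
  the dominating function can then be a multiple of the indicator of one bounded set.
\<close>

lemma integral_diff_quot_tendsto:
  fixes F :: "real \<Rightarrow> 'x \<Rightarrow> real"
  assumes int: "\<And>t. integrable N (F t)" and G: "integrable N G"
    and bound: "\<And>t w. \<bar>t\<bar> \<le> 1 \<Longrightarrow> w \<in> space N \<Longrightarrow> \<bar>F t w - F 0 w\<bar> \<le> \<bar>t\<bar> * G w"
    and lim: "\<And>w. w \<in> space N \<Longrightarrow> ((\<lambda>t. (F t w - F 0 w) / t) \<longlongrightarrow> F' w) (at 0)"
  shows "((\<lambda>t. ((\<integral>w. F t w \<partial>N) - (\<integral>w. F 0 w \<partial>N)) / t) \<longlongrightarrow> (\<integral>w. F' w \<partial>N)) (at 0)"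
proof -
  have seq: "(\<lambda>i. (F (X i) w - F 0 w) / X i) \<longlonglongrightarrow> F' w"
    if "\<forall>i. X i \<in> UNIV - {0}" "X \<longlonglongrightarrow> 0" "w \<in> space N" for X w
    using lim[OF that(3)] that(1,2) unfolding tendsto_at_iff_sequentially comp_def by auto
  have meas: "F' \<in> borel_measurable N"
  proof (rule borel_measurable_LIMSEQ_real)
    show "(\<lambda>i. (F (inverse (real (Suc i))) w - F 0 w) / inverse (real (Suc i))) \<longlonglongrightarrow> F' w"
      if "w \<in> space N" for w
      by (rule seq) (use that LIMSEQ_inverse_real_of_nat in auto)
  qed (use int in measurable)
  show ?thesis
    unfolding tendsto_at_iff_sequentially comp_def
  proof (intro allI impI)
    fix X :: "nat \<Rightarrow> real" assume X: "\<forall>i. X i \<in> UNIV - {0}" "X \<longlonglongrightarrow> 0"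
    obtain k where k: "\<bar>X i\<bar> \<le> 1" if "i \<ge> k" for i
      using LIMSEQ_D[OF X(2), of 1] by fastforce
    have "(\<lambda>i. \<integral>w. (F (X (i + k)) w - F 0 w) / X (i + k) \<partial>N) \<longlonglongrightarrow> (\<integral>w. F' w \<partial>N)"
    proof (rule integral_dominated_convergence[OF meas _ G])
      show "AE w in N. norm ((F (X (i + k)) w - F 0 w) / X (i + k)) \<le> G w" for i
        using X(1) bound[of "X (i + k)"] k[of "i + k"] by (intro AE_I2) (auto simp: field_simps)
      show "AE w in N. (\<lambda>i. (F (X (i + k)) w - F 0 w) / X (i + k)) \<longlonglongrightarrow> F' w"
        using seq[OF X] LIMSEQ_ignore_initial_segment by (intro AE_I2) blast
    qed (use int in auto)
    then have "(\<lambda>i. \<integral>w. (F (X i) w - F 0 w) / X i \<partial>N) \<longlonglongrightarrow> (\<integral>w. F' w \<partial>N)"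
      by (rule LIMSEQ_offset)
    then show "(\<lambda>i. ((\<integral>w. F (X i) w \<partial>N) - (\<integral>w. F 0 w \<partial>N)) / X i) \<longlonglongrightarrow> (\<integral>w. F' w \<partial>N)"
      using int by simp
  qed
qed

section \<open>Integrable functions\<close>

lemma integrable_bounded_mult:
  fixes f h :: "'x \<Rightarrow> real"
  assumes f: "integrable N f" and h: "h \<in> borel_measurable N" "\<And>x. \<bar>h x\<bar> \<le> C"
  shows "integrable N (\<lambda>x. h x * f x)"
proof (rule Bochner_Integration.integrable_bound)
  show "integrable N (\<lambda>x. C * f x)" using f by simp
  show "(\<lambda>x. h x * f x) \<in> borel_measurable N" using f h by simp
  have "\<bar>h x\<bar> \<le> \<bar>C\<bar>" for x using h(2)[of x] by linarith
  then show "AE x in N. norm (h x * f x) \<le> norm (C * f x)"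
    by (intro AE_I2) (simp add: abs_mult mult_right_mono)
qed

text \<open>
  The sets on which \<open>f\<close> integrates to zero form a Dynkin system, so an intersection-stable generator
  suffices. It is used with the open boxes of space and with the closed sets of \<open>\<Omega>\<close>.
\<close>

lemma AE_eq_0_if_generator:
  fixes f :: "'x \<Rightarrow> real"
  assumes f: "integrable N f" and G: "Int_stable G" "G \<subseteq> Pow (space N)" "sets N = sigma_sets (space N) G"
    and zero: "\<And>A. A \<in> G \<Longrightarrow> (\<integral>x. indicator A x * f x \<partial>N) = 0" "(\<integral>x. f x \<partial>N) = 0"
  shows "AE x in N. f x = 0"
proof (rule density_unique_real[OF f integrable_zero])
  have int: "integrable N (\<lambda>x. indicator A x * f x)" if "A \<in> sets N" for A
    using that f by (auto intro: integrable_real_mult_indicator simp: mult.commute)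
  fix A assume "A \<in> sets N"
  then have "A \<in> sigma_sets (space N) G" using G by simp
  with G(1,2) have "(\<integral>x. indicator A x * f x \<partial>N) = 0"
  proof (induction A rule: sigma_sets_induct_disjoint)
    case (basic A)
    then show ?case by (rule zero)
  next
    case empty
    then show ?case by simp
  next
    case (compl A)
    have "(\<integral>x. indicator (space N - A) x * f x \<partial>N) = (\<integral>x. f x - indicator A x * f x \<partial>N)"
      by (intro Bochner_Integration.integral_cong) (auto simp: indicator_def)
    then show ?case
      using compl int[of A] f zero(2) G(3) by simp
  next
    case (union A)
    have "(LINT x:(\<Union>i. A i)|N. f x) = (\<Sum>i. (LINT x:(A i)|N. f x))"
    proof (rule lebesgue_integral_countable_add)
      show "A i \<in> sets N" for i using union(2) G(3) by auto
      show "i \<noteq> j \<Longrightarrow> A i \<inter> A j = {}" for i j using union(1) by (auto simp: disjoint_family_on_def)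
      have "(\<Union>i. A i) \<in> sets N" using union(2) G(3) by (intro sets.countable_UN) auto
      then show "set_integrable N (\<Union>i. A i) f"
        unfolding set_integrable_def using int by simp
    qed
    then show ?case using union(3) by (simp add: set_lebesgue_integral_def)
  qed
  then show "(LINT x:A|N. f x) = (LINT x:A|N. 0)"
    by (simp add: set_lebesgue_integral_def)
qed

section \<open>The fundamental lemma of the calculus of variations\<close>

lemma flat_1: "flat 1 t = (if 0 < t then exp (- (1 / t)) else 0)"
  by (simp add: flat_def)

text \<open>
  The scaling by \<open>Suc n\<close> pushes \<open>exp (- 1/t)\<close> up to 1, so that these test functions increase to the
  indicator of the open box.
\<close>

definition box_bump :: "real^3 \<Rightarrow> real^3 \<Rightarrow> nat \<Rightarrow> real^3 \<Rightarrow> real" where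
  "box_bump a b n x = (\<Prod>i\<in>UNIV. flat 1 ((x $ i - a $ i) * Suc n) * flat 1 ((b $ i - x $ i) * Suc n))"

lemma box_bump_eq_0_iff: "box_bump a b n x = 0 \<longleftrightarrow> x \<notin> box a b"
  by (auto simp: box_bump_def flat_1 mem_box_cart zero_less_mult_iff)

lemma box_bump_bounds: "0 \<le> box_bump a b n x" "box_bump a b n x \<le> 1"
proof -
  have f: "0 \<le> flat 1 t" "flat 1 t \<le> 1" for t by (auto simp: flat_1)
  then show "0 \<le> box_bump a b n x" by (auto simp: box_bump_def intro!: prod_nonneg)
  show "box_bump a b n x \<le> 1" unfolding box_bump_def
    using f by (intro prod_le_1) (auto intro: mult_le_one)
qed

lemma box_bump_test_function:
  assumes "cbox a b \<subseteq> D"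
  shows "box_bump a b n \<in> test_functions D"
proof -
  have "Ck k (\<lambda>x. flat 1 ((x $ i - a $ i) * Suc n))" "Ck k (\<lambda>x. flat 1 ((b $ i - x $ i) * Suc n))" for k i
    using Ck_flat[of k "axis i (real (Suc n))" "- (a $ i * Suc n)"]
      Ck_flat[of k "axis i (- real (Suc n))" "b $ i * Suc n"]
    by (simp_all add: inner_axis algebra_simps)
  then have "Ck k (box_bump a b n)" for k
    unfolding box_bump_def[abs_def] by (intro Ck_prod Ck_mult) auto
  moreover have sub: "closure {x. box_bump a b n x \<noteq> 0} \<subseteq> cbox a b"
    unfolding box_bump_eq_0_iff using box_subset_cbox[of a b] by (intro closure_minimal) auto
  moreover have "compact (closure {x. box_bump a b n x \<noteq> 0})"
    using sub compact_cbox[of a b] by (metis closed_closure compact_Int_closed inf.absorb_iff2)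
  ultimately show ?thesis using assms by (auto simp: test_functions_def)
qed

lemma box_bump_tendsto: "(\<lambda>n. box_bump a b n x) \<longlonglongrightarrow> indicator (box a b) x"
proof (cases "x \<in> box a b")
  case True
  have "(\<lambda>n. flat 1 (t * Suc n)) \<longlonglongrightarrow> 1" if "t > 0" for t :: real
  proof -
    have "(\<lambda>n. exp (- (inverse t * inverse (real (Suc n))))) \<longlonglongrightarrow> exp (- (inverse t * 0))"
      by (intro tendsto_intros LIMSEQ_inverse_real_of_nat)
    moreover have "flat 1 (t * Suc n) = exp (- (inverse t * inverse (real (Suc n))))" for n
      using that by (simp add: flat_1 inverse_eq_divide del: of_nat_Suc)
    ultimately show ?thesis by simp
  qed
  then have "(\<lambda>n. box_bump a b n x) \<longlonglongrightarrow> (\<Prod>i\<in>(UNIV :: 3 set). 1 * 1)"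
    unfolding box_bump_def using True by (intro tendsto_prod tendsto_mult) (auto simp: mem_box_cart)
  then show ?thesis using True by simp
next
  case False
  then have "box_bump a b n x = 0" for n by (simp add: box_bump_eq_0_iff)
  then show ?thesis using False by simp
qed

lemma AE_lborel_negligible: "(AE x in lborel. P x) \<longleftrightarrow> negligible {x. \<not> P x}"
  for P :: "'a::euclidean_space \<Rightarrow> bool"
proof -
  have "(AE x in lborel. P x) \<longleftrightarrow> (AE x in lebesgue. P x)" by (rule AE_completion_iff[symmetric])
  also have "\<dots> \<longleftrightarrow> {x. \<not> P x} \<in> null_sets lebesgue"
  proof
    assume "AE x in lebesgue. P x"
    then obtain N where "N \<in> null_sets lebesgue" "{x. \<not> P x} \<subseteq> N"
      by (auto simp: eventually_ae_filter)
    then show "{x. \<not> P x} \<in> null_sets lebesgue"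
      using null_sets_completion_subset by blast
  next
    assume "{x. \<not> P x} \<in> null_sets lebesgue"
    then show "AE x in lebesgue. P x" by (rule AE_I') auto
  qed
  finally show ?thesis by (simp add: negligible_iff_null_sets)
qed

lemma AE_lborel_open_ex:
  assumes "open S" "S \<noteq> {}" "AE x in lborel. P x"
  obtains x where "x \<in> S" "P x"
proof -
  have "\<not> S \<subseteq> {x. \<not> P x}"
    using assms open_not_negligible negligible_subset unfolding AE_lborel_negligible by blast
  then show ?thesis using that by blast
qed

text \<open>
  By dominated convergence the bumps of a box show that \<open>g\<close> integrates to zero over every box whose
  closure lies in \<open>D\<close>. Inside such a box the smaller boxes generate the Borel sets, and \<open>D\<close> is a countable
  union of closed boxes.
\<close>

lemma fundamental_lemma_calculus_of_variations:
  fixes g :: "real^3 \<Rightarrow> real"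
  assumes D: "open D" and g: "integrable lborel g"
    and zero: "\<And>\<phi>. \<phi> \<in> test_functions D \<Longrightarrow> (\<integral>x. g x * \<phi> x \<partial>lborel) = 0"
  shows "AE x in lborel. x \<in> D \<longrightarrow> g x = 0"
proof -
  have [measurable]: "g \<in> borel_measurable borel" using g by auto
  have box_zero: "(\<integral>x. indicator (box a b) x * g x \<partial>lborel) = 0" if "cbox a b \<subseteq> D" for a b
  proof -
    have "(\<lambda>n. \<integral>x. g x * box_bump a b n x \<partial>lborel) \<longlonglongrightarrow> (\<integral>x. g x * indicator (box a b) x \<partial>lborel)"
    proof (rule integral_dominated_convergence[where w = "\<lambda>x. \<bar>g x\<bar>"])
      have "box_bump a b n \<in> borel_measurable borel" for n
        using test_function_continuous[OF box_bump_test_function[OF that]]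
        by (rule borel_measurable_continuous_onI)
      then show "(\<lambda>x. g x * box_bump a b n x) \<in> borel_measurable lborel" for n by simp
      show "AE x in lborel. norm (g x * box_bump a b n x) \<le> \<bar>g x\<bar>" for n
        using box_bump_bounds by (intro AE_I2) (auto simp: abs_mult mult_left_le)
      show "AE x in lborel. (\<lambda>n. g x * box_bump a b n x) \<longlonglongrightarrow> g x * indicator (box a b) x"
        by (intro AE_I2 tendsto_intros box_bump_tendsto)
    qed (use g in auto)
    then show ?thesis
      using zero[OF box_bump_test_function[OF that]] by (simp add: LIMSEQ_const_iff mult.commute)
  qed
  have AE_box: "AE x in lborel. x \<in> cbox a b \<longrightarrow> g x = 0" if ab: "cbox a b \<subseteq> D" for a b
  proof -
    have "AE x in lborel. indicator (box a b) x * g x = 0"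
    proof (rule AE_eq_0_if_generator[where G = "range (\<lambda>(a, b). box a b)"])
      show "integrable lborel (\<lambda>x. indicator (box a b) x * g x)"
        using integrable_real_mult_indicator[OF _ g] by (simp add: mult.commute)
      show "Int_stable (range (\<lambda>(a, b). box a b :: (real^3) set))"
        by (auto simp: Int_stable_def box_Int_box)
      show "sets lborel = sigma_sets (space lborel) (range (\<lambda>(a, b). box a b :: (real^3) set))"
        by (simp add: borel_eq_box)
      show "(\<integral>x. indicator (box a b) x * g x \<partial>lborel) = 0" by (rule box_zero[OF ab])
      fix A assume "A \<in> range (\<lambda>(a, b). box a b :: (real^3) set)"
      then obtain c d where "A = box c d" by auto
      moreover obtain c' d' where "box c d \<inter> box a b = box c' d'"
        by (auto simp: box_Int_box)
      ultimately have A: "A \<inter> box a b = box c' d'" by simp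
      have "(\<integral>x. indicator (box c' d') x * g x \<partial>lborel) = 0"
      proof (cases "box c' d' = {}")
        case False
        then have "cbox c' d' \<subseteq> cbox a b"
          using A by (metis closure_box closure_minimal closed_cbox box_subset_cbox inf_le2 order_trans)
        then show ?thesis using box_zero ab by blast
      qed simp
      then show "(\<integral>x. indicator A x * (indicator (box a b) x * g x) \<partial>lborel) = 0"
        unfolding A[symmetric] by (simp add: indicator_inter_arith mult.assoc)
    qed auto
    moreover have "AE x in lborel. x \<notin> cbox a b - box a b"
      using negligible_frontier_interval[of a b] by (simp add: AE_lborel_negligible set_diff_eq)
    ultimately show ?thesis by eventually_elim (auto simp: indicator_def)
  qed
  obtain \<D> where \<D>: "countable \<D>" "\<D> \<subseteq> Pow D" "\<And>X. X \<in> \<D> \<Longrightarrow> \<exists>a b. X = cbox a b" "\<Union>\<D> = D"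
    using open_countable_Union_open_cbox[OF D] by auto
  have "AE x in lborel. x \<in> X \<longrightarrow> g x = 0" if "X \<in> \<D>" for X
  proof -
    from \<D>(3)[OF that] obtain a b where "X = cbox a b" by auto
    moreover have "X \<subseteq> D" using \<D>(2) that by auto
    ultimately show ?thesis using AE_box[of a b] by simp
  qed
  then have "AE x in lborel. \<forall>X\<in>\<D>. x \<in> X \<longrightarrow> g x = 0"
    unfolding AE_ball_countable[OF \<D>(1)] by blast
  then show ?thesis using \<D>(4) by (auto elim!: eventually_mono)
qed

section \<open>Integration by parts and functions with vanishing weak gradient\<close>

lemma
  fixes g :: "real^3 \<Rightarrow> real"
  assumes g: "integrable lborel g" and \<phi>: "\<phi> \<in> test_functions D"
  shows integrable_mult_test_function: "integrable lborel (\<lambda>x. g x * \<phi> x)"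
    and integrable_mult_test_function_partial:
      "integrable lborel (\<lambda>x. g x * frechet_derivative \<phi> (at x) v)"
proof -
  obtain C where C: "\<And>x. \<bar>\<phi> x\<bar> \<le> C" using test_function_bounded[OF \<phi>] by metis
  have "\<phi> \<in> borel_measurable lborel"
    using borel_measurable_continuous_onI[OF test_function_continuous[OF \<phi>]] by simp
  from integrable_bounded_mult[OF g this C] show "integrable lborel (\<lambda>x. g x * \<phi> x)"
    by (simp add: mult.commute)
  obtain C' where C': "\<And>x. \<bar>frechet_derivative \<phi> (at x) v\<bar> \<le> C'"
    using test_function_partial_bounded[OF \<phi>] by metis
  have "(\<lambda>x. frechet_derivative \<phi> (at x) v) \<in> borel_measurable lborel"
    using borel_measurable_continuous_onI[OF test_function_partial_continuous[OF \<phi>]] by simp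
  from integrable_bounded_mult[OF g this C']
  show "integrable lborel (\<lambda>x. g x * frechet_derivative \<phi> (at x) v)"
    by (simp add: mult.commute)
qed

lemma integral_lborel_shift:
  fixes f :: "'a::euclidean_space \<Rightarrow> real"
  assumes "f \<in> borel_measurable borel"
  shows "(\<integral>x. f (y + x) \<partial>lborel) = (\<integral>x. f x \<partial>lborel)"
proof -
  have "(\<integral>x. f x \<partial>distr lborel borel ((+) y)) = (\<integral>x. f (y + x) \<partial>lborel)"
    using assms by (intro integral_distr) auto
  then show ?thesis by (simp add: lborel_distr_plus)
qed

lemma integrable_lborel_shift:
  fixes f :: "'a::euclidean_space \<Rightarrow> real"
  assumes "integrable lborel f"
  shows "integrable lborel (\<lambda>x. f (y + x))"
proof -
  have "integrable (distr lborel borel ((+) y)) f \<longleftrightarrow> integrable lborel (\<lambda>x. f (y + x))"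
    using assms by (intro integrable_distr_eq) auto
  then show ?thesis using assms by (simp add: lborel_distr_plus)
qed

text \<open>
  The integral of a translate does not depend on the translation, so its derivative is zero. This
  gives integration by parts without iterated integrals.
\<close>

lemma integral_test_function_partial:
  assumes \<phi>: "\<phi> \<in> test_functions D"
  shows "(\<integral>x. frechet_derivative \<phi> (at x) v \<partial>lborel) = 0"
proof -
  obtain K where K: "compact K" "\<And>x. x \<notin> K \<Longrightarrow> \<phi> x = 0"
    using test_function_compact_support[OF \<phi>] by metis
  obtain C where C: "\<And>x t. \<bar>\<phi> (x + t *\<^sub>R v) - \<phi> x\<bar> \<le> C * \<bar>t\<bar>"
    using test_function_lipschitz_along[OF \<phi>] by metis
  obtain R where R: "\<And>x. x \<in> K \<Longrightarrow> norm x \<le> R"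
    using compact_imp_bounded[OF K(1)] by (auto simp: bounded_iff)
  have meas: "\<phi> \<in> borel_measurable borel"
    by (intro borel_measurable_continuous_onI test_function_continuous[OF \<phi>])
  have "integrable lborel (\<lambda>x. indicator K x * \<phi> x)"
    using borel_integrable_compact[OF K(1) continuous_on_subset[OF test_function_continuous[OF \<phi>] subset_UNIV]]
    by (simp add: set_integrable_def)
  moreover have "(\<lambda>x. indicator K x * \<phi> x) = \<phi>" using K(2) by (force simp: indicator_def)
  ultimately have int: "integrable lborel \<phi>" by simp
  define B where "B = cball (0 :: real^3) (R + norm v)"
  have "((\<lambda>t. ((\<integral>x. \<phi> (x + t *\<^sub>R v) \<partial>lborel) - (\<integral>x. \<phi> (x + 0 *\<^sub>R v) \<partial>lborel)) / t)
      \<longlongrightarrow> (\<integral>x. frechet_derivative \<phi> (at x) v \<partial>lborel)) (at 0)"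
  proof (rule integral_diff_quot_tendsto)
    show "integrable lborel (\<lambda>x. \<phi> (x + t *\<^sub>R v))" for t
      using integrable_lborel_shift[OF int, of "t *\<^sub>R v"] by (simp add: add.commute)
    show "integrable lborel (\<lambda>x. C * indicator B x)"
      using emeasure_lborel_cball_finite[of 0 "R + norm v"] by (auto simp: B_def)
    show "\<bar>\<phi> (x + t *\<^sub>R v) - \<phi> (x + 0 *\<^sub>R v)\<bar> \<le> \<bar>t\<bar> * (C * indicator B x)" if t: "\<bar>t\<bar> \<le> 1" for t x
    proof (cases "x \<in> B")
      case False
      have "norm x \<le> norm (x + t *\<^sub>R v) + norm (t *\<^sub>R v)"
        by (metis add_diff_cancel norm_triangle_ineq4)
      moreover have "norm (t *\<^sub>R v) \<le> norm v" using t by (simp add: mult_left_le_one_le)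
      ultimately have "x \<notin> K" "x + t *\<^sub>R v \<notin> K"
        using False R[of x] R[of "x + t *\<^sub>R v"] norm_ge_zero[of v] by (auto simp: B_def)
      then show ?thesis using K(2) False by simp
    qed (use C in \<open>auto simp: mult.commute\<close>)
    show "((\<lambda>t. (\<phi> (x + t *\<^sub>R v) - \<phi> (x + 0 *\<^sub>R v)) / t) \<longlongrightarrow> frechet_derivative \<phi> (at x) v) (at 0)" for x
      using test_function_DERIV_along[OF \<phi>, of x v 0] by (simp add: DERIV_def)
  qed
  moreover have "(\<integral>x. \<phi> (x + t *\<^sub>R v) \<partial>lborel) = (\<integral>x. \<phi> x \<partial>lborel)" for t
    using integral_lborel_shift[OF meas, of "t *\<^sub>R v"] by (simp add: add.commute)
  ultimately have "((\<lambda>t::real. 0) \<longlongrightarrow> (\<integral>x. frechet_derivative \<phi> (at x) v \<partial>lborel)) (at 0)" by simp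
  then show ?thesis by (simp add: tendsto_const_iff)
qed

lemma frechet_derivative_mult_test_function:
  assumes \<phi>: "\<phi> \<in> test_functions D" and \<psi>: "(\<psi> has_derivative \<psi>') (at x)"
  shows "frechet_derivative (\<lambda>x. \<phi> x * \<psi> x) (at x) v
    = frechet_derivative \<phi> (at x) v * \<psi> x + \<phi> x * \<psi>' v"
proof -
  have "((\<lambda>x. \<phi> x * \<psi> x) has_derivative (\<lambda>v. \<phi> x * \<psi>' v + frechet_derivative \<phi> (at x) v * \<psi> x)) (at x)"
    by (intro has_derivative_mult test_function_has_derivative[OF \<phi>] \<psi>)
  from frechet_derivative_at[OF this, symmetric] show ?thesis by simp
qed

text \<open>
  Moving a test function along the segment from \<open>0\<close> to \<open>y\<close> changes its pairing with \<open>g\<close> at the rate of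
  the pairing with a directional derivative, which is zero as long as the support stays in \<open>D\<close>.
\<close>

lemma integral_mult_shifted_test_function:
  fixes g :: "real^3 \<Rightarrow> real"
  assumes g: "integrable lborel g"
    and zero: "\<And>\<phi> i. \<phi> \<in> test_functions D \<Longrightarrow> (\<integral>x. g x * frechet_derivative \<phi> (at x) (axis i 1) \<partial>lborel) = 0"
    and \<phi>: "\<phi> \<in> test_functions U"
    and U: "\<And>t x. t \<in> {0..1} \<Longrightarrow> x \<in> U \<Longrightarrow> x + t *\<^sub>R y \<in> D"
  shows "(\<integral>x. g x * \<phi> (x - y) \<partial>lborel) = (\<integral>x. g x * \<phi> x \<partial>lborel)"
proof -
  define h where "h t = (\<integral>x. g x * \<phi> (x + t *\<^sub>R (- y)) \<partial>lborel)" for t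
  have UNIV: "\<phi> \<in> test_functions UNIV" using \<phi> by (auto simp: test_functions_def)
  have shift_UNIV: "(\<lambda>x. \<phi> (x + t *\<^sub>R (- y))) \<in> test_functions UNIV" for t
    using test_function_shift[OF UNIV, of "t *\<^sub>R y"] by simp
  obtain C where C: "\<And>x t. \<bar>\<phi> (x + t *\<^sub>R (- y)) - \<phi> x\<bar> \<le> C * \<bar>t\<bar>"
    using test_function_lipschitz_along[OF \<phi>, of "- y"] by metis
  have "(h has_real_derivative 0) (at t)" if t: "t \<in> {0..1}" for t
  proof -
    have shift: "(\<lambda>x. \<phi> (x - t *\<^sub>R y)) \<in> test_functions D"
      using U t by (intro test_function_shift[OF \<phi>]) auto
    have "((\<lambda>s. ((\<integral>x. g x * \<phi> (x + (t + s) *\<^sub>R (- y)) \<partial>lborel) - (\<integral>x. g x * \<phi> (x + (t + 0) *\<^sub>R (- y)) \<partial>lborel)) / s)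
        \<longlongrightarrow> (\<integral>x. g x * frechet_derivative \<phi> (at (x - t *\<^sub>R y)) (- y) \<partial>lborel)) (at 0)"
    proof (rule integral_diff_quot_tendsto)
      show "integrable lborel (\<lambda>x. g x * \<phi> (x + (t + s) *\<^sub>R (- y)))" for s
        by (intro integrable_mult_test_function[OF g shift_UNIV])
      show "integrable lborel (\<lambda>x. C * \<bar>g x\<bar>)" using g by simp
      have *: "x + (t + s) *\<^sub>R (- y) = (x - t *\<^sub>R y) + s *\<^sub>R (- y)" for x s by (simp add: algebra_simps)
      show "\<bar>g x * \<phi> (x + (t + s) *\<^sub>R (- y)) - g x * \<phi> (x + (t + 0) *\<^sub>R (- y))\<bar> \<le> \<bar>s\<bar> * (C * \<bar>g x\<bar>)" for s x
      proof -
        have "\<bar>g x\<bar> * \<bar>\<phi> (x - t *\<^sub>R y + s *\<^sub>R (- y)) - \<phi> (x - t *\<^sub>R y)\<bar> \<le> \<bar>g x\<bar> * (C * \<bar>s\<bar>)"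
          by (intro mult_left_mono C) auto
        then show ?thesis unfolding * right_diff_distrib[symmetric] abs_mult by (simp add: mult_ac)
      qed
      show "((\<lambda>s. (g x * \<phi> (x + (t + s) *\<^sub>R (- y)) - g x * \<phi> (x + (t + 0) *\<^sub>R (- y))) / s)
          \<longlongrightarrow> g x * frechet_derivative \<phi> (at (x - t *\<^sub>R y)) (- y)) (at 0)" for x
        unfolding * right_diff_distrib[symmetric] times_divide_eq_right[symmetric]
        using test_function_DERIV_along[OF \<phi>, of "x - t *\<^sub>R y" "- y" 0]
        by (intro tendsto_mult tendsto_const) (simp add: DERIV_def)
    qed
    moreover have "(\<integral>x. g x * frechet_derivative \<phi> (at (x - t *\<^sub>R y)) (- y) \<partial>lborel) = 0"
    proof -
      have "(\<integral>x. g x * frechet_derivative \<phi> (at (x - t *\<^sub>R y)) (- y) \<partial>lborel)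
          = (\<integral>x. (\<Sum>i\<in>UNIV. (- y) $ i * (g x * frechet_derivative (\<lambda>x. \<phi> (x - t *\<^sub>R y)) (at x) (axis i 1))) \<partial>lborel)"
        unfolding frechet_derivative_shift[OF \<phi>]
        by (subst test_function_partial_sum[OF \<phi>]) (simp add: sum_distrib_left mult_ac)
      also have "\<dots> = 0"
        by (subst Bochner_Integration.integral_sum)
          (use integrable_mult_test_function_partial[OF g shift] zero[OF shift] in auto)
      finally show ?thesis .
    qed
    ultimately show ?thesis by (simp add: DERIV_def h_def)
  qed
  then have "\<exists>c. \<forall>t\<in>{0..1}. h t = c"
    by (intro has_field_derivative_zero_constant) (auto intro: has_field_derivative_at_within)
  then have "h 1 = h 0" by force
  then show ?thesis by (simp add: h_def)
qed

text \<open>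
  Near a point of \<open>D\<close> every small translate of \<open>g\<close> has the same pairings with test functions as \<open>g\<close>, so
  for each small \<open>y\<close> the equation \<open>g (x + y) = g x\<close> holds for almost every \<open>x\<close>. By Fubini's theorem there is
  one \<open>x\<close> for which it holds for almost every \<open>y\<close>, which means that \<open>g\<close> is locally constant almost everywhere.
  Connectedness makes the local constants agree.
\<close>

lemma weak_gradient_zero_imp_const:
  fixes g :: "real^3 \<Rightarrow> real"
  assumes D: "open D" "connected D" and g: "integrable lborel g"
    and zero: "\<And>\<phi> i. \<phi> \<in> test_functions D \<Longrightarrow> (\<integral>x. g x * frechet_derivative \<phi> (at x) (axis i 1) \<partial>lborel) = 0"
  obtains c where "AE x in lborel. x \<in> D \<longrightarrow> g x = c"
proof -
  have [measurable]: "g \<in> borel_measurable borel" using g by auto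
  have "\<exists>r c. r > 0 \<and> (AE z in lborel. z \<in> ball p r \<longrightarrow> g z = c)" if "p \<in> D" for p
  proof -
    obtain R where R: "R > 0" "ball p R \<subseteq> D" using D(1) \<open>p \<in> D\<close> open_contains_ball by blast
    \<comment> \<open>Points of the ball of radius \<open>r\<close> stay in \<open>D\<close> when they are moved by less than \<open>r\<close>.\<close>
    define r where "r = R / 2"
    have r: "r > 0" using R by (simp add: r_def)
    have near: "x + y \<in> D" if "x \<in> ball p r" "norm y < r" for x y
    proof -
      have "dist p (x + y) \<le> dist p x + norm y" by (metis add_diff_cancel_left' dist_norm dist_triangle norm_minus_commute)
      then show ?thesis using that R(2) by (auto simp: r_def)
    qed
    have shift: "AE x in lborel. x \<in> ball p r \<longrightarrow> g (y + x) - g x = 0" if y: "norm y < r" for y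
    proof (rule fundamental_lemma_calculus_of_variations)
      show "integrable lborel (\<lambda>x. g (y + x) - g x)"
        using integrable_lborel_shift[OF g] g by simp
      fix \<phi> :: "real^3 \<Rightarrow> real" assume \<phi>: "\<phi> \<in> test_functions (ball p r)"
      have [measurable]: "\<phi> \<in> borel_measurable borel"
        by (intro borel_measurable_continuous_onI test_function_continuous[OF \<phi>])
      have "(\<integral>x. g (y + x) * \<phi> x \<partial>lborel) = (\<integral>x. g x * \<phi> (x - y) \<partial>lborel)"
        using integral_lborel_shift[of "\<lambda>x. g x * \<phi> (x - y)" y] by simp
      also have "\<dots> = (\<integral>x. g x * \<phi> x \<partial>lborel)"
      proof (rule integral_mult_shifted_test_function[OF g zero \<phi>])
        show "x + t *\<^sub>R y \<in> D" if "t \<in> {0..1}" "x \<in> ball p r" for t x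
          using that y mult_left_le_one_le[of "norm y" t] by (intro near) auto
      qed
      finally show "(\<integral>x. (g (y + x) - g x) * \<phi> x \<partial>lborel) = 0"
        using integrable_mult_test_function[OF g \<phi>]
          integrable_mult_test_function[OF integrable_lborel_shift[OF g, of y] \<phi>]
        by (simp add: left_diff_distrib)
    qed simp
    have "AE y in lborel. AE x in lborel. norm y < r \<longrightarrow> x \<in> ball p r \<longrightarrow> g (y + x) = g x"
    proof (rule AE_I2)
      show "AE x in lborel. norm y < r \<longrightarrow> x \<in> ball p r \<longrightarrow> g (y + x) = g x" for y
        using shift[of y] by (cases "norm y < r") auto
    qed
    moreover have "{z \<in> space (lborel \<Otimes>\<^sub>M lborel). norm (fst z) < r \<longrightarrow> snd z \<in> ball p r
        \<longrightarrow> g (fst z + snd z) = g (snd z)} \<in> sets (lborel \<Otimes>\<^sub>M lborel)"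
    proof -
      have [measurable]: "(\<lambda>z. g (fst z + snd z)) \<in> borel_measurable (lborel \<Otimes>\<^sub>M lborel)"
          "(\<lambda>z. g (snd z)) \<in> borel_measurable (lborel \<Otimes>\<^sub>M lborel)"
        by simp_all
      show ?thesis unfolding mem_ball by measurable
    qed
    ultimately have "AE x in lborel. AE y in lborel. norm y < r \<longrightarrow> x \<in> ball p r \<longrightarrow> g (y + x) = g x"
      using lborel_pair.AE_commute[of "\<lambda>y x. norm y < r \<longrightarrow> x \<in> ball p r \<longrightarrow> g (y + x) = g x"] by blast
    then obtain x where x: "x \<in> ball p (r / 2)"
        "AE y in lborel. norm y < r \<longrightarrow> x \<in> ball p r \<longrightarrow> g (y + x) = g x"
      using AE_lborel_open_ex[of "ball p (r / 2)"] r by (metis (no_types, lifting) ball_eq_empty half_gt_zero not_le open_ball)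
    then have "AE y in distr lborel borel ((+) (- x)). norm y < r \<longrightarrow> g (y + x) = g x"
      unfolding lborel_distr_plus using r by auto
    then have "AE z in lborel. norm (- x + z) < r \<longrightarrow> g (- x + z + x) = g x"
      by (subst (asm) AE_distr_iff) auto
    then have "AE z in lborel. z \<in> ball p (r / 2) \<longrightarrow> g z = g x"
    proof eventually_elim
      case (elim z)
      show ?case
      proof
        assume "z \<in> ball p (r / 2)"
        then have "dist x z < r" using x(1) dist_triangle[of x z p] by (simp add: dist_commute)
        then have "norm (- x + z) < r" by (simp add: dist_norm norm_minus_commute)
        then show "g z = g x" using elim by simp
      qed
    qed
    then show ?thesis using r by (intro exI[of _ "r / 2"] exI[of _ "g x"]) simp
  qed
  then have "\<forall>p\<in>D. \<exists>s. fst s > 0 \<and> (AE z in lborel. z \<in> ball p (fst s) \<longrightarrow> g z = snd s)" by auto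
  from bchoice[OF this] obtain s where
    s: "\<forall>p\<in>D. fst (s p) > 0 \<and> (AE z in lborel. z \<in> ball p (fst (s p)) \<longrightarrow> g z = snd (s p))" ..
  define r c where "r p = fst (s p)" and "c p = snd (s p)" for p
  have r: "r p > 0" and c: "AE z in lborel. z \<in> ball p (r p) \<longrightarrow> g z = c p" if "p \<in> D" for p
    using s that by (auto simp: r_def c_def)
  \<comment> \<open>Overlapping balls meet in an open set of positive measure, where both constants are attained.\<close>
  have "c constant_on D"
  proof (rule locally_constant_imp_constant[OF D(2)])
    fix p assume p: "p \<in> D"
    have "c q = c p" if q: "q \<in> D" "q \<in> ball p (r p)" for q
    proof -
      have "AE z in lborel. (z \<in> ball p (r p) \<longrightarrow> g z = c p) \<and> (z \<in> ball q (r q) \<longrightarrow> g z = c q)"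
        using c[OF p] c[OF q(1)] by eventually_elim auto
      moreover have "ball p (r p) \<inter> ball q (r q) \<noteq> {}" using q r by auto
      ultimately obtain z where "z \<in> ball p (r p) \<inter> ball q (r q)"
          "(z \<in> ball p (r p) \<longrightarrow> g z = c p) \<and> (z \<in> ball q (r q) \<longrightarrow> g z = c q)"
        using AE_lborel_open_ex[OF open_Int[OF open_ball open_ball]] by blast
      then show ?thesis by auto
    qed
    then have "\<forall>q\<in>D \<inter> ball p (r p). c q = c p" by blast
    moreover have "openin (top_of_set D) (D \<inter> ball p (r p))" "p \<in> D \<inter> ball p (r p)"
      using p r by (auto intro: openin_open_Int)
    ultimately show "\<exists>T. openin (top_of_set D) T \<and> p \<in> T \<and> (\<forall>q\<in>T. c q = c p)"
      by blast
  qed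
  then obtain c0 where c0: "\<And>p. p \<in> D \<Longrightarrow> c p = c0" by (auto simp: constant_on_def)
  obtain \<F> where \<F>: "\<F> \<subseteq> (\<lambda>p. ball p (r p)) ` D" "countable \<F>" "\<Union>\<F> = \<Union>((\<lambda>p. ball p (r p)) ` D)"
    using Lindelof[of "(\<lambda>p. ball p (r p)) ` D"] by auto
  have "AE z in lborel. \<forall>B\<in>\<F>. z \<in> B \<longrightarrow> g z = c0"
  proof (subst AE_ball_countable[OF \<F>(2)], rule ballI)
    fix B assume "B \<in> \<F>"
    then obtain p where "p \<in> D" "B = ball p (r p)" using \<F>(1) by blast
    then show "AE z in lborel. z \<in> B \<longrightarrow> g z = c0" using c c0 by simp
  qed
  moreover have "D \<subseteq> \<Union>\<F>" unfolding \<F>(3) using r by force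
  ultimately have "AE z in lborel. z \<in> D \<longrightarrow> g z = c0" by (auto elim!: eventually_mono)
  then show ?thesis by (rule that)
qed

section \<open>Measure preserving continuous flows\<close>

lemma borel_measurable_entry:
  fixes f :: "'x \<Rightarrow> real^'n^'m"
  assumes "f \<in> borel_measurable N"
  shows "(\<lambda>w. f w $ i) \<in> borel_measurable N" "(\<lambda>w. f w $ i $ j) \<in> borel_measurable N"
proof -
  have c: "(\<lambda>A :: real^'n^'m. A $ i) \<in> borel_measurable borel" "(\<lambda>A :: real^'n^'m. A $ i $ j) \<in> borel_measurable borel"
    by (intro borel_measurable_continuous_onI continuous_intros)+
  show "(\<lambda>w. f w $ i) \<in> borel_measurable N" "(\<lambda>w. f w $ i $ j) \<in> borel_measurable N"
    using measurable_compose[OF assms c(1)] measurable_compose[OF assms c(2)] by simp_all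
qed

lemma entry_le_norm: "\<bar>A $ i $ j\<bar> \<le> norm A" for A :: "real^'n^'m"
  using component_le_norm_cart[of "A $ i" j] Finite_Cartesian_Product.norm_nth_le[of A i] by linarith

lemma L2_entry:
  fixes f :: "'x \<Rightarrow> real^'n^'m"
  assumes "f \<in> L2 N"
  shows "(\<lambda>w. f w $ i $ j) \<in> borel_measurable N" "integrable N (\<lambda>w. (f w $ i $ j)\<^sup>2)"
proof -
  show m: "(\<lambda>w. f w $ i $ j) \<in> borel_measurable N"
    using assms borel_measurable_entry by (auto simp: L2_def)
  have "(f w $ i $ j)\<^sup>2 \<le> (norm (f w))\<^sup>2" for w
    using entry_le_norm[of "f w" i j] by (metis abs_le_square_iff abs_norm_cancel)
  then have "AE w in N. norm ((f w $ i $ j)\<^sup>2) \<le> norm ((norm (f w))\<^sup>2)" by simp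
  moreover have "integrable N (\<lambda>w. (norm (f w))\<^sup>2)" using assms by (simp add: L2_def)
  moreover have "(\<lambda>w. (f w $ i $ j)\<^sup>2) \<in> borel_measurable N" using m by simp
  ultimately show "integrable N (\<lambda>w. (f w $ i $ j)\<^sup>2)"
    using Bochner_Integration.integrable_bound by blast
qed

lemma L2_diff:
  assumes "f \<in> L2 N" "g \<in> L2 N"
  shows "(\<lambda>w. f w - g w) \<in> L2 N"
proof -
  have m: "(\<lambda>w. f w - g w) \<in> borel_measurable N" using assms by (auto simp: L2_def)
  have "(norm (x - y))\<^sup>2 \<le> 2 * (norm x)\<^sup>2 + 2 * (norm y)\<^sup>2" for x y :: 'b
    using inner_ge_zero[of "x + y"] by (simp add: power2_norm_eq_inner inner_simps inner_commute)
  then have "AE w in N. norm ((norm (f w - g w))\<^sup>2) \<le> norm (2 * (norm (f w))\<^sup>2 + 2 * (norm (g w))\<^sup>2)" by simp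
  moreover have "integrable N (\<lambda>w. 2 * (norm (f w))\<^sup>2 + 2 * (norm (g w))\<^sup>2)"
    using assms by (simp add: L2_def)
  moreover have "(\<lambda>w. (norm (f w - g w))\<^sup>2) \<in> borel_measurable N" using m by simp
  ultimately have "integrable N (\<lambda>w. (norm (f w - g w))\<^sup>2)"
    using Bochner_Integration.integrable_bound by blast
  then show ?thesis using m by (simp add: L2_def)
qed

context ergodic_system
begin

lemma space_M: "space M = UNIV"
proof -
  obtain N where N: "sets N = sets borel" "M = completion N" using borel_completion by blast
  show ?thesis using sets_eq_imp_space_eq[OF N(1)] by (simp add: N(2))
qed

lemma borel_measurable_M: "f \<in> borel_measurable borel \<Longrightarrow> f \<in> borel_measurable M"
proof -
  assume f: "f \<in> borel_measurable borel"
  obtain N where N: "sets N = sets borel" "M = completion N" using borel_completion by blast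
  have "f \<in> borel_measurable N" using f measurable_cong_sets[OF N(1) refl] by blast
  then show ?thesis unfolding N(2) by (rule measurable_completion)
qed

lemma continuous_measurable_M:
  fixes f :: "'w \<Rightarrow> 'b::topological_space"
  shows "continuous_on UNIV f \<Longrightarrow> f \<in> borel_measurable M"
  by (intro borel_measurable_M borel_measurable_continuous_onI)

lemma continuous_bounded_ex:
  fixes f :: "'w \<Rightarrow> 'b::real_normed_vector"
  assumes "continuous_on UNIV f"
  obtains C where "\<And>w. norm (f w) \<le> C"
  using compact_imp_bounded[OF compact_continuous_image[OF assms compact_space]] by (auto simp: bounded_iff)

lemma continuous_integrable_M:
  fixes f :: "'w \<Rightarrow> real"
  assumes "continuous_on UNIV f"
  shows "integrable M f"
proof -
  obtain C where "\<And>w. norm (f w) \<le> C" using continuous_bounded_ex[OF assms] by metis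
  then show ?thesis
    by (intro integrable_const_bound[of _ C] continuous_measurable_M[OF assms]) auto
qed

lemma distr_T: "distr M M (T x) = M"
proof (rule measure_eqI)
  fix A assume "A \<in> sets (distr M M (T x))"
  then have "A \<in> sets M" by simp
  then show "emeasure (distr M M (T x)) A = emeasure M A"
    using T_invariant T_measurable by (simp add: emeasure_distr emeasure_eq_measure)
qed simp

lemma integral_T:
  fixes f :: "'w \<Rightarrow> real"
  assumes "f \<in> borel_measurable M"
  shows "(\<integral>w. f (T x w) \<partial>M) = (\<integral>w. f w \<partial>M)"
  using integral_distr[OF T_measurable[of x] assms] by (simp add: distr_T)

lemma integrable_T:
  fixes f :: "'w \<Rightarrow> real"
  assumes "integrable M f"
  shows "integrable M (\<lambda>w. f (T x w))"
  using integrable_distr_eq[OF T_measurable[of x], of f] assms by (simp add: distr_T)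

lemma AE_T:
  assumes "AE w in M. P w"
  shows "AE w in M. P (T x w)"
proof -
  obtain N where N: "{w. \<not> P w} \<subseteq> N" "emeasure M N = 0" "N \<in> sets M"
    using AE_E[OF assms] space_M by auto
  have "emeasure M (T x -` N \<inter> space M) = emeasure (distr M M (T x)) N"
    using N T_measurable by (simp add: emeasure_distr)
  then have "T x -` N \<inter> space M \<in> null_sets M"
    using N distr_T measurable_sets[OF T_measurable] by auto
  then show ?thesis by (rule AE_I') (use N in auto)
qed

lemma T_cancel: "T x (T (- x) w) = w" "T (- x) (T x w) = w"
  using T_add[of x "- x"] T_add[of "- x" x] T_zero by (auto simp: fun_eq_iff)

lemma continuous_T:
  fixes u :: "'w \<Rightarrow> 'b::topological_space"
  assumes "continuous_on UNIV u"
  shows "continuous_on UNIV (\<lambda>(x, w). u (T x w))"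
proof -
  have "continuous_on UNIV (u \<circ> (\<lambda>(x, w). T x w))"
    using T_jointly_continuous assms by (intro continuous_on_compose) (auto intro: continuous_on_subset)
  then show ?thesis by (simp add: o_def case_prod_beta)
qed

lemma continuous_T_slice:
  fixes u :: "'w \<Rightarrow> 'b::topological_space"
  assumes "continuous_on UNIV u"
  shows "continuous_on UNIV (\<lambda>w. u (T x w))"
    "continuous_on UNIV (\<lambda>s. u (T (s *\<^sub>R v) w))"
proof -
  show "continuous_on UNIV (\<lambda>w. u (T x w))"
    using continuous_on_compose2[OF continuous_T[OF assms], of UNIV "\<lambda>w. (x, w)"]
    by (simp add: continuous_on_Pair)
  show "continuous_on UNIV (\<lambda>s. u (T (s *\<^sub>R v) w))"
    using continuous_on_compose2[OF continuous_T[OF assms], of UNIV "\<lambda>s. (s *\<^sub>R v, w)"]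
    by (simp add: continuous_on_Pair continuous_on_scaleR)
qed

text \<open>
  The set where \<open>b\<close> exceeds its mean is invariant up to null sets, so by ergodicity it has probability
  0 or 1. In either case \<open>b\<close> minus its mean has one sign almost surely and integral zero.
\<close>

lemma invariant_imp_AE_const:
  fixes b :: "'w \<Rightarrow> real"
  assumes b: "integrable M b" and inv: "\<And>x. AE w in M. b (T x w) = b w"
  shows "AE w in M. b w = (\<integral>w. b w \<partial>M)"
proof -
  define m where "m = (\<integral>w. b w \<partial>M)"
  define A where "A = {w. b w > m}"
  have [measurable]: "b \<in> borel_measurable M" using b by auto
  have A: "A \<in> sets M"
    using borel_measurable_less[of "\<lambda>_. m" M b] by (simp add: A_def space_M)
  have "sym_diff (T x ` A) A \<in> null_sets M" for x
  proof -
    have eq: "T x ` A = T (- x) -` A \<inter> space M"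
    proof (intro set_eqI iffI)
      fix w assume "w \<in> T (- x) -` A \<inter> space M"
      then have "T (- x) w \<in> A" "w = T x (T (- x) w)" using T_cancel(1)[of x w] by simp_all
      then show "w \<in> T x ` A" by blast
    qed (auto simp: T_cancel space_M)
    have "T x ` A \<in> sets M"
      unfolding eq by (rule measurable_sets[OF T_measurable A])
    then have S: "sym_diff (T x ` A) A \<in> sets M" using A by auto
    have "AE w in M. w \<notin> sym_diff (T x ` A) A"
      unfolding eq using inv[of "- x"] by eventually_elim (auto simp: A_def space_M)
    then show ?thesis using AE_iff_null_sets[OF S] by simp
  qed
  then have "prob A \<in> {0, 1}" using T_ergodic[OF A] by blast
  moreover have int: "integrable M (\<lambda>w. b w - m)" "(\<integral>w. b w - m \<partial>M) = 0"
    using b by (auto simp: m_def prob_space)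
  moreover have "AE w in M. b w - m = 0" if "AE w in M. b w - m \<ge> 0"
    using integral_nonneg_eq_0_iff_AE[OF int(1) that] int(2) by simp
  moreover have "AE w in M. b w - m = 0" if "AE w in M. b w - m \<le> 0"
  proof -
    have "AE w in M. 0 \<le> m - b w" using that by eventually_elim simp
    moreover have "integrable M (\<lambda>w. m - b w)" "(\<integral>w. m - b w \<partial>M) = 0"
      using b by (auto simp: m_def prob_space)
    ultimately have "AE w in M. m - b w = 0" using integral_nonneg_eq_0_iff_AE by blast
    then show ?thesis by eventually_elim simp
  qed
  moreover have "AE w in M. w \<notin> A" if "prob A = 0"
    unfolding AE_iff_null_sets[OF A, symmetric] using that A by (simp add: null_sets_def emeasure_eq_measure)
  moreover have "AE w in M. w \<in> A" if "prob A = 1"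
    using that A AE_in_set_eq_1 by blast
  ultimately have "AE w in M. b w - m = 0"
  proof (elim insertE emptyE)
    assume *: "prob A = 0"
    have "AE w in M. b w - m \<le> 0"
      using \<open>prob A = 0 \<Longrightarrow> AE w in M. w \<notin> A\<close>[OF *] by eventually_elim (simp add: A_def)
    then show ?thesis by fact
  next
    assume *: "prob A = 1"
    have "AE w in M. b w - m \<ge> 0"
      using \<open>prob A = 1 \<Longrightarrow> AE w in M. w \<in> A\<close>[OF *] by eventually_elim (simp add: A_def)
    then show ?thesis by fact
  qed
  then show ?thesis by (simp add: m_def)
qed

text \<open>
  Indicators of closed sets are limits of the continuous functions \<open>max 0 (1 - n d(w, F))\<close>, and the closed
  sets generate the Borel sets. The passage to a Borel representative is needed because the
  measure is a completion.
\<close>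

lemma AE_eq_0_if_orthogonal_to_continuous:
  fixes g :: "'w \<Rightarrow> real"
  assumes g: "integrable M g"
    and zero: "\<And>u. continuous_on UNIV u \<Longrightarrow> (\<integral>w. u w * g w \<partial>M) = 0"
  shows "AE w in M. g w = 0"
proof -
  obtain N where N: "sets N = sets borel" "M = completion N" using borel_completion by auto
  have [simp]: "space N = UNIV" using sets_eq_imp_space_eq[OF N(1)] by simp
  obtain g' where g': "g' \<in> borel_measurable N" "AE w in N. g w = g' w"
    using completion_ex_borel_measurable_real[of g N] g N(2) by auto
  then have [measurable]: "g' \<in> borel_measurable borel" using measurable_cong_sets[OF N(1) refl] by blast
  have [measurable]: "g \<in> borel_measurable M" using g by auto
  have AE: "AE w in M. g w = g' w" unfolding N(2) by (rule AE_completion[OF g'(2)])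
  have g'M: "integrable M g'"
    using g AE by (subst integrable_cong_AE[of g' M g]) (auto intro: borel_measurable_M elim!: eventually_mono)
  then have int: "integrable N g'" using integrable_completion[OF g'(1)] N(2) by simp
  have zero': "(\<integral>w. u w * g' w \<partial>N) = 0" if u: "continuous_on UNIV u" for u
  proof -
    have [measurable]: "u \<in> borel_measurable borel" using u by (rule borel_measurable_continuous_onI)
    have "(\<integral>w. u w * g' w \<partial>N) = (\<integral>w. u w * g' w \<partial>M)"
      unfolding N(2) by (subst integral_completion) (auto simp: measurable_cong_sets[OF N(1) refl])
    also have "\<dots> = (\<integral>w. u w * g w \<partial>M)"
    proof (rule integral_cong_AE)
      show "(\<lambda>w. u w * g' w) \<in> borel_measurable M" by (rule borel_measurable_M) simp
      have "u \<in> borel_measurable M" by (rule continuous_measurable_M[OF u])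
      then show "(\<lambda>w. u w * g w) \<in> borel_measurable M" by simp
    qed (use AE in \<open>auto elim!: eventually_mono\<close>)
    finally show ?thesis using zero[OF u] by simp
  qed
  have "AE w in N. g' w = 0"
  proof (rule AE_eq_0_if_generator[OF int, where G = "Collect closed"])
    show "Int_stable (Collect closed :: 'w set set)" by (auto simp: Int_stable_def)
    show "sets N = sigma_sets (space N) (Collect closed)" using N(1) by (simp add: borel_eq_closed)
    show "(\<integral>w. g' w \<partial>N) = 0" using zero'[of "\<lambda>_. 1"] by simp
    fix F :: "'w set" assume F: "F \<in> Collect closed"
    show "(\<integral>w. indicator F w * g' w \<partial>N) = 0"
    proof (cases "F = {}")
      case False
      define u where "u n w = max 0 (1 - real n * infdist w F)" for n w
      have cont: "continuous_on UNIV (u n)" for n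
        unfolding u_def by (intro continuous_intros)
      have "(\<lambda>n. \<integral>w. u n w * g' w \<partial>N) \<longlonglongrightarrow> (\<integral>w. indicator F w * g' w \<partial>N)"
      proof (rule integral_dominated_convergence[where w = "\<lambda>w. \<bar>g' w\<bar>"])
        have "u n \<in> borel_measurable N" for n
          using borel_measurable_continuous_onI[OF cont] measurable_cong_sets[OF N(1) refl] by blast
        then show "(\<lambda>w. u n w * g' w) \<in> borel_measurable N" for n using g'(1) by simp
        have "F \<in> sets N" using F N(1) by auto
        then show "(\<lambda>w. indicator F w * g' w) \<in> borel_measurable N" using g'(1) by simp
        show "integrable N (\<lambda>w. \<bar>g' w\<bar>)" using int by simp
        have "\<bar>u n w\<bar> \<le> 1" for n w by (simp add: u_def infdist_nonneg)
        then show "AE w in N. norm (u n w * g' w) \<le> \<bar>g' w\<bar>" for n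
          by (intro AE_I2) (simp add: abs_mult mult_left_le_one_le)
        have "(\<lambda>n. u n w) \<longlonglongrightarrow> indicator F w" for w
        proof (cases "w \<in> F")
          case True
          then show ?thesis by (simp add: u_def)
        next
          case w: False
          then have pos: "infdist w F > 0"
            using F False by (simp add: infdist_pos_not_in_closed)
          obtain k where k: "real k * infdist w F > 1" using reals_Archimedean3[OF pos] by blast
          have "u n w = 0" if "n \<ge> k" for n
          proof -
            have "real k * infdist w F \<le> real n * infdist w F" using that by (simp add: infdist_nonneg mult_right_mono)
            then show ?thesis using k by (simp add: u_def)
          qed
          then have "eventually (\<lambda>n. u n w = 0) sequentially" by (auto simp: eventually_sequentially)
          then show ?thesis using w by (simp add: tendsto_eventually)
        qed
        then show "AE w in N. (\<lambda>n. u n w * g' w) \<longlonglongrightarrow> indicator F w * g' w"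
          by (intro AE_I2 tendsto_mult tendsto_const) auto
      qed
      then show ?thesis using zero'[OF cont] by (simp add: LIMSEQ_const_iff)
    qed simp
  qed auto
  then have "AE w in M. g' w = 0" using AE_completion N(2) by auto
  with AE show ?thesis by eventually_elim simp
qed

section \<open>Potential and solenoidal fields of a layered system\<close>

lemma C1_grad:
  assumes "u \<in> C1 T"
  shows "continuous_on UNIV (\<lambda>w. grad_\<omega> T u w $ i)"
    and "(diff_quot T u i w \<longlongrightarrow> grad_\<omega> T u w $ i) (at 0)"
proof -
  obtain v where v: "continuous_on UNIV v" "\<And>w. (diff_quot T u i w \<longlongrightarrow> v w) (at 0)"
    using assms by (auto simp: C1_def)
  have "grad_\<omega> T u w $ i = v w" for w
    using v(2) by (simp add: grad_\<omega>_def tendsto_Lim)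
  then show "continuous_on UNIV (\<lambda>w. grad_\<omega> T u w $ i)" "(diff_quot T u i w \<longlongrightarrow> grad_\<omega> T u w $ i) (at 0)"
    using v by simp_all
qed

lemma grad_continuous: "u \<in> C1 T \<Longrightarrow> continuous_on UNIV (grad_\<omega> T u)"
  using continuous_on_vec_lambda[of UNIV "\<lambda>i w. grad_\<omega> T u w $ i"] C1_grad(1)[of u] by (simp add: vec_lambda_eta)

lemma grad_L2: "u \<in> C1 T \<Longrightarrow> grad_\<omega> T u \<in> L2 M"
  unfolding L2_def
  by (auto intro!: continuous_integrable_M continuous_measurable_M continuous_on_power continuous_on_norm grad_continuous)

lemma grad_L2_pot: "u \<in> C1 T \<Longrightarrow> grad_\<omega> T u \<in> L2_pot M T"
  using grad_L2 by (auto simp: L2_pot_def intro!: bexI[of _ u])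

lemma C1_DERIV_along_flow:
  assumes "u \<in> C1 T"
  shows "((\<lambda>s. u (T (s *\<^sub>R axis i 1) w) $ j) has_real_derivative grad_\<omega> T u (T (s *\<^sub>R axis i 1) w) $ i $ j) (at s)"
proof -
  have "((\<lambda>h. (u (T ((s + h) *\<^sub>R axis i 1) w) $ j - u (T (s *\<^sub>R axis i 1) w) $ j) / h)
      \<longlongrightarrow> grad_\<omega> T u (T (s *\<^sub>R axis i 1) w) $ i $ j) (at 0)"
  proof -
    have "T ((s + h) *\<^sub>R axis i 1) w = T (h *\<^sub>R axis i 1) (T (s *\<^sub>R axis i 1) w)" for h
      using T_add[of "h *\<^sub>R axis i 1" "s *\<^sub>R axis i 1"] by (simp add: algebra_simps)
    then show ?thesis
      using tendsto_vec_nth[OF C1_grad(2)[OF assms, of i "T (s *\<^sub>R axis i 1) w"], of j]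
      by (simp add: diff_quot_def divide_inverse mult.commute)
  qed
  then show ?thesis by (simp add: DERIV_def)
qed

text \<open>
  The flow preserves the measure, so the mean of \<open>u\<close> along the flow is constant in time and its derivative,
  which is the mean of the gradient, is zero.
\<close>

lemma integral_grad_eq_0:
  assumes u: "u \<in> C1 T"
  shows "(\<integral>w. grad_\<omega> T u w $ i $ j \<partial>M) = 0"
proof -
  have uc: "continuous_on UNIV (\<lambda>w. u w $ j)" using u by (auto simp: C1_def intro!: continuous_intros)
  have gc: "continuous_on UNIV (\<lambda>w. grad_\<omega> T u w $ i $ j)"
    by (intro continuous_intros C1_grad(1)[OF u])
  obtain C where C: "\<And>w. norm (grad_\<omega> T u w $ i $ j) \<le> C" using continuous_bounded_ex[OF gc] by metis
  have T0: "T (0 *\<^sub>R axis i 1) w = w" for w using T_zero by simp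
  have "((\<lambda>t. ((\<integral>w. u (T (t *\<^sub>R axis i 1) w) $ j \<partial>M) - (\<integral>w. u (T (0 *\<^sub>R axis i 1) w) $ j \<partial>M)) / t)
      \<longlongrightarrow> (\<integral>w. grad_\<omega> T u w $ i $ j \<partial>M)) (at 0)"
  proof (rule integral_diff_quot_tendsto[where G = "\<lambda>_. C"])
    show "integrable M (\<lambda>w. u (T (t *\<^sub>R axis i 1) w) $ j)" for t
      by (intro integrable_T continuous_integrable_M uc)
    show "\<bar>u (T (t *\<^sub>R axis i 1) w) $ j - u (T (0 *\<^sub>R axis i 1) w) $ j\<bar> \<le> \<bar>t\<bar> * C" for t w
    proof -
      have "norm (u (T (t *\<^sub>R axis i 1) w) $ j - u (T (0 *\<^sub>R axis i 1) w) $ j) \<le> C * norm (t - 0)"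
        by (rule field_differentiable_bound[where S = UNIV and f' = "\<lambda>s. grad_\<omega> T u (T (s *\<^sub>R axis i 1) w) $ i $ j"])
          (use C C1_DERIV_along_flow[OF u] in auto)
      then show ?thesis by (simp add: mult.commute)
    qed
    show "((\<lambda>t. (u (T (t *\<^sub>R axis i 1) w) $ j - u (T (0 *\<^sub>R axis i 1) w) $ j) / t) \<longlongrightarrow> grad_\<omega> T u w $ i $ j) (at 0)" for w
      using C1_DERIV_along_flow[OF u, of i w j 0] by (simp add: DERIV_def T0[unfolded scaleR_zero_left])
  qed simp
  moreover have "(\<integral>w. u (T x w) $ j \<partial>M) = (\<integral>w. u w $ j \<partial>M)" for x
    by (intro integral_T[of "\<lambda>w. u w $ j"] continuous_measurable_M uc)
  ultimately have "((\<lambda>t::real. 0) \<longlongrightarrow> (\<integral>w. grad_\<omega> T u w $ i $ j \<partial>M)) (at 0)" by simp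
  then show ?thesis by (simp add: tendsto_const_iff)
qed

lemma L2_pot_integral_eq_0:
  assumes "\<Theta> \<in> L2_pot M T"
  shows "(\<integral>w. \<Theta> w $ i $ j \<partial>M) = 0"
proof -
  have \<Theta>: "\<Theta> \<in> L2 M" using assms by (simp add: L2_pot_def)
  have int\<Theta>: "integrable M (\<lambda>w. \<Theta> w $ i $ j)"
    by (rule square_integrable_imp_integrable[OF L2_entry[OF \<Theta>]])
  have "\<bar>\<integral>w. \<Theta> w $ i $ j \<partial>M\<bar> \<le> 0 + \<epsilon>" if "\<epsilon> > 0" for \<epsilon>
  proof -
    obtain u where u: "u \<in> C1 T" and lt: "sqrt (\<integral>w. (norm (\<Theta> w - grad_\<omega> T u w))\<^sup>2 \<partial>M) < \<epsilon>"
      using assms \<open>\<epsilon> > 0\<close> unfolding L2_pot_def by blast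
    define X where "X w = \<Theta> w - grad_\<omega> T u w" for w
    have X: "X \<in> L2 M" unfolding X_def using \<Theta> grad_L2[OF u] by (rule L2_diff)
    have e2: "integrable M (\<lambda>w. (X w $ i $ j)\<^sup>2)" and e1: "integrable M (\<lambda>w. X w $ i $ j)"
      using L2_entry[OF X] square_integrable_imp_integrable by blast+
    have "(\<integral>w. X w $ i $ j \<partial>M)\<^sup>2 \<le> (\<integral>w. (X w $ i $ j)\<^sup>2 \<partial>M)"
      using variance_eq[OF e1 e2] variance_positive[of "\<lambda>w. X w $ i $ j"] by linarith
    also have "\<dots> \<le> (\<integral>w. (norm (X w))\<^sup>2 \<partial>M)"
      using e2 X entry_le_norm by (intro integral_mono) (auto simp: L2_def abs_le_square_iff[symmetric])
    finally have "\<bar>\<integral>w. X w $ i $ j \<partial>M\<bar> \<le> sqrt (\<integral>w. (norm (X w))\<^sup>2 \<partial>M)"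
      by (simp add: real_le_rsqrt)
    moreover have "(\<integral>w. X w $ i $ j \<partial>M) = (\<integral>w. \<Theta> w $ i $ j \<partial>M)"
      using int\<Theta> integral_grad_eq_0[OF u, of i j] continuous_integrable_M[of "\<lambda>w. grad_\<omega> T u w $ i $ j"] C1_grad(1)[OF u]
      by (simp add: X_def continuous_intros)
    ultimately show ?thesis using lt by (simp add: X_def)
  qed
  then have "\<bar>\<integral>w. \<Theta> w $ i $ j \<partial>M\<bar> \<le> 0" by (rule field_le_epsilon)
  then show ?thesis by simp
qed

context
  assumes layered: "\<And>x. T x = T (x $ 3 *\<^sub>R axis 3 1)"
begin

lemma T_other_axis: "i \<noteq> 3 \<Longrightarrow> T (t *\<^sub>R axis i 1) w = w"
  using layered[of "t *\<^sub>R axis i 1"] T_zero by (simp add: axis_def)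

lemma grad_row_eq_0: "i \<noteq> 3 \<Longrightarrow> grad_\<omega> T u w $ i = 0"
  by (simp add: grad_\<omega>_def diff_quot_def[abs_def] T_other_axis tendsto_Lim)

lemma L2_pot_row_eq_0:
  assumes \<Theta>: "\<Theta> \<in> L2_pot M T" and i: "i \<noteq> 3"
  shows "AE w in M. \<Theta> w $ i $ j = 0"
proof -
  have L2: "\<Theta> \<in> L2 M" using \<Theta> by (simp add: L2_pot_def)
  have sq: "integrable M (\<lambda>w. (\<Theta> w $ i $ j)\<^sup>2)" by (rule L2_entry[OF L2])
  have "sqrt (\<integral>w. (\<Theta> w $ i $ j)\<^sup>2 \<partial>M) \<le> 0 + \<epsilon>" if "\<epsilon> > 0" for \<epsilon>
  proof -
    obtain u where u: "u \<in> C1 T" and lt: "sqrt (\<integral>w. (norm (\<Theta> w - grad_\<omega> T u w))\<^sup>2 \<partial>M) < \<epsilon>"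
      using \<Theta> \<open>\<epsilon> > 0\<close> unfolding L2_pot_def by blast
    have "(\<integral>w. (\<Theta> w $ i $ j)\<^sup>2 \<partial>M) \<le> (\<integral>w. (norm (\<Theta> w - grad_\<omega> T u w))\<^sup>2 \<partial>M)"
    proof (rule integral_mono[OF sq])
      show "integrable M (\<lambda>w. (norm (\<Theta> w - grad_\<omega> T u w))\<^sup>2)"
        using L2_diff[OF L2 grad_L2[OF u]] by (simp add: L2_def)
      show "(\<Theta> w $ i $ j)\<^sup>2 \<le> (norm (\<Theta> w - grad_\<omega> T u w))\<^sup>2" for w
        using entry_le_norm[of "\<Theta> w - grad_\<omega> T u w" i j] grad_row_eq_0[OF i]
        by (simp add: abs_le_square_iff[symmetric])
    qed
    then show ?thesis using lt real_sqrt_le_mono[of "\<integral>w. (\<Theta> w $ i $ j)\<^sup>2 \<partial>M"] by (smt (verit))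
  qed
  then have "sqrt (\<integral>w. (\<Theta> w $ i $ j)\<^sup>2 \<partial>M) \<le> 0" by (rule field_le_epsilon)
  then have "(\<integral>w. (\<Theta> w $ i $ j)\<^sup>2 \<partial>M) = 0"
    by (intro antisym) (auto intro!: Bochner_Integration.integral_nonneg)
  then show ?thesis
    using integral_nonneg_eq_0_iff_AE[OF sq] by simp
qed

text \<open>
  The derivative along the flow of the primitive \<open>\<integral>\<^sub>0\<^sup>t u (T\<^sub>s w) ds\<close> is the increment \<open>u (T\<^sub>t w) - u w\<close>. Increments
  of continuous functions are thus derivatives of \<open>C\<^sup>1\<close> functions, and solenoidal fields can be
  tested with them.
\<close>

lemma flow_primitive:
  fixes u :: "'w \<Rightarrow> real"
  assumes u: "continuous_on UNIV u" and t: "t > 0"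
  defines "U \<equiv> \<lambda>w. integral {0..t} (\<lambda>s. u (T (s *\<^sub>R axis 3 1) w))"
  shows "continuous_on UNIV U"
    and "((\<lambda>\<delta>. (U (T (\<delta> *\<^sub>R axis 3 1) w) - U w) / \<delta>) \<longlongrightarrow> u (T (t *\<^sub>R axis 3 1) w) - u w) (at 0)"
proof -
  have "continuous_on (UNIV \<times> cbox 0 t) (\<lambda>(w, s). u (T (s *\<^sub>R axis 3 1) w))"
    using continuous_on_compose2[OF continuous_T[OF u], of "UNIV \<times> cbox 0 t" "\<lambda>(w, s). (s *\<^sub>R axis 3 1, w)"]
    by (simp add: case_prod_beta continuous_intros)
  from integral_continuous_on_param[OF this] show "continuous_on UNIV U" by (simp add: U_def)
  define f where "f s = u (T (s *\<^sub>R axis 3 1) w)" for s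
  have f: "continuous_on S f" for S
    using continuous_on_subset[OF continuous_T_slice(2)[OF u] subset_UNIV] by (simp add: f_def)
  \<comment> \<open>The primitive starts at \<open>-1\<close> so that \<open>0\<close> is an interior point and two-sided limits make sense there.\<close>
  define F where "F x = integral {-1..x} f" for x
  have F: "(F has_real_derivative f x) (at x)" if "x \<in> {-1<..<t+1}" for x
  proof -
    have "(F has_real_derivative f x) (at x within {-1..t+1})"
      unfolding F_def using that by (intro integral_has_real_derivative f) auto
    then show ?thesis using that by (simp add: at_within_Icc_at)
  qed
  have shift: "U (T (\<delta> *\<^sub>R axis 3 1) w) = F (t + \<delta>) - F \<delta>" if "\<bar>\<delta>\<bar> < 1" for \<delta>
  proof -
    have "T (s *\<^sub>R axis 3 1) (T (\<delta> *\<^sub>R axis 3 1) w) = T ((s + \<delta>) *\<^sub>R axis 3 1) w" for s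
      using T_add[of "s *\<^sub>R axis 3 1" "\<delta> *\<^sub>R axis 3 1"] by (simp add: algebra_simps)
    then have "U (T (\<delta> *\<^sub>R axis 3 1) w) = integral {0..t} (f \<circ> (\<lambda>x. x + \<delta>))"
      by (simp add: U_def f_def o_def)
    also have "\<dots> = integral {\<delta>..t + \<delta>} f"
      using integral_shift[OF f, of 0 t \<delta>] by simp
    also have "\<dots> = F (t + \<delta>) - F \<delta>"
    proof -
      have "-1 \<le> \<delta>" "\<delta> \<le> t + \<delta>" using that t by auto
      from Henstock_Kurzweil_Integration.integral_combine[OF this integrable_continuous_real[OF f]]
      show ?thesis by (simp add: F_def)
    qed
    finally show ?thesis .
  qed
  have U0: "U w = F t - F 0" using shift[of 0] T_zero by simp
  have "((\<lambda>\<delta>. (F (t + \<delta>) - F t) / \<delta> - (F (0 + \<delta>) - F 0) / \<delta>) \<longlongrightarrow> f t - f 0) (at 0)"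
    using F[of t] F[of 0] t unfolding DERIV_def by (intro tendsto_diff) auto
  moreover have "eventually (\<lambda>\<delta>::real. \<bar>\<delta>\<bar> < 1) (at 0)"
    unfolding eventually_at by (intro exI[of _ 1]) (auto simp: dist_real_def)
  then have "eventually (\<lambda>\<delta>. (F (t + \<delta>) - F t) / \<delta> - (F (0 + \<delta>) - F 0) / \<delta>
      = (U (T (\<delta> *\<^sub>R axis 3 1) w) - U w) / \<delta>) (at 0)"
    by eventually_elim (simp add: shift U0 diff_divide_distrib)
  ultimately have "((\<lambda>\<delta>. (U (T (\<delta> *\<^sub>R axis 3 1) w) - U w) / \<delta>) \<longlongrightarrow> f t - f 0) (at 0)"
    by (rule Lim_transform_eventually)
  then show "((\<lambda>\<delta>. (U (T (\<delta> *\<^sub>R axis 3 1) w) - U w) / \<delta>) \<longlongrightarrow> u (T (t *\<^sub>R axis 3 1) w) - u w) (at 0)"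
    using T_zero by (simp add: f_def)
qed

lemma L2_sol_orthogonal_to_increments:
  fixes u :: "'w \<Rightarrow> real"
  assumes B: "B \<in> L2_sol M T" and u: "continuous_on UNIV u" and t: "t > 0"
  shows "(\<integral>w. (u (T (t *\<^sub>R axis 3 1) w) - u w) * B w $ 3 $ j \<partial>M) = 0"
proof -
  define U where "U w = integral {0..t} (\<lambda>s. u (T (s *\<^sub>R axis 3 1) w))" for w
  define V where "V w = U w *\<^sub>R (axis j 1 :: real^3)" for w
  define G where "G i w = (if i = 3 then u (T (t *\<^sub>R axis 3 1) w) - u w else 0) *\<^sub>R (axis j 1 :: real^3)" for i :: 3 and w
  have dq: "(diff_quot T V i w \<longlongrightarrow> G i w) (at 0)" for i w
  proof (cases "i = 3")
    case True
    have "((\<lambda>\<delta>. ((U (T (\<delta> *\<^sub>R axis 3 1) w) - U w) / \<delta>) *\<^sub>R (axis j 1 :: real^3)) \<longlongrightarrow> G i w) (at 0)"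
      unfolding G_def True using flow_primitive(2)[OF u t, of w, folded U_def] by (intro tendsto_scaleR tendsto_const) simp
    then show ?thesis
      by (simp add: diff_quot_def[abs_def] V_def True scaleR_diff_left[symmetric] divide_inverse mult.commute)
  next
    case False
    then show ?thesis by (simp add: diff_quot_def[abs_def] T_other_axis G_def)
  qed
  have "continuous_on UNIV (G i)" for i
    unfolding G_def using u continuous_T_slice(1)[OF u] by (cases "i = 3") (auto intro!: continuous_intros)
  moreover have "continuous_on UNIV V"
    unfolding V_def U_def using flow_primitive(1)[OF u t] by (intro continuous_intros)
  ultimately have V: "V \<in> C1 T" using dq unfolding C1_def by blast
  have "grad_\<omega> T V w = (\<chi> i. G i w)" for w
    by (simp add: grad_\<omega>_def tendsto_Lim[OF _ dq])
  then have "(u (T (t *\<^sub>R axis 3 1) w) - u w) * B w $ 3 $ j = grad_\<omega> T V w \<bullet> B w" for w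
    by (simp add: inner_vec_def[of "_ :: real^3^3"] G_def sum_3 inner_axis')
  then show ?thesis
    using B grad_L2_pot[OF V] by (simp add: L2_sol_def)
qed

text \<open>
  Let \<open>b\<close> be an entry of the third row. Orthogonality to all increments \<open>u \<circ> T\<^sub>t - u\<close> says, after a change of variables, that \<open>b \<circ> T\<^sub>-\<^sub>t - b\<close> is orthogonal
  to every continuous \<open>u\<close>. So \<open>b\<close> is invariant, and ergodicity applies.
\<close>

lemma L2_sol_row_const:
  assumes B: "B \<in> L2_sol M T"
  obtains c where "AE w in M. B w $ 3 $ j = c"
proof -
  define b where "b w = B w $ 3 $ j" for w
  have "B \<in> L2 M" using B by (simp add: L2_sol_def)
  then have b: "integrable M b" and [measurable]: "b \<in> borel_measurable M"
    unfolding b_def using L2_entry square_integrable_imp_integrable by blast+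
  have shift_back: "AE w in M. b (T (- (t *\<^sub>R axis 3 1)) w) = b w" if t: "t > 0" for t
  proof -
    define x where "x = t *\<^sub>R (axis 3 1 :: real^3)"
    have "AE w in M. b (T (- x) w) - b w = 0"
    proof (rule AE_eq_0_if_orthogonal_to_continuous)
      show "integrable M (\<lambda>w. b (T (- x) w) - b w)" using integrable_T[OF b] b by simp
      fix u :: "'w \<Rightarrow> real" assume u: "continuous_on UNIV u"
      have [measurable]: "u \<in> borel_measurable M" by (rule continuous_measurable_M[OF u])
      obtain C where C: "\<And>w. norm (u w) \<le> C" using continuous_bounded_ex[OF u] by metis
      have ub: "integrable M (\<lambda>w. u w * f w)" if f: "integrable M f" for f :: "'w \<Rightarrow> real"
        by (rule integrable_bounded_mult[OF f, where C = C]) (use C in auto)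
      have sh: "integrable M (\<lambda>w. u (T x w) * b w)" "(\<integral>w. u (T x w) * b w \<partial>M) = (\<integral>w. u w * b (T (- x) w) \<partial>M)"
        using integrable_T[OF ub[OF integrable_T[OF b, of "- x"]], of x]
          integral_T[OF borel_measurable_integrable[OF ub[OF integrable_T[OF b, of "- x"]]], of x]
        by (simp_all add: T_cancel)
      have "(\<integral>w. u w * (b (T (- x) w) - b w) \<partial>M) = (\<integral>w. u (T x w) * b w \<partial>M) - (\<integral>w. u w * b w \<partial>M)"
        using ub[OF b] ub[OF integrable_T[OF b, of "- x"]] sh(2) by (simp add: right_diff_distrib)
      also have "\<dots> = (\<integral>w. (u (T x w) - u w) * b w \<partial>M)"
        using ub[OF b] sh(1) by (simp add: left_diff_distrib)
      also have "\<dots> = 0"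
        using L2_sol_orthogonal_to_increments[OF B u t] by (simp add: x_def b_def)
      finally show "(\<integral>w. u w * (b (T (- x) w) - b w) \<partial>M) = 0" .
    qed
    then show ?thesis by eventually_elim (simp add: x_def)
  qed
  have "AE w in M. b (T x w) = b w" for x
  proof -
    define s where "s = x $ 3"
    consider "s < 0" | "s = 0" | "s > 0" by linarith
    then have "AE w in M. b (T (s *\<^sub>R axis 3 1) w) = b w"
    proof cases
      case 1
      then show ?thesis using shift_back[of "- s"] by simp
    next
      case 2
      then show ?thesis using T_zero by simp
    next
      case 3
      from AE_T[OF shift_back[OF this], of "s *\<^sub>R axis 3 1"] show ?thesis by (simp add: T_cancel eq_commute)
    qed
    then show ?thesis using layered[of x] by (simp add: s_def)
  qed
  from invariant_imp_AE_const[OF b this] show ?thesis by (intro that) (simp add: b_def)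
qed

text \<open>
  In the third row, \<open>a \<Theta>\<^sub>3\<^sub>j + k \<delta>\<^sub>3\<^sub>j\<close> equals a constant \<open>d\<close>. Solving for \<open>\<Theta>\<^sub>3\<^sub>j\<close> and using that it has mean
  zero determines \<open>d\<close>.
\<close>

lemma corrector_explicit:
  assumes a: "a \<in> borel_measurable M" "\<And>w. c \<le> a w" "0 < c"
    and k: "k \<in> borel_measurable M" "\<And>w. \<bar>k w\<bar> \<le> C"
    and \<Theta>: "is_corrector M T a k \<Theta>"
  shows "AE w in M. \<Theta> w = (((\<integral>w. k w / a w \<partial>M) / (\<integral>w. 1 / a w \<partial>M) - k w) / a w) *\<^sub>R axis 3 (axis 3 1)"
proof -
  note [measurable] = a(1) k(1)
  have apos: "a w > 0" for w using a(2)[of w] a(3) by linarith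
  have pot: "\<Theta> \<in> L2_pot M T" and sol: "(\<lambda>w. a w *\<^sub>R \<Theta> w + k w *\<^sub>R mat 1) \<in> L2_sol M T"
    using \<Theta> by (auto simp: is_corrector_def)
  have inv_int: "integrable M (\<lambda>w. 1 / a w)"
    using apos a(2,3) by (intro integrable_const_bound[of _ "1 / c"]) (auto simp: abs_of_pos intro!: AE_I2 divide_left_mono)
  have k_int: "integrable M (\<lambda>w. k w / a w)"
    using integrable_bounded_mult[OF inv_int k] by simp
  have "0 < (\<integral>w. 1 / a w \<partial>M)"
  proof -
    have "(\<integral>w. 0 \<partial>M) < (\<integral>w. 1 / a w \<partial>M)"
      using apos inv_int by (intro integral_less_AE_space) (auto simp: emeasure_space_1)
    then show ?thesis by simp
  qed
  then have E: "(\<integral>w. 1 / a w \<partial>M) \<noteq> 0" by simp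
  have row3: "AE w in M. \<Theta> w $ 3 $ j = (((\<integral>w. k w / a w \<partial>M) / (\<integral>w. 1 / a w \<partial>M) - k w) / a w) * (if j = 3 then 1 else 0)" for j
  proof -
    define \<delta> :: real where "\<delta> = (if j = 3 then 1 else 0)"
    obtain d where "AE w in M. (a w *\<^sub>R \<Theta> w + k w *\<^sub>R mat 1) $ 3 $ j = d"
      by (rule L2_sol_row_const[OF sol])
    then have AE: "AE w in M. \<Theta> w $ 3 $ j = d * (1 / a w) - \<delta> * (k w / a w)"
    proof eventually_elim
      case (elim w)
      then have "a w * \<Theta> w $ 3 $ j + k w * \<delta> = d" by (auto simp: mat_def \<delta>_def)
      then show ?case using apos[of w] by (simp add: field_simps)
    qed
    have "0 = (\<integral>w. d * (1 / a w) - \<delta> * (k w / a w) \<partial>M)"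
      using AE L2_pot_integral_eq_0[OF pot, of 3 j] L2_entry(1)[of \<Theta> M 3 j] pot
      by (subst integral_cong_AE[of "\<lambda>w. d * (1 / a w) - \<delta> * (k w / a w)" M "\<lambda>w. \<Theta> w $ 3 $ j"])
        (auto simp: L2_pot_def elim!: eventually_mono)
    then have "0 = d * (\<integral>w. 1 / a w \<partial>M) - \<delta> * (\<integral>w. k w / a w \<partial>M)"
      by (subst (asm) Bochner_Integration.integral_diff
          [OF integrable_mult_right[OF inv_int] integrable_mult_right[OF k_int]],
          simp only: integral_mult_right_zero)
    then have d: "d = \<delta> * ((\<integral>w. k w / a w \<partial>M) / (\<integral>w. 1 / a w \<partial>M))"
      using E by (simp add: field_simps)
    show ?thesis
      using AE by eventually_elim (simp add: d \<delta>_def diff_divide_distrib)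
  qed
  have "AE w in M. \<forall>i j. \<Theta> w $ i $ j = (((\<integral>w. k w / a w \<partial>M) / (\<integral>w. 1 / a w \<partial>M) - k w) / a w) * (if i = 3 \<and> j = 3 then 1 else 0)"
  proof -
    have "AE w in M. \<Theta> w $ i $ j = (((\<integral>w. k w / a w \<partial>M) / (\<integral>w. 1 / a w \<partial>M) - k w) / a w) * (if i = 3 \<and> j = 3 then 1 else 0)" for i j
      using row3[of j] L2_pot_row_eq_0[OF pot, of i j] by (cases "i = 3") auto
    then show ?thesis by (simp add: AE_all_countable)
  qed
  then show ?thesis
    by eventually_elim (auto simp: vec_eq_iff axis_def)
qed

end

end

section \<open>Weak partial derivatives\<close>

lemma continuous_measurable_lebesgue_on:
  fixes f :: "real^3 \<Rightarrow> 'b::euclidean_space"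
  assumes "open D" "continuous_on UNIV f"
  shows "f \<in> borel_measurable (lebesgue_on D)"
  using continuous_imp_measurable_on_sets_lebesgue[OF continuous_on_subset[OF assms(2) subset_UNIV], of D] assms(1)
  by (simp add: borel_open)

lemma (in finite_measure) L2_imp_integrable:
  fixes f :: "'a \<Rightarrow> 'b::euclidean_space"
  assumes "f \<in> L2 M"
  shows "integrable M f"
proof -
  have m: "f \<in> borel_measurable M" and sq: "integrable M (\<lambda>x. (norm (f x))\<^sup>2)"
    using assms by (auto simp: L2_def)
  have "integrable M (\<lambda>x. norm (f x))"
    by (rule square_integrable_imp_integrable[of "\<lambda>x. norm (f x)", OF measurable_compose[OF m borel_measurable_norm] sq])
  then show ?thesis using integrable_norm_iff[OF m] by simp
qed

text \<open>
  A scalar form of \<^const>\<open>is_weak_grad\<close> that can be manipulated one entry at a time.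
\<close>

definition weak_partial :: "(real^3) set \<Rightarrow> 3 \<Rightarrow> (real^3 \<Rightarrow> real) \<Rightarrow> (real^3 \<Rightarrow> real) \<Rightarrow> bool" where
  "weak_partial D i f p \<longleftrightarrow> integrable (lebesgue_on D) f \<and> integrable (lebesgue_on D) p \<and>
     (\<forall>\<phi> \<in> test_functions D. (\<integral>x. frechet_derivative \<phi> (at x) (axis i 1) * f x \<partial>lebesgue_on D)
        = - (\<integral>x. \<phi> x * p x \<partial>lebesgue_on D))"

lemma
  fixes f :: "real^3 \<Rightarrow> real"
  assumes D: "open D" and f: "integrable (lebesgue_on D) f" and \<phi>: "\<phi> \<in> test_functions D'"
  shows integrable_test_function_mult_on: "integrable (lebesgue_on D) (\<lambda>x. \<phi> x * f x)"
    and integrable_test_function_partial_mult_on: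
      "integrable (lebesgue_on D) (\<lambda>x. frechet_derivative \<phi> (at x) v * f x)"
proof -
  obtain C where "\<And>x. \<bar>\<phi> x\<bar> \<le> C" using test_function_bounded[OF \<phi>] by metis
  then show "integrable (lebesgue_on D) (\<lambda>x. \<phi> x * f x)"
    by (rule integrable_bounded_mult[OF f continuous_measurable_lebesgue_on[OF D test_function_continuous[OF \<phi>]]])
  obtain C where "\<And>x. \<bar>frechet_derivative \<phi> (at x) v\<bar> \<le> C"
    using test_function_partial_bounded[OF \<phi>] by metis
  then show "integrable (lebesgue_on D) (\<lambda>x. frechet_derivative \<phi> (at x) v * f x)"
    by (rule integrable_bounded_mult[OF f continuous_measurable_lebesgue_on[OF D test_function_partial_continuous[OF \<phi>]]])
qed

text \<open>
  This translates between integrals over \<open>D\<close> of Lebesgue measurable functions, in which weak derivatives are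
  stated, and Borel functions on the whole space, for which translation invariance and Fubini's
  theorem are available.
\<close>

lemma borel_representative:
  fixes f :: "real^3 \<Rightarrow> real"
  assumes D: "open D" and f: "integrable (lebesgue_on D) f"
  obtains g where "integrable lborel g" "AE x in lborel. x \<in> D \<longrightarrow> f x = g x"
    "\<forall>\<psi>\<in>borel_measurable borel. (\<forall>x. x \<notin> D \<longrightarrow> \<psi> x = 0) \<longrightarrow>
      (\<integral>x. \<psi> x * f x \<partial>lebesgue_on D) = (\<integral>x. g x * \<psi> x \<partial>lborel)"
proof -
  have D': "D \<inter> space lebesgue \<in> sets lebesgue" using D by (simp add: borel_open)
  have f0: "integrable lebesgue (\<lambda>x. indicator D x * f x)"
    using f integrable_restrict_space[OF D', of f] by simp
  then obtain g where g: "g \<in> borel_measurable lborel" "AE x in lborel. indicator D x * f x = g x"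
    using completion_ex_borel_measurable_real[OF borel_measurable_integrable[OF f0]] by blast
  have AE: "AE x in lebesgue. indicator D x * f x = g x" by (rule AE_completion[OF g(2)])
  have gl: "g \<in> borel_measurable lebesgue" using g(1) by (rule measurable_completion)
  have "integrable lebesgue g"
    using f0 AE gl integrable_cong_AE[of "\<lambda>x. indicator D x * f x" lebesgue g] by auto
  then have int: "integrable lborel g" using integrable_completion[OF g(1)] by simp
  show ?thesis
  proof (rule that[OF int], goal_cases)
    case 1
    show ?case using g(2) by eventually_elim (auto simp: indicator_def)
  next
    case 2
    show ?case
    proof (intro ballI impI)
      fix \<psi> :: "real^3 \<Rightarrow> real" assume \<psi>: "\<psi> \<in> borel_measurable borel" "\<forall>x. x \<notin> D \<longrightarrow> \<psi> x = 0"
      have \<psi>l: "\<psi> \<in> borel_measurable lebesgue" using \<psi>(1) by (intro measurable_completion) simp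
      have "(\<integral>x. \<psi> x * f x \<partial>lebesgue_on D) = (\<integral>x. \<psi> x * (indicator D x * f x) \<partial>lebesgue)"
        unfolding integral_restrict_space[OF D'] by (simp add: mult_ac)
      also have "\<dots> = (\<integral>x. g x * \<psi> x \<partial>lebesgue)"
      proof (rule integral_cong_AE)
        show "(\<lambda>x. \<psi> x * (indicator D x * f x)) \<in> borel_measurable lebesgue" using f0 \<psi>l by simp
        show "(\<lambda>x. g x * \<psi> x) \<in> borel_measurable lebesgue" using gl \<psi>l by simp
        show "AE x in lebesgue. \<psi> x * (indicator D x * f x) = g x * \<psi> x"
          using AE by eventually_elim simp
      qed
      also have "\<dots> = (\<integral>x. g x * \<psi> x \<partial>lborel)"
        using g(1) \<psi>(1) by (intro integral_completion) simp
      finally show "(\<integral>x. \<psi> x * f x \<partial>lebesgue_on D) = (\<integral>x. g x * \<psi> x \<partial>lborel)" .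
    qed
  qed
qed

lemma AE_lebesgue_on_lborel: "open D \<Longrightarrow> (AE x in lebesgue_on D. P x) \<longleftrightarrow> (AE x in lborel. x \<in> D \<longrightarrow> P x)"
  for D :: "(real^3) set"
  by (subst AE_restrict_space_iff) (auto simp: borel_open AE_completion_iff)

lemma AE_eq_0_if_orthogonal_to_test_functions:
  fixes f :: "real^3 \<Rightarrow> real"
  assumes D: "open D" and f: "integrable (lebesgue_on D) f"
    and zero: "\<And>\<phi>. \<phi> \<in> test_functions D \<Longrightarrow> (\<integral>x. \<phi> x * f x \<partial>lebesgue_on D) = 0"
  shows "AE x in lebesgue_on D. f x = 0"
proof -
  obtain g where g: "integrable lborel g" "AE x in lborel. x \<in> D \<longrightarrow> f x = g x"
    "\<forall>\<psi>\<in>borel_measurable borel. (\<forall>x. x \<notin> D \<longrightarrow> \<psi> x = 0) \<longrightarrow>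
      (\<integral>x. \<psi> x * f x \<partial>lebesgue_on D) = (\<integral>x. g x * \<psi> x \<partial>lborel)"
    by (rule borel_representative[OF D f])
  have "AE x in lborel. x \<in> D \<longrightarrow> g x = 0"
  proof (rule fundamental_lemma_calculus_of_variations[OF D g(1)])
    fix \<phi> :: "real^3 \<Rightarrow> real" assume \<phi>: "\<phi> \<in> test_functions D"
    then have "(\<integral>x. \<phi> x * f x \<partial>lebesgue_on D) = (\<integral>x. g x * \<phi> x \<partial>lborel)"
      by (intro g(3)[rule_format] borel_measurable_continuous_onI test_function_continuous test_function_outside)
    then show "(\<integral>x. g x * \<phi> x \<partial>lborel) = 0" using zero[OF \<phi>] by simp
  qed
  with g(2) show ?thesis unfolding AE_lebesgue_on_lborel[OF D] by eventually_elim simp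
qed

lemma weak_partial_unique:
  assumes D: "open D" and p: "weak_partial D i f p" and q: "weak_partial D i f q"
  shows "AE x in lebesgue_on D. p x = q x"
proof -
  have pi: "integrable (lebesgue_on D) p" and qi: "integrable (lebesgue_on D) q"
    using p q by (auto simp: weak_partial_def)
  have "AE x in lebesgue_on D. p x - q x = 0"
  proof (rule AE_eq_0_if_orthogonal_to_test_functions[OF D])
    show "integrable (lebesgue_on D) (\<lambda>x. p x - q x)" using pi qi by simp
    fix \<phi> :: "real^3 \<Rightarrow> real" assume \<phi>: "\<phi> \<in> test_functions D"
    have "(\<integral>x. \<phi> x * p x \<partial>lebesgue_on D) = (\<integral>x. \<phi> x * q x \<partial>lebesgue_on D)"
      using p q \<phi> by (simp add: weak_partial_def)
    then show "(\<integral>x. \<phi> x * (p x - q x) \<partial>lebesgue_on D) = 0"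
      using integrable_test_function_mult_on[OF D pi \<phi>] integrable_test_function_mult_on[OF D qi \<phi>]
      by (simp add: right_diff_distrib)
  qed
  then show ?thesis by eventually_elim simp
qed

lemma weak_partial_cong_AE:
  assumes D: "open D" and p: "weak_partial D i f p"
    and f': "integrable (lebesgue_on D) f'" "AE x in lebesgue_on D. f' x = f x"
  shows "weak_partial D i f' p"
proof -
  have f: "integrable (lebesgue_on D) f" using p by (simp add: weak_partial_def)
  have "(\<integral>x. frechet_derivative \<phi> (at x) (axis i 1) * f' x \<partial>lebesgue_on D)
      = (\<integral>x. frechet_derivative \<phi> (at x) (axis i 1) * f x \<partial>lebesgue_on D)" if \<phi>: "\<phi> \<in> test_functions D" for \<phi>
  proof (rule integral_cong_AE)
    show "AE x in lebesgue_on D. frechet_derivative \<phi> (at x) (axis i 1) * f' x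
        = frechet_derivative \<phi> (at x) (axis i 1) * f x"
      using f'(2) by eventually_elim simp
  qed (use integrable_test_function_partial_mult_on[OF D _ \<phi>] f f'(1) in auto)
  then show ?thesis using p f'(1) by (simp add: weak_partial_def)
qed

lemma weak_partial_add:
  assumes D: "open D" and p: "weak_partial D i f p" and q: "weak_partial D i g q"
  shows "weak_partial D i (\<lambda>x. f x + g x) (\<lambda>x. p x + q x)"
proof -
  note int = p[unfolded weak_partial_def] q[unfolded weak_partial_def]
  show ?thesis
    unfolding weak_partial_def
  proof (intro conjI ballI)
    fix \<phi> :: "real^3 \<Rightarrow> real" assume \<phi>: "\<phi> \<in> test_functions D"
    show "(\<integral>x. frechet_derivative \<phi> (at x) (axis i 1) * (f x + g x) \<partial>lebesgue_on D)
        = - (\<integral>x. \<phi> x * (p x + q x) \<partial>lebesgue_on D)"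
      using int \<phi> integrable_test_function_mult_on[OF D _ \<phi>] integrable_test_function_partial_mult_on[OF D _ \<phi>]
      by (simp add: distrib_left)
  qed (use int in auto)
qed

text \<open>
  If \<open>\<phi>\<close> is a test function, then so is \<open>\<phi> \<psi>\<close>, and the definition for \<open>f\<close> tested with \<open>\<phi> \<psi>\<close> is the product rule.
\<close>

lemma weak_partial_mult_smooth:
  assumes D: "open D" and p: "weak_partial D i f p"
    and \<psi>: "\<And>k. Ck k \<psi>" "\<And>x. (\<psi> has_derivative \<psi>' x) (at x)"
    and bounds: "\<And>x. \<bar>\<psi> x\<bar> \<le> C" "\<And>x. \<bar>\<psi>' x (axis i 1)\<bar> \<le> C'"
  shows "weak_partial D i (\<lambda>x. \<psi> x * f x) (\<lambda>x. \<psi> x * p x + \<psi>' x (axis i 1) * f x)"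
proof -
  have f: "integrable (lebesgue_on D) f" and pi: "integrable (lebesgue_on D) p"
    and eq: "\<And>\<phi>. \<phi> \<in> test_functions D \<Longrightarrow> (\<integral>x. frechet_derivative \<phi> (at x) (axis i 1) * f x \<partial>lebesgue_on D)
        = - (\<integral>x. \<phi> x * p x \<partial>lebesgue_on D)"
    using p by (auto simp: weak_partial_def)
  obtain \<psi>2 where \<psi>2: "\<forall>x. (\<psi> has_derivative \<psi>2 x) (at x)" "\<forall>v. continuous_on UNIV (\<lambda>x. \<psi>2 x v)"
    using \<psi>(1)[of "Suc 0"] by auto
  have "\<psi>2 = \<psi>'" using has_derivative_unique[OF \<psi>2(1)[rule_format] \<psi>(2)] by auto
  then have cont': "continuous_on UNIV (\<lambda>x. \<psi>' x v)" for v using \<psi>2(2) by simp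
  have cont: "continuous_on UNIV \<psi>" using \<psi>(1)[of 0] by simp
  note \<psi>m = continuous_measurable_lebesgue_on[OF D cont] continuous_measurable_lebesgue_on[OF D cont']
  have ints: "integrable (lebesgue_on D) (\<lambda>x. \<psi> x * f x)" "integrable (lebesgue_on D) (\<lambda>x. \<psi> x * p x)"
      "integrable (lebesgue_on D) (\<lambda>x. \<psi>' x (axis i 1) * f x)"
    using integrable_bounded_mult[OF f \<psi>m(1) bounds(1)] integrable_bounded_mult[OF pi \<psi>m(1) bounds(1)]
      integrable_bounded_mult[OF f \<psi>m(2) bounds(2)] by auto
  show ?thesis
    unfolding weak_partial_def
  proof (intro conjI ballI)
    fix \<phi> :: "real^3 \<Rightarrow> real" assume \<phi>: "\<phi> \<in> test_functions D"
    have \<phi>\<psi>: "(\<lambda>x. \<phi> x * \<psi> x) \<in> test_functions D" by (rule test_function_mult[OF \<phi> \<psi>(1)])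
    have "(\<integral>x. frechet_derivative \<phi> (at x) (axis i 1) * (\<psi> x * f x) \<partial>lebesgue_on D)
        + (\<integral>x. \<phi> x * (\<psi>' x (axis i 1) * f x) \<partial>lebesgue_on D)
        = (\<integral>x. frechet_derivative (\<lambda>x. \<phi> x * \<psi> x) (at x) (axis i 1) * f x \<partial>lebesgue_on D)"
      unfolding frechet_derivative_mult_test_function[OF \<phi> \<psi>(2)]
      using integrable_test_function_partial_mult_on[OF D ints(1) \<phi>, of "axis i 1"] integrable_test_function_mult_on[OF D ints(3) \<phi>]
      by (simp add: distrib_right mult.assoc)
    also have "\<dots> = - (\<integral>x. \<phi> x * (\<psi> x * p x) \<partial>lebesgue_on D)"
      using eq[OF \<phi>\<psi>] by (simp add: mult.assoc)
    finally show "(\<integral>x. frechet_derivative \<phi> (at x) (axis i 1) * (\<psi> x * f x) \<partial>lebesgue_on D)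
        = - (\<integral>x. \<phi> x * (\<psi> x * p x + \<psi>' x (axis i 1) * f x) \<partial>lebesgue_on D)"
      using integrable_test_function_mult_on[OF D ints(2) \<phi>] integrable_test_function_mult_on[OF D ints(3) \<phi>]
      by (simp add: distrib_left)
  qed (use ints in auto)
qed

lemma weak_partial_const:
  assumes D: "open D" "bounded D"
  shows "weak_partial D i (\<lambda>x. c) (\<lambda>x. 0)"
proof -
  interpret finite_measure "lebesgue_on D"
    by (intro finite_measure_lebesgue_on lmeasurable_open D)
  have D': "D \<inter> space lebesgue \<in> sets lebesgue" using D by (simp add: borel_open)
  have "(\<integral>x. frechet_derivative \<phi> (at x) (axis i 1) \<partial>lebesgue_on D) = 0"
    if \<phi>: "\<phi> \<in> test_functions D" for \<phi>
  proof -
    have z: "frechet_derivative \<phi> (at x) v = 0" if "x \<notin> D" for x v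
      using test_function_partial_outside[OF \<phi>, of x v] \<phi> that by (auto simp: test_functions_def)
    have "(\<lambda>x. indicator D x * frechet_derivative \<phi> (at x) (axis i 1)) = (\<lambda>x. frechet_derivative \<phi> (at x) (axis i 1))"
      using z by (fastforce simp: indicator_def)
    then have "(\<integral>x. frechet_derivative \<phi> (at x) (axis i 1) \<partial>lebesgue_on D)
        = (\<integral>x. frechet_derivative \<phi> (at x) (axis i 1) \<partial>lebesgue)"
      unfolding integral_restrict_space[OF D'] by simp
    also have "\<dots> = (\<integral>x. frechet_derivative \<phi> (at x) (axis i 1) \<partial>lborel)"
      using borel_measurable_continuous_onI[OF test_function_partial_continuous[OF \<phi>]]
      by (intro integral_completion) simp
    finally show ?thesis using integral_test_function_partial[OF \<phi>] by simp
  qed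
  then show ?thesis by (simp add: weak_partial_def)
qed

lemma weak_partials_zero_imp_AE_const:
  assumes D: "open D" "connected D"
    and p: "\<And>i. weak_partial D i f (p i)" "\<And>i. AE x in lebesgue_on D. p i x = 0"
  obtains c where "AE x in lebesgue_on D. f x = c"
proof -
  have f: "integrable (lebesgue_on D) f" using p(1) by (auto simp: weak_partial_def)
  obtain g where g: "integrable lborel g" "AE x in lborel. x \<in> D \<longrightarrow> f x = g x"
    "\<forall>\<psi>\<in>borel_measurable borel. (\<forall>x. x \<notin> D \<longrightarrow> \<psi> x = 0) \<longrightarrow>
      (\<integral>x. \<psi> x * f x \<partial>lebesgue_on D) = (\<integral>x. g x * \<psi> x \<partial>lborel)"
    by (rule borel_representative[OF D(1) f])
  have "(\<integral>x. g x * frechet_derivative \<phi> (at x) (axis i 1) \<partial>lborel) = 0" if \<phi>: "\<phi> \<in> test_functions D" for \<phi> i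
  proof -
    have "(\<integral>x. g x * frechet_derivative \<phi> (at x) (axis i 1) \<partial>lborel)
        = (\<integral>x. frechet_derivative \<phi> (at x) (axis i 1) * f x \<partial>lebesgue_on D)"
    proof (rule g(3)[rule_format, symmetric])
      show "(\<lambda>x. frechet_derivative \<phi> (at x) (axis i 1)) \<in> borel_measurable borel"
        by (intro borel_measurable_continuous_onI test_function_partial_continuous[OF \<phi>])
      show "frechet_derivative \<phi> (at x) (axis i 1) = 0" if "x \<notin> D" for x
        using test_function_partial_outside[OF \<phi>, of x] \<phi> that by (auto simp: test_functions_def)
    qed
    also have "\<dots> = - (\<integral>x. \<phi> x * p i x \<partial>lebesgue_on D)"
      using p(1)[of i] \<phi> by (simp add: weak_partial_def)
    also have "(\<integral>x. \<phi> x * p i x \<partial>lebesgue_on D) = 0"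
      using p(2)[of i] by (intro integral_eq_zero_AE) (auto elim!: eventually_mono)
    finally show ?thesis by simp
  qed
  then obtain c where "AE x in lborel. x \<in> D \<longrightarrow> g x = c"
    by (rule weak_gradient_zero_imp_const[OF D g(1)])
  with g(2) have "AE x in lborel. x \<in> D \<longrightarrow> f x = c" by eventually_elim simp
  then show ?thesis by (intro that) (simp add: AE_lebesgue_on_lborel[OF D(1)])
qed

lemma integral_vec_component:
  fixes f :: "'x \<Rightarrow> real^'n"
  assumes "integrable N f"
  shows "(\<integral>x. f x \<partial>N) $ i = (\<integral>x. f x $ i \<partial>N)"
  using integral_bounded_linear[OF bounded_linear_vec_nth assms, of i] by simp

lemma integrable_vec_iff:
  fixes f :: "'x \<Rightarrow> real^'n"
  shows "integrable N f \<longleftrightarrow> (\<forall>i. integrable N (\<lambda>x. f x $ i))"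
proof
  assume "\<forall>i. integrable N (\<lambda>x. f x $ i)"
  then have "integrable N (\<lambda>x. \<Sum>i\<in>UNIV. f x $ i *\<^sub>R (axis i 1 :: real^'n))" by auto
  moreover have "(\<Sum>i\<in>UNIV. f x $ i *\<^sub>R (axis i 1 :: real^'n)) = f x" for x
    using basis_expansion[of "f x"] by (simp add: scalar_mult_eq_scaleR)
  ultimately show "integrable N f" by (simp only:)
qed (intro allI integrable_bounded_linear[OF bounded_linear_vec_nth])

lemma is_weak_grad_iff:
  assumes D: "open D" "bounded D" and m: "m \<in> L2 (lebesgue_on D)"
  shows "is_weak_grad D m g \<longleftrightarrow> g \<in> L2 (lebesgue_on D) \<and>
    (\<forall>i j. weak_partial D i (\<lambda>x. m x $ j) (\<lambda>x. g x $ i $ j))"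
proof -
  interpret finite_measure "lebesgue_on D"
    by (intro finite_measure_lebesgue_on lmeasurable_open D)
  have mi: "integrable (lebesgue_on D) (\<lambda>x. m x $ j)" for j
  proof -
    have "integrable (lebesgue_on D) m" by (rule L2_imp_integrable[OF m])
    then show ?thesis using integrable_vec_iff by blast
  qed
  have "(\<forall>\<phi> \<in> test_functions D. \<forall>i.
        (\<integral>x. frechet_derivative \<phi> (at x) (axis i 1) *\<^sub>R m x \<partial>lebesgue_on D)
          = - (\<integral>x. \<phi> x *\<^sub>R (g x $ i) \<partial>lebesgue_on D)) \<longleftrightarrow>
     (\<forall>i j. weak_partial D i (\<lambda>x. m x $ j) (\<lambda>x. g x $ i $ j))" if g: "g \<in> L2 (lebesgue_on D)"
  proof -
    have gi: "integrable (lebesgue_on D) (\<lambda>x. g x $ i $ j)" for i j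
      using square_integrable_imp_integrable[OF L2_entry[OF g]] .
    have "(\<integral>x. frechet_derivative \<phi> (at x) (axis i 1) *\<^sub>R m x \<partial>lebesgue_on D) $ j
          = (\<integral>x. frechet_derivative \<phi> (at x) (axis i 1) * m x $ j \<partial>lebesgue_on D)"
        "(\<integral>x. \<phi> x *\<^sub>R (g x $ i) \<partial>lebesgue_on D) $ j = (\<integral>x. \<phi> x * g x $ i $ j \<partial>lebesgue_on D)"
      if \<phi>: "\<phi> \<in> test_functions D" for \<phi> i j
      using integrable_test_function_mult_on[OF D(1) gi \<phi>] integrable_test_function_partial_mult_on[OF D(1) mi \<phi>]
      by (subst integral_vec_component, unfold integrable_vec_iff, simp, simp)+
    then show ?thesis
      using mi gi by (auto simp: weak_partial_def vec_eq_iff)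
  qed
  then show ?thesis by (auto simp: is_weak_grad_def)
qed

section \<open>The homogenized coefficients of a layered material\<close>

lemma norm_axis_eq: "norm (axis i v) = norm v" for v :: "'b::real_inner"
  unfolding norm_eq_sqrt_inner by (simp add: inner_axis)

lemma axis33_congruence:
  "transpose (p *\<^sub>R axis 3 (axis 3 1) :: real^3^3) ** (a *\<^sub>R (q *\<^sub>R axis 3 (axis 3 1) :: real^3^3)) = (a * p * q) *\<^sub>R (axis 3 (axis 3 1) :: real^3^3)"
  by (simp add: vec_eq_iff forall_3 matrix_matrix_mult_def transpose_def axis_def sum_3)

lemma inner_layered_matrix:
  fixes g h :: "real^3^3"
  shows "g \<bullet> ((s *\<^sub>R mat 1 + t *\<^sub>R axis 3 (axis 3 1)) ** h) = s * (g \<bullet> h) + t * (g $ 3 \<bullet> h $ 3)"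
proof -
  have "(s *\<^sub>R mat 1 + t *\<^sub>R axis 3 (axis 3 1)) ** h = s *\<^sub>R h + t *\<^sub>R axis 3 (h $ 3)"
    by (simp add: vec_eq_iff forall_3 matrix_matrix_mult_def axis_def mat_def sum_3 distrib_right)
  moreover have "g \<bullet> axis 3 (h $ 3) = g $ 3 \<bullet> h $ 3" by (rule inner_axis)
  ultimately show ?thesis by (simp add: inner_add_right)
qed

lemma borel_measurable_vecI:
  fixes f :: "'x \<Rightarrow> 'b::euclidean_space^'n"
  assumes "\<And>i. (\<lambda>x. f x $ i) \<in> borel_measurable N"
  shows "f \<in> borel_measurable N"
proof (subst borel_measurable_euclidean_space, rule ballI)
  fix b :: "'b^'n" assume "b \<in> Basis"
  then obtain i u where "b = axis i u" by (auto simp: Basis_vec_def)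
  then show "(\<lambda>x. f x \<bullet> b) \<in> borel_measurable N"
    using assms[of i] by (simp add: inner_axis)
qed

lemma borel_measurable_matrix_congruence:
  fixes P Q :: "'x \<Rightarrow> real^3^3"
  assumes "P \<in> borel_measurable N" "Q \<in> borel_measurable N" "a \<in> borel_measurable N"
  shows "(\<lambda>w. transpose (P w) ** (a w *\<^sub>R Q w)) \<in> borel_measurable N"
proof -
  note [measurable] = borel_measurable_entry(2)[OF assms(1)] borel_measurable_entry(2)[OF assms(2)] assms(3)
  show ?thesis
    by (intro borel_measurable_vecI) (simp add: matrix_matrix_mult_def transpose_def)
qed

context ergodic_system
begin

text \<open>
  Only the entry \<open>(3, 3)\<close> of the corrector products is nonzero, and each expectation is a combination of
  \<open>E[1/a] = 1/\<alpha>\<close>, \<open>E[\<kappa>/a] = \<beta>\<close>, \<open>E[\<kappa>\<^sup>2/a] = K\<close>, \<open>E[a]\<close> and \<open>E[\<kappa>] = 0\<close>.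
\<close>

lemma homogenized_coefficients:
  assumes layered: "\<And>x. T x = T (x $ 3 *\<^sub>R axis 3 1)"
    and a: "a \<in> borel_measurable M" "\<And>w. c \<le> a w \<and> a w \<le> C" "0 < c"
    and \<kappa>: "\<kappa> \<in> borel_measurable M" "\<And>w. \<bar>\<kappa> w\<bar> \<le> C'" "(\<integral>w. \<kappa> w \<partial>M) = 0"
    and \<Theta>\<^sub>a: "is_corrector M T a a \<Theta>\<^sub>a" and \<Theta>\<^sub>\<kappa>: "is_corrector M T a \<kappa> \<Theta>\<^sub>\<kappa>"
  defines "\<alpha> \<equiv> 1 / (\<integral>w. 1 / a w \<partial>M)" and "\<beta> \<equiv> (\<integral>w. \<kappa> w / a w \<partial>M)" and "K \<equiv> (\<integral>w. (\<kappa> w)\<^sup>2 / a w \<partial>M)"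
  shows "0 < (\<integral>w. a w \<partial>M)" "0 < \<alpha>" "0 \<le> K" "K = 0 \<Longrightarrow> AE w in M. \<kappa> w = 0"
    and "(\<integral>w. a w *\<^sub>R mat 1 - transpose (\<Theta>\<^sub>a w) ** (a w *\<^sub>R \<Theta>\<^sub>a w) \<partial>M)
      = (\<integral>w. a w \<partial>M) *\<^sub>R mat 1 + (\<alpha> - (\<integral>w. a w \<partial>M)) *\<^sub>R axis 3 (axis 3 1)"
    and "(\<integral>w. \<kappa> w *\<^sub>R mat 1 - transpose (\<Theta>\<^sub>a w) ** (a w *\<^sub>R \<Theta>\<^sub>\<kappa> w) \<partial>M)
      = 0 *\<^sub>R mat 1 + (\<alpha> * \<beta>) *\<^sub>R axis 3 (axis 3 1)"
    and "(\<integral>w. transpose (\<Theta>\<^sub>\<kappa> w) ** (a w *\<^sub>R \<Theta>\<^sub>\<kappa> w) \<partial>M)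
      = 0 *\<^sub>R mat 1 + (K - \<alpha> * \<beta>\<^sup>2) *\<^sub>R axis 3 (axis 3 1)"
proof -
  note [measurable] = a(1) \<kappa>(1)
  define E :: "real^3^3" where "E = axis 3 (axis 3 1)"
  have apos: "a w > 0" for w using a(2)[of w] a(3) by linarith
  have inv_bound: "\<bar>1 / a w\<bar> \<le> 1 / c" for w
    using apos[of w] a(2)[of w] a(3) by (simp add: frac_le)
  have int_a: "integrable M a"
    using a(2) apos by (intro integrable_const_bound[of _ C]) (auto intro!: AE_I2 simp: abs_of_pos)
  have int_\<kappa>: "integrable M \<kappa>"
    using \<kappa>(2) by (intro integrable_const_bound[of _ C']) auto
  have int_inv: "integrable M (\<lambda>w. 1 / a w)"
    using inv_bound by (intro integrable_const_bound[of _ "1 / c"]) auto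
  have int_\<kappa>a: "integrable M (\<lambda>w. \<kappa> w / a w)"
    using integrable_bounded_mult[OF int_inv \<kappa>(1,2)] by simp
  have int_\<kappa>2: "integrable M (\<lambda>w. (\<kappa> w)\<^sup>2 / a w)"
    using integrable_bounded_mult[OF int_\<kappa>a \<kappa>(1,2)] by (simp add: power2_eq_square)
  have pos: "0 < (\<integral>w. f w \<partial>M)" if "integrable M f" "\<And>w. 0 < f w" for f :: "'w \<Rightarrow> real"
  proof -
    have "(\<integral>w. 0 \<partial>M) < (\<integral>w. f w \<partial>M)"
      using that by (intro integral_less_AE_space) (auto simp: emeasure_space_1)
    then show ?thesis by simp
  qed
  show "0 < (\<integral>w. a w \<partial>M)" using pos[OF int_a apos] .
  have I: "0 < (\<integral>w. 1 / a w \<partial>M)" using pos[OF int_inv] apos by simp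
  then show "0 < \<alpha>" by (simp add: \<alpha>_def)
  have I\<alpha>: "(\<integral>w. 1 / a w \<partial>M) = 1 / \<alpha>" using I by (simp add: \<alpha>_def)
  have \<alpha>: "\<alpha> > 0" by fact
  show "0 \<le> K" unfolding K_def using apos by (intro integral_nonneg_AE) (auto simp: less_imp_le)
  show "AE w in M. \<kappa> w = 0" if "K = 0"
  proof -
    have "AE w in M. (\<kappa> w)\<^sup>2 / a w = 0"
      using integral_nonneg_eq_0_iff_AE[OF int_\<kappa>2] apos that by (simp add: K_def less_imp_le)
    moreover have "a w \<noteq> 0" for w using apos[of w] by simp
    ultimately show ?thesis by simp
  qed
  have "AE w in M. \<Theta>\<^sub>a w = (((\<integral>w. a w / a w \<partial>M) / (\<integral>w. 1 / a w \<partial>M) - a w) / a w) *\<^sub>R E"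
    unfolding E_def using a apos by (intro corrector_explicit[OF layered a(1) _ a(3) a(1) _ \<Theta>\<^sub>a, of C]) (auto simp: abs_of_pos)
  moreover have "(\<integral>w. a w / a w \<partial>M) = 1" using apos by (simp add: less_imp_neq[symmetric] prob_space)
  ultimately have Ta: "AE w in M. \<Theta>\<^sub>a w = ((\<alpha> - a w) / a w) *\<^sub>R E" by (simp add: I\<alpha>)
  have "AE w in M. \<Theta>\<^sub>\<kappa> w = (((\<integral>w. \<kappa> w / a w \<partial>M) / (\<integral>w. 1 / a w \<partial>M) - \<kappa> w) / a w) *\<^sub>R E"
    unfolding E_def using a by (intro corrector_explicit[OF layered a(1) _ a(3) \<kappa>(1,2) \<Theta>\<^sub>\<kappa>]) auto
  then have Tk: "AE w in M. \<Theta>\<^sub>\<kappa> w = ((\<alpha> * \<beta> - \<kappa> w) / a w) *\<^sub>R E" by (simp add: I\<alpha> \<beta>_def mult.commute)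
  have \<Theta>m: "\<Theta>\<^sub>a \<in> borel_measurable M" "\<Theta>\<^sub>\<kappa> \<in> borel_measurable M"
    using \<Theta>\<^sub>a \<Theta>\<^sub>\<kappa> by (auto simp: is_corrector_def L2_pot_def L2_def)
  have mult: "a * ((p - a) / a) * ((p - a) / a) = p * p * (1 / a) - 2 * p + a"
    "a * ((p - a) / a) * ((q - k) / a) = p * q * (1 / a) - p * (k / a) - q + k"
    "a * ((q - k) / a) * ((q - k) / a) = q\<^sup>2 * (1 / a) - 2 * q * (k / a) + k\<^sup>2 / a"
    if "a > 0" for a p q k :: real
    using that by (simp_all add: field_simps power2_eq_square)

  have "(\<integral>w. a w *\<^sub>R mat 1 - transpose (\<Theta>\<^sub>a w) ** (a w *\<^sub>R \<Theta>\<^sub>a w) \<partial>M)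
      = (\<integral>w. a w *\<^sub>R mat 1 - (\<alpha> * \<alpha> * (1 / a w) - 2 * \<alpha> + a w) *\<^sub>R E \<partial>M)"
  proof (rule integral_cong_AE)
    show "AE w in M. a w *\<^sub>R mat 1 - transpose (\<Theta>\<^sub>a w) ** (a w *\<^sub>R \<Theta>\<^sub>a w)
        = a w *\<^sub>R mat 1 - (\<alpha> * \<alpha> * (1 / a w) - 2 * \<alpha> + a w) *\<^sub>R E"
      using Ta by eventually_elim (simp only: E_def axis33_congruence mult(1)[OF apos])
  qed (auto intro!: borel_measurable_diff borel_measurable_matrix_congruence \<Theta>m)
  also have "\<dots> = (\<integral>w. a w \<partial>M) *\<^sub>R mat 1 - (\<alpha> * \<alpha> * (1 / \<alpha>) - 2 * \<alpha> + (\<integral>w. a w \<partial>M)) *\<^sub>R E"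
  proof -
    have i: "integrable M (\<lambda>w. \<alpha> * \<alpha> * (1 / a w) - 2 * \<alpha>)" "(\<integral>w. \<alpha> * \<alpha> * (1 / a w) - 2 * \<alpha> \<partial>M) = \<alpha> * \<alpha> * (1 / \<alpha>) - 2 * \<alpha>"
      using int_inv integrable_mult_right[OF int_inv, of "\<alpha> * \<alpha>"] integral_mult_right_zero[of M "\<alpha> * \<alpha>" "\<lambda>w. 1 / a w"]
      by (simp_all add: prob_space I\<alpha> del: times_divide_eq_right mult_1_right)
    then show ?thesis using int_a by simp
  qed
  also have "\<dots> = (\<integral>w. a w \<partial>M) *\<^sub>R mat 1 + (\<alpha> - (\<integral>w. a w \<partial>M)) *\<^sub>R E"
    using \<alpha> by (simp add: power2_eq_square algebra_simps)
  finally show "(\<integral>w. a w *\<^sub>R mat 1 - transpose (\<Theta>\<^sub>a w) ** (a w *\<^sub>R \<Theta>\<^sub>a w) \<partial>M)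
      = (\<integral>w. a w \<partial>M) *\<^sub>R mat 1 + (\<alpha> - (\<integral>w. a w \<partial>M)) *\<^sub>R axis 3 (axis 3 1)" by (simp add: E_def)

  have "(\<integral>w. \<kappa> w *\<^sub>R mat 1 - transpose (\<Theta>\<^sub>a w) ** (a w *\<^sub>R \<Theta>\<^sub>\<kappa> w) \<partial>M)
      = (\<integral>w. \<kappa> w *\<^sub>R mat 1 - (\<alpha> * (\<alpha> * \<beta>) * (1 / a w) - \<alpha> * (\<kappa> w / a w) - \<alpha> * \<beta> + \<kappa> w) *\<^sub>R E \<partial>M)"
  proof (rule integral_cong_AE)
    show "AE w in M. \<kappa> w *\<^sub>R mat 1 - transpose (\<Theta>\<^sub>a w) ** (a w *\<^sub>R \<Theta>\<^sub>\<kappa> w)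
        = \<kappa> w *\<^sub>R mat 1 - (\<alpha> * (\<alpha> * \<beta>) * (1 / a w) - \<alpha> * (\<kappa> w / a w) - \<alpha> * \<beta> + \<kappa> w) *\<^sub>R E"
      using Ta Tk by eventually_elim (simp only: E_def axis33_congruence mult(2)[OF apos])
  qed (auto intro!: borel_measurable_diff borel_measurable_matrix_congruence \<Theta>m)
  also have "\<dots> = (\<integral>w. \<kappa> w \<partial>M) *\<^sub>R mat 1 - (\<alpha> * (\<alpha> * \<beta>) * (1 / \<alpha>) - \<alpha> * \<beta> - \<alpha> * \<beta> + (\<integral>w. \<kappa> w \<partial>M)) *\<^sub>R E"
  proof -
    have i: "integrable M (\<lambda>w. \<alpha> * (\<alpha> * \<beta>) * (1 / a w) - \<alpha> * (\<kappa> w / a w) - \<alpha> * \<beta>)"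
        "(\<integral>w. \<alpha> * (\<alpha> * \<beta>) * (1 / a w) - \<alpha> * (\<kappa> w / a w) - \<alpha> * \<beta> \<partial>M)
          = \<alpha> * (\<alpha> * \<beta>) * (1 / \<alpha>) - \<alpha> * \<beta> - \<alpha> * \<beta>"
      using integrable_mult_right[OF int_inv, of "\<alpha> * (\<alpha> * \<beta>)"] integral_mult_right_zero[of M "\<alpha> * (\<alpha> * \<beta>)" "\<lambda>w. 1 / a w"]
        integrable_mult_right[OF int_\<kappa>a, of \<alpha>] integral_mult_right_zero[of M \<alpha> "\<lambda>w. \<kappa> w / a w"]
      by (simp_all add: prob_space I\<alpha> \<beta>_def[symmetric] del: times_divide_eq_right mult_1_right)
    then show ?thesis using int_\<kappa> by simp
  qed
  also have "\<dots> = 0 *\<^sub>R mat 1 + (\<alpha> * \<beta>) *\<^sub>R E"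
    using \<alpha> \<kappa>(3) by (simp add: algebra_simps)
  finally show "(\<integral>w. \<kappa> w *\<^sub>R mat 1 - transpose (\<Theta>\<^sub>a w) ** (a w *\<^sub>R \<Theta>\<^sub>\<kappa> w) \<partial>M)
      = 0 *\<^sub>R mat 1 + (\<alpha> * \<beta>) *\<^sub>R axis 3 (axis 3 1)" by (simp add: E_def)

  have "(\<integral>w. transpose (\<Theta>\<^sub>\<kappa> w) ** (a w *\<^sub>R \<Theta>\<^sub>\<kappa> w) \<partial>M)
      = (\<integral>w. ((\<alpha> * \<beta>)\<^sup>2 * (1 / a w) - 2 * (\<alpha> * \<beta>) * (\<kappa> w / a w) + (\<kappa> w)\<^sup>2 / a w) *\<^sub>R E \<partial>M)"
  proof (rule integral_cong_AE)
    show "AE w in M. transpose (\<Theta>\<^sub>\<kappa> w) ** (a w *\<^sub>R \<Theta>\<^sub>\<kappa> w)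
        = ((\<alpha> * \<beta>)\<^sup>2 * (1 / a w) - 2 * (\<alpha> * \<beta>) * (\<kappa> w / a w) + (\<kappa> w)\<^sup>2 / a w) *\<^sub>R E"
      using Tk by eventually_elim (simp only: E_def axis33_congruence mult(3)[OF apos])
  qed (auto intro!: borel_measurable_diff borel_measurable_matrix_congruence \<Theta>m)
  also have "\<dots> = ((\<alpha> * \<beta>)\<^sup>2 * (1 / \<alpha>) - 2 * (\<alpha> * \<beta>) * \<beta> + K) *\<^sub>R E"
  proof -
    have i: "integrable M (\<lambda>w. (\<alpha> * \<beta>)\<^sup>2 * (1 / a w) - 2 * (\<alpha> * \<beta>) * (\<kappa> w / a w))"
        "(\<integral>w. (\<alpha> * \<beta>)\<^sup>2 * (1 / a w) - 2 * (\<alpha> * \<beta>) * (\<kappa> w / a w) \<partial>M)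
          = (\<alpha> * \<beta>)\<^sup>2 * (1 / \<alpha>) - 2 * (\<alpha> * \<beta>) * \<beta>"
      using integrable_mult_right[OF int_inv, of "(\<alpha> * \<beta>)\<^sup>2"] integral_mult_right_zero[of M "(\<alpha> * \<beta>)\<^sup>2" "\<lambda>w. 1 / a w"]
        integrable_mult_right[OF int_\<kappa>a, of "2 * (\<alpha> * \<beta>)"] integral_mult_right_zero[of M "2 * (\<alpha> * \<beta>)" "\<lambda>w. \<kappa> w / a w"]
      by (simp_all add: I\<alpha> \<beta>_def[symmetric] del: times_divide_eq_right mult_1_right)
    then show ?thesis using int_\<kappa>2 by (simp add: K_def[symmetric])
  qed
  also have "\<dots> = 0 *\<^sub>R mat 1 + (K - \<alpha> * \<beta>\<^sup>2) *\<^sub>R E"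
    using \<alpha> by (simp add: power2_eq_square algebra_simps)
  finally show "(\<integral>w. transpose (\<Theta>\<^sub>\<kappa> w) ** (a w *\<^sub>R \<Theta>\<^sub>\<kappa> w) \<partial>M)
      = 0 *\<^sub>R mat 1 + (K - \<alpha> * \<beta>\<^sup>2) *\<^sub>R axis 3 (axis 3 1)" by (simp add: E_def)
qed

end

section \<open>Completing the square in the homogenized energy\<close>

text \<open>
  The pointwise excess of twice the energy density over its minimum \<open>- K\<close>, for a state \<open>s\<close> with gradient \<open>g\<close>.
\<close>

definition energy_defect :: "real \<Rightarrow> real \<Rightarrow> real \<Rightarrow> real \<Rightarrow> real^3 \<Rightarrow> real^3^3 \<Rightarrow> real" where
  "energy_defect A \<alpha> \<beta> K s g =
     A * ((norm (g $ 1))\<^sup>2 + (norm (g $ 2))\<^sup>2) + \<alpha> * (norm (g $ 3 - \<beta> *\<^sub>R cross3 (axis 3 1) s))\<^sup>2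
     + K * (1 - (norm (cross3 (axis 3 1) s))\<^sup>2)"

lemma norm_cross3_axis3: "(norm (cross3 (axis 3 1) s))\<^sup>2 = (s $ 1)\<^sup>2 + (s $ 2)\<^sup>2"
  unfolding power2_norm_eq_inner
  by (simp add: inner_vec_def sum_3 cross_components axis_def power2_eq_square)

lemma norm_vec3: "(norm s)\<^sup>2 = (s $ 1)\<^sup>2 + (s $ 2)\<^sup>2 + (s $ 3)\<^sup>2" for s :: "real^3"
  unfolding power2_norm_eq_inner by (simp add: inner_vec_def sum_3 power2_eq_square)

lemma energy_defect_nonneg:
  assumes "0 \<le> A" "0 \<le> \<alpha>" "0 \<le> K" "norm s = 1"
  shows "0 \<le> energy_defect A \<alpha> \<beta> K s g"
proof -
  have "1 = (s $ 1)\<^sup>2 + (s $ 2)\<^sup>2 + (s $ 3)\<^sup>2" using norm_vec3[of s] assms(4) by simp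
  then have "(norm (cross3 (axis 3 1) s))\<^sup>2 \<le> 1"
    unfolding norm_cross3_axis3 using zero_le_power2[of "s $ 3"] by linarith
  then show ?thesis using assms by (simp add: energy_defect_def)
qed

lemma energy_defect_eq_0D:
  assumes "0 < A" "0 < \<alpha>" "0 < K" "norm s = 1" "energy_defect A \<alpha> \<beta> K s g = 0"
  shows "g $ 1 = 0" "g $ 2 = 0" "g $ 3 = \<beta> *\<^sub>R cross3 (axis 3 1) s" "s $ 3 = 0"
proof -
  have s: "1 - (norm (cross3 (axis 3 1) s))\<^sup>2 = (s $ 3)\<^sup>2"
    unfolding norm_cross3_axis3 using norm_vec3[of s] assms(4) by simp
  have "A * ((norm (g $ 1))\<^sup>2 + (norm (g $ 2))\<^sup>2) + \<alpha> * (norm (g $ 3 - \<beta> *\<^sub>R cross3 (axis 3 1) s))\<^sup>2 + K * (s $ 3)\<^sup>2 = 0"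
    using assms(5) by (simp add: energy_defect_def s)
  moreover have "0 \<le> A * ((norm (g $ 1))\<^sup>2 + (norm (g $ 2))\<^sup>2)" "0 \<le> \<alpha> * (norm (g $ 3 - \<beta> *\<^sub>R cross3 (axis 3 1) s))\<^sup>2"
      "0 \<le> K * (s $ 3)\<^sup>2"
    using assms(1-3) by simp_all
  ultimately have "A * ((norm (g $ 1))\<^sup>2 + (norm (g $ 2))\<^sup>2) = 0"
      "\<alpha> * (norm (g $ 3 - \<beta> *\<^sub>R cross3 (axis 3 1) s))\<^sup>2 = 0" "K * (s $ 3)\<^sup>2 = 0"
    by linarith+
  then show "g $ 1 = 0" "g $ 2 = 0" "g $ 3 = \<beta> *\<^sub>R cross3 (axis 3 1) s" "s $ 3 = 0"
    using assms(1-3) by (simp_all add: sum_power2_eq_zero_iff)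
qed

text \<open>
  The term \<open>- \<alpha> \<beta>\<^sup>2 |e\<^sub>3 \<times> m|\<^sup>2\<close> in the third tensor is what makes the square complete: the cross term
  contributes \<open>- 2 \<alpha> \<beta> \<partial>\<^sub>3 m \<bullet> (e\<^sub>3 \<times> m)\<close>, and \<open>- K |e\<^sub>3 \<times> m|\<^sup>2\<close> is left over.
\<close>

lemma G_hom_eq_defect:
  assumes D: "open D" "bounded D" and m: "m \<in> H1_sphere D"
    and A: "(\<integral>w. a w *\<^sub>R mat 1 - transpose (\<Theta>\<^sub>a w) ** (a w *\<^sub>R \<Theta>\<^sub>a w) \<partial>M)
      = A *\<^sub>R mat 1 + (\<alpha> - A) *\<^sub>R axis 3 (axis 3 1)"
    and B: "(\<integral>w. \<kappa> w *\<^sub>R mat 1 - transpose (\<Theta>\<^sub>a w) ** (a w *\<^sub>R \<Theta>\<^sub>\<kappa> w) \<partial>M)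
      = 0 *\<^sub>R mat 1 + (\<alpha> * \<beta>) *\<^sub>R axis 3 (axis 3 1)"
    and C: "(\<integral>w. transpose (\<Theta>\<^sub>\<kappa> w) ** (a w *\<^sub>R \<Theta>\<^sub>\<kappa> w) \<partial>M)
      = 0 *\<^sub>R mat 1 + (K - \<alpha> * \<beta>\<^sup>2) *\<^sub>R axis 3 (axis 3 1)"
  shows "integrable (lebesgue_on D) (\<lambda>x. energy_defect A \<alpha> \<beta> K (m x) (weak_grad D m x))"
    and "G_hom M a \<kappa> \<Theta>\<^sub>a \<Theta>\<^sub>\<kappa> D m
      = 1/2 * (\<integral>x. energy_defect A \<alpha> \<beta> K (m x) (weak_grad D m x) \<partial>lebesgue_on D) - 1/2 * K * measure lebesgue D"
proof -
  interpret finite_measure "lebesgue_on D"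
    by (intro finite_measure_lebesgue_on lmeasurable_open D)
  define g where "g = weak_grad D m"
  define n where "n x = cross3 (axis 3 1) (m x)" for x
  have "m \<in> H1 D" using m by (simp add: H1_sphere_def)
  then have "is_weak_grad D m g" and mL: "m \<in> L2 (lebesgue_on D)"
    unfolding g_def weak_grad_def H1_def using someI_ex[of "is_weak_grad D m"] by auto
  then have gL: "g \<in> L2 (lebesgue_on D)" by (simp add: is_weak_grad_def)
  have gm: "g \<in> borel_measurable (lebesgue_on D)" and g2: "integrable (lebesgue_on D) (\<lambda>x. g x \<bullet> g x)"
    using gL by (auto simp: L2_def power2_norm_eq_inner)
  have nm: "n \<in> borel_measurable (lebesgue_on D)"
  proof -
    have "continuous_on UNIV (cross3 (axis 3 1))"
      using continuous_on_cross[OF continuous_on_const continuous_on_id, of UNIV "axis 3 1"] by (simp add: id_def)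
    then have "cross3 (axis 3 1) \<in> borel_measurable borel" by (rule borel_measurable_continuous_onI)
    moreover have "m \<in> borel_measurable (lebesgue_on D)" using mL by (simp add: L2_def)
    ultimately show ?thesis unfolding n_def by (rule measurable_compose[rotated])
  qed
  have n_le: "norm (n x) \<le> norm (m x)" for x
  proof (rule power2_le_imp_le)
    show "(norm (n x))\<^sup>2 \<le> (norm (m x))\<^sup>2"
      unfolding n_def norm_cross3_axis3 norm_vec3[of "m x"] by simp
  qed simp
  have int_n: "integrable (lebesgue_on D) (\<lambda>x. n x \<bullet> n x)"
  proof (rule Bochner_Integration.integrable_bound)
    show "integrable (lebesgue_on D) (\<lambda>x. (norm (m x))\<^sup>2)" using mL by (simp add: L2_def)
    show "AE x in lebesgue_on D. norm (n x \<bullet> n x) \<le> norm ((norm (m x))\<^sup>2)"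
      using n_le by (intro AE_I2) (simp add: power2_norm_eq_inner[symmetric] power_mono)
  qed (use nm in simp)
  have g3m: "(\<lambda>x. g x $ 3) \<in> borel_measurable (lebesgue_on D)" by (rule borel_measurable_entry[OF gm])
  have int_g3: "integrable (lebesgue_on D) (\<lambda>x. g x $ 3 \<bullet> g x $ 3)"
  proof (rule Bochner_Integration.integrable_bound[OF g2])
    have "norm (g x $ 3) \<le> norm (g x)" for x by (rule Finite_Cartesian_Product.norm_nth_le)
    then show "AE x in lebesgue_on D. norm (g x $ 3 \<bullet> g x $ 3) \<le> norm (g x \<bullet> g x)"
      by (intro AE_I2) (simp add: power2_norm_eq_inner[symmetric] power_mono)
  qed (use g3m in simp)
  have int_gn: "integrable (lebesgue_on D) (\<lambda>x. g x $ 3 \<bullet> n x)"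
  proof (rule Bochner_Integration.integrable_bound)
    show "integrable (lebesgue_on D) (\<lambda>x. g x $ 3 \<bullet> g x $ 3 + n x \<bullet> n x)" using int_g3 int_n by simp
    have "\<bar>g x $ 3 \<bullet> n x\<bar> \<le> g x $ 3 \<bullet> g x $ 3 + n x \<bullet> n x" for x
    proof -
      have "\<bar>g x $ 3 \<bullet> n x\<bar> \<le> norm (g x $ 3) * norm (n x)" by (rule Cauchy_Schwarz_ineq2)
      also have "\<dots> \<le> (norm (g x $ 3))\<^sup>2 + (norm (n x))\<^sup>2"
        using sum_squares_bound[of "norm (g x $ 3)" "norm (n x)"]
          mult_nonneg_nonneg[OF norm_ge_zero[of "g x $ 3"] norm_ge_zero[of "n x"]] by linarith
      finally show ?thesis by (simp add: power2_norm_eq_inner)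
    qed
    then show "AE x in lebesgue_on D. norm (g x $ 3 \<bullet> n x) \<le> norm (g x $ 3 \<bullet> g x $ 3 + n x \<bullet> n x)"
      by (intro AE_I2) (auto simp: abs_of_nonneg)
  qed (use g3m nm in simp)
  have sq: "energy_defect A \<alpha> \<beta> K (m x) (g x) = A * (g x \<bullet> g x) + (\<alpha> - A) * (g x $ 3 \<bullet> g x $ 3)
      - 2 * \<alpha> * \<beta> * (g x $ 3 \<bullet> n x) - (K - \<alpha> * \<beta>\<^sup>2) * (n x \<bullet> n x) + K" for x
  proof -
    have "g x \<bullet> g x = g x $ 1 \<bullet> g x $ 1 + g x $ 2 \<bullet> g x $ 2 + g x $ 3 \<bullet> g x $ 3"
      by (simp add: inner_vec_def[of "g x"] sum_3)
    then show ?thesis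
      unfolding energy_defect_def n_def[symmetric] power2_norm_eq_inner
      by (simp add: inner_diff_left inner_diff_right inner_commute algebra_simps power2_eq_square)
  qed
  show "integrable (lebesgue_on D) (\<lambda>x. energy_defect A \<alpha> \<beta> K (m x) (weak_grad D m x))"
    unfolding g_def[symmetric] sq using g2 int_g3 int_gn int_n by simp
  have "(\<integral>x. energy_defect A \<alpha> \<beta> K (m x) (g x) \<partial>lebesgue_on D)
      = (\<integral>x. A * (g x \<bullet> g x) + (\<alpha> - A) * (g x $ 3 \<bullet> g x $ 3) \<partial>lebesgue_on D)
      - 2 * \<alpha> * \<beta> * (\<integral>x. g x $ 3 \<bullet> n x \<partial>lebesgue_on D)
      - (K - \<alpha> * \<beta>\<^sup>2) * (\<integral>x. n x \<bullet> n x \<partial>lebesgue_on D) + K * measure lebesgue D"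
    unfolding sq using g2 int_g3 int_gn int_n D by (simp add: measure_restrict_space borel_open)
  moreover have "chi_mat (m x) $ 3 = n x" for x by (simp add: chi_mat_def n_def)
  ultimately show "G_hom M a \<kappa> \<Theta>\<^sub>a \<Theta>\<^sub>\<kappa> D m
      = 1/2 * (\<integral>x. energy_defect A \<alpha> \<beta> K (m x) (weak_grad D m x) \<partial>lebesgue_on D) - 1/2 * K * measure lebesgue D"
    unfolding G_hom_def Let_def A B C inner_layered_matrix g_def[symmetric]
    by (simp only: mult_zero_left add_0 integral_mult_right_zero) (simp add: algebra_simps)
qed

section \<open>The helical states\<close>

definition helix :: "real \<Rightarrow> real \<Rightarrow> real^3 \<Rightarrow> real^3" where
  "helix \<beta> \<theta> x = cos (\<theta> + \<beta> * x $ 3) *\<^sub>R axis 1 1 + sin (\<theta> + \<beta> * x $ 3) *\<^sub>R axis 2 1"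

lemma m_star_eq_helix: "m_star M a \<kappa> \<theta> = helix (\<integral>w. \<kappa> w / a w \<partial>M) \<theta>"
  by (simp add: m_star_def helix_def inner_axis fun_eq_iff)

lemma helix_components:
  "helix \<beta> \<theta> x $ 1 = cos (\<theta> + \<beta> * x $ 3)" "helix \<beta> \<theta> x $ 2 = sin (\<theta> + \<beta> * x $ 3)" "helix \<beta> \<theta> x $ 3 = 0"
  by (simp_all add: helix_def axis_def)

lemma norm_helix: "norm (helix \<beta> \<theta> x) = 1"
  using norm_vec3[of "helix \<beta> \<theta> x"] by (simp add: helix_components abs_square_eq_1)

lemma continuous_on_helix: "continuous_on S (helix \<beta> \<theta>)"
  unfolding helix_def[abs_def] by (intro continuous_intros)

lemma
  fixes y :: "real^3"
  shows Ck_cos_third: "Ck k (\<lambda>x. cos (\<theta> + \<beta> * x $ 3))" and Ck_sin_third: "Ck k (\<lambda>x. sin (\<theta> + \<beta> * x $ 3))"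
    and has_derivative_cos_third: "((\<lambda>x. cos (\<theta> + \<beta> * x $ 3)) has_derivative (\<lambda>v. - sin (\<theta> + \<beta> * y $ 3) * (\<beta> * v $ 3))) (at y)"
    and has_derivative_sin_third: "((\<lambda>x. sin (\<theta> + \<beta> * x $ 3)) has_derivative (\<lambda>v. cos (\<theta> + \<beta> * y $ 3) * (\<beta> * v $ 3))) (at y)"
proof -
  show "Ck k (\<lambda>x. cos (\<theta> + \<beta> * x $ 3))" "Ck k (\<lambda>x. sin (\<theta> + \<beta> * x $ 3))"
    using Ck_cos[of k "axis 3 \<beta>" \<theta>] Ck_sin[of k "axis 3 \<beta>" \<theta>] by (simp_all add: inner_axis mult.commute add.commute)
  have "((\<lambda>x :: real^3. x $ 3) has_derivative (\<lambda>v. v $ 3)) (at y)"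
    by (rule bounded_linear.has_derivative[OF bounded_linear_vec_nth has_derivative_ident])
  note [derivative_intros] = this
  show "((\<lambda>x. cos (\<theta> + \<beta> * x $ 3)) has_derivative (\<lambda>v. - sin (\<theta> + \<beta> * y $ 3) * (\<beta> * v $ 3))) (at y)"
    by (auto intro!: derivative_eq_intros simp: fun_eq_iff)
  show "((\<lambda>x. sin (\<theta> + \<beta> * x $ 3)) has_derivative (\<lambda>v. cos (\<theta> + \<beta> * y $ 3) * (\<beta> * v $ 3))) (at y)"
    by (auto intro!: derivative_eq_intros simp: fun_eq_iff)
qed

lemma abs_cos_sin_partial_le: "\<bar>- sin t * (\<beta> * s)\<bar> \<le> \<bar>\<beta> * s\<bar>" "\<bar>cos t * (\<beta> * s)\<bar> \<le> \<bar>\<beta> * s\<bar>" for t \<beta> s :: real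
  using mult_right_mono[OF abs_sin_le_one[of t] abs_ge_zero[of "\<beta> * s"]]
    mult_right_mono[OF abs_cos_le_one[of t] abs_ge_zero[of "\<beta> * s"]]
  by (simp_all add: abs_mult)

lemma weak_partial_cos_mult:
  assumes "open D" "weak_partial D i f p"
  shows "weak_partial D i (\<lambda>x. cos (\<theta> + \<beta> * x $ 3) * f x)
    (\<lambda>x. cos (\<theta> + \<beta> * x $ 3) * p x + - sin (\<theta> + \<beta> * x $ 3) * (\<beta> * axis i 1 $ 3) * f x)"
  by (rule weak_partial_mult_smooth[OF assms Ck_cos_third has_derivative_cos_third abs_cos_le_one abs_cos_sin_partial_le(1)])

lemma weak_partial_sin_mult:
  assumes "open D" "weak_partial D i f p"
  shows "weak_partial D i (\<lambda>x. sin (\<theta> + \<beta> * x $ 3) * f x)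
    (\<lambda>x. sin (\<theta> + \<beta> * x $ 3) * p x + cos (\<theta> + \<beta> * x $ 3) * (\<beta> * axis i 1 $ 3) * f x)"
  by (rule weak_partial_mult_smooth[OF assms Ck_sin_third has_derivative_sin_third abs_sin_le_one abs_cos_sin_partial_le(2)])

lemma AE_helix_L2:
  assumes D: "open D" "bounded D" and m: "AE x in lebesgue_on D. m x = helix \<beta> \<theta> x"
  shows "m \<in> L2 (lebesgue_on D)"
proof -
  interpret finite_measure "lebesgue_on D"
    by (intro finite_measure_lebesgue_on lmeasurable_open D)
  have D': "D \<inter> space lebesgue \<in> sets lebesgue" using D by (simp add: borel_open)
  have "helix \<beta> \<theta> \<in> borel_measurable (lebesgue_on D)"
    by (intro continuous_measurable_lebesgue_on D continuous_on_helix)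
  then have "(\<lambda>x. indicator D x *\<^sub>R helix \<beta> \<theta> x) \<in> borel_measurable lebesgue"
    using borel_measurable_restrict_space_iff[OF D'] by blast
  moreover have "AE x in lebesgue. indicator D x *\<^sub>R helix \<beta> \<theta> x = indicator D x *\<^sub>R m x"
    using m unfolding AE_restrict_space_iff[OF D'] by eventually_elim (auto simp: indicator_def)
  ultimately have "(\<lambda>x. indicator D x *\<^sub>R m x) \<in> borel_measurable lebesgue"
    by (rule borel_measurable_AE)
  then have meas: "m \<in> borel_measurable (lebesgue_on D)"
    using borel_measurable_restrict_space_iff[OF D'] by blast
  have "integrable (lebesgue_on D) (\<lambda>x. (norm (m x))\<^sup>2)"
  proof (rule integrable_const_bound)
    show "AE x in lebesgue_on D. norm ((norm (m x))\<^sup>2) \<le> 1"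
      using m by eventually_elim (simp add: norm_helix)
  qed (use meas in simp)
  then show ?thesis using meas by (simp add: L2_def)
qed

text \<open>
  The entries of a helix are smooth functions times the constant 1, so the product rule computes their weak
  derivatives.
\<close>

lemma AE_helix_is_weak_grad:
  assumes D: "open D" "bounded D" and m: "AE x in lebesgue_on D. m x = helix \<beta> \<theta> x"
  shows "is_weak_grad D m (\<lambda>x. axis 3 (\<beta> *\<^sub>R cross3 (axis 3 1) (helix \<beta> \<theta> x)))"
proof -
  interpret finite_measure "lebesgue_on D"
    by (intro finite_measure_lebesgue_on lmeasurable_open D)
  define g :: "real^3 \<Rightarrow> real^3^3" where "g x = axis 3 (\<beta> *\<^sub>R cross3 (axis 3 1) (helix \<beta> \<theta> x))" for x
  have mL: "m \<in> L2 (lebesgue_on D)" by (rule AE_helix_L2[OF D m])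
  have g_entries: "g x $ i $ 1 = - sin (\<theta> + \<beta> * x $ 3) * (\<beta> * axis i 1 $ 3)"
      "g x $ i $ 2 = cos (\<theta> + \<beta> * x $ 3) * (\<beta> * axis i 1 $ 3)" "g x $ i $ 3 = 0" for x i
    by (auto simp: g_def cross_components helix_components axis_def)
  have "continuous_on UNIV g"
  proof -
    have "continuous_on UNIV (\<lambda>x. g x $ i $ j)" for i j
    proof -
      have "continuous_on UNIV (\<lambda>x. g x $ i $ 1)" "continuous_on UNIV (\<lambda>x. g x $ i $ 2)" "continuous_on UNIV (\<lambda>x. g x $ i $ 3)"
        unfolding g_entries by (intro continuous_intros)+
      then show ?thesis using exhaust_3[of j] by auto
    qed
    then show ?thesis
      using continuous_on_vec_lambda[of UNIV "\<lambda>i x. \<chi> j. g x $ i $ j"] continuous_on_vec_lambda[of UNIV "\<lambda>j x. g x $ _ $ j"]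
      by (simp add: vec_lambda_eta)
  qed
  then have gm: "g \<in> borel_measurable (lebesgue_on D)" by (rule continuous_measurable_lebesgue_on[OF D(1)])
  have "norm (g x) \<le> \<bar>\<beta>\<bar>" for x
  proof -
    have "(norm (cross3 (axis 3 1) (helix \<beta> \<theta> x)))\<^sup>2 = 1"
      unfolding norm_cross3_axis3 helix_components by simp
    then have "norm (cross3 (axis 3 1) (helix \<beta> \<theta> x)) = 1" by (simp add: abs_square_eq_1)
    then show ?thesis by (simp add: g_def norm_axis_eq)
  qed
  then have "norm ((norm (g x))\<^sup>2) \<le> \<beta>\<^sup>2" for x
    by (simp add: abs_le_square_iff[symmetric])
  then have "integrable (lebesgue_on D) (\<lambda>x. (norm (g x))\<^sup>2)"
    using gm by (intro integrable_const_bound[of _ "\<beta>\<^sup>2"]) auto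
  then have gL: "g \<in> L2 (lebesgue_on D)" using gm by (simp add: L2_def)
  have mi: "integrable (lebesgue_on D) (\<lambda>x. m x $ j)" for j
    using L2_imp_integrable[OF mL] integrable_vec_iff by blast
  have one: "weak_partial D i (\<lambda>x. c) (\<lambda>x. 0)" for i c by (rule weak_partial_const[OF D])
  have "weak_partial D i (\<lambda>x. m x $ j) (\<lambda>x. g x $ i $ j)" for i j
  proof -
    have *: "weak_partial D i (\<lambda>x. helix \<beta> \<theta> x $ j) (\<lambda>x. g x $ i $ j)"
      using exhaust_3[of j] weak_partial_cos_mult[OF D(1) one, of i \<theta> \<beta> 1] weak_partial_sin_mult[OF D(1) one, of i \<theta> \<beta> 1] one[of i 0]
      by (auto simp: helix_components g_entries)
    have "AE x in lebesgue_on D. m x $ j = helix \<beta> \<theta> x $ j" using m by eventually_elim simp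
    then show ?thesis by (rule weak_partial_cong_AE[OF D(1) * mi])
  qed
  then show ?thesis unfolding g_def[symmetric] is_weak_grad_iff[OF D mL] using gL by blast
qed

lemma is_weak_grad_unique:
  assumes D: "open D" "bounded D" and m: "m \<in> L2 (lebesgue_on D)" and g: "is_weak_grad D m g" "is_weak_grad D m g'"
  shows "AE x in lebesgue_on D. g x = g' x"
proof -
  have "AE x in lebesgue_on D. g x $ i $ j = g' x $ i $ j" for i j
  proof (rule weak_partial_unique[OF D(1)])
    show "weak_partial D i (\<lambda>x. m x $ j) (\<lambda>x. g x $ i $ j)" "weak_partial D i (\<lambda>x. m x $ j) (\<lambda>x. g' x $ i $ j)"
      using g unfolding is_weak_grad_iff[OF D m] by blast+
  qed
  then have "AE x in lebesgue_on D. \<forall>i j. g x $ i $ j = g' x $ i $ j"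
    by (simp add: AE_all_countable)
  then show ?thesis by eventually_elim (simp add: vec_eq_iff)
qed

lemma is_weak_grad_weak_grad: "m \<in> H1_sphere D \<Longrightarrow> is_weak_grad D m (weak_grad D m)"
  unfolding weak_grad_def H1_sphere_def H1_def using someI_ex[of "is_weak_grad D m"] by auto

lemma AE_helix_H1_sphere:
  assumes D: "open D" "bounded D" and m: "AE x in lebesgue_on D. m x = helix \<beta> \<theta> x"
  shows "m \<in> H1_sphere D"
proof -
  have "AE x in lebesgue_on D. m x \<in> sphere 0 1" using m by eventually_elim (simp add: norm_helix)
  then show ?thesis
    using AE_helix_L2[OF D m] AE_helix_is_weak_grad[OF D m] by (auto simp: H1_sphere_def H1_def)
qed

lemma AE_helix_defect_eq_0:
  assumes D: "open D" "bounded D" and m: "AE x in lebesgue_on D. m x = helix \<beta> \<theta> x"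
  shows "AE x in lebesgue_on D. energy_defect A \<alpha> \<beta> K (m x) (weak_grad D m x) = 0"
proof -
  have "AE x in lebesgue_on D. weak_grad D m x = axis 3 (\<beta> *\<^sub>R cross3 (axis 3 1) (helix \<beta> \<theta> x))"
    by (rule is_weak_grad_unique[OF D AE_helix_L2[OF D m] is_weak_grad_weak_grad[OF AE_helix_H1_sphere[OF D m]]
          AE_helix_is_weak_grad[OF D m]])
  then show ?thesis
    using m
  proof eventually_elim
    case (elim x)
    have "(norm (cross3 (axis 3 1) (helix \<beta> \<theta> x)))\<^sup>2 = 1"
      unfolding norm_cross3_axis3 helix_components by simp
    then show ?case using elim by (simp add: energy_defect_def axis_def)
  qed
qed

text \<open>
  The planar part of \<open>m\<close>, seen in a frame that rotates with angle \<open>\<beta> x\<^sub>3\<close>, has entries \<open>c m\<^sub>1 + s m\<^sub>2\<close> and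
  \<open>c m\<^sub>2 - s m\<^sub>1\<close>, where \<open>c = cos (\<beta> x\<^sub>3)\<close> and \<open>s = sin (\<beta> x\<^sub>3)\<close>. Their weak gradients vanish by the equations
  \<open>\<partial>\<^sub>3 m\<^sub>1 = - \<beta> m\<^sub>2\<close> and \<open>\<partial>\<^sub>3 m\<^sub>2 = \<beta> m\<^sub>1\<close>, so they are constants \<open>c1\<close> and \<open>c2\<close>, and the polar angle of
  \<open>(c1, c2)\<close> is the phase of the helix.
\<close>

lemma defect_eq_0_imp_AE_helix:
  assumes D: "open D" "bounded D" "connected D" and m: "m \<in> H1_sphere D"
    and pos: "0 < A" "0 < \<alpha>" "0 < K"
    and zero: "AE x in lebesgue_on D. energy_defect A \<alpha> \<beta> K (m x) (weak_grad D m x) = 0"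
  obtains \<theta> where "AE x in lebesgue_on D. m x = helix \<beta> \<theta> x"
proof -
  define g where "g = weak_grad D m"
  have mL: "m \<in> L2 (lebesgue_on D)" using m by (simp add: H1_sphere_def H1_def)
  have wp: "weak_partial D i (\<lambda>x. m x $ j) (\<lambda>x. g x $ i $ j)" for i j
    using is_weak_grad_weak_grad[OF m] unfolding is_weak_grad_iff[OF D(1,2) mL] g_def by blast
  have unit: "AE x in lebesgue_on D. norm (m x) = 1"
    using m by (simp add: H1_sphere_def)
  have eqs: "AE x in lebesgue_on D. g x $ 1 = 0 \<and> g x $ 2 = 0 \<and> g x $ 3 = \<beta> *\<^sub>R cross3 (axis 3 1) (m x) \<and> m x $ 3 = 0"
    using zero unit
  proof eventually_elim
    case (elim x)
    from energy_defect_eq_0D[OF pos elim(2,1)] show ?case by (simp add: g_def)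
  qed
  have g_entries: "AE x in lebesgue_on D. \<forall>i. g x $ i $ 1 = - (\<beta> * axis i 1 $ 3) * m x $ 2 \<and> g x $ i $ 2 = (\<beta> * axis i 1 $ 3) * m x $ 1"
    using eqs by eventually_elim (auto simp: forall_3 cross_components axis_def)
  define c where "c x = cos (0 + \<beta> * x $ 3)" for x :: "real^3"
  define s where "s x = sin (0 + \<beta> * x $ 3)" for x :: "real^3"
  note cm = weak_partial_cos_mult[OF D(1), where \<theta> = 0 and \<beta> = \<beta>, folded c_def s_def]
    and sm = weak_partial_sin_mult[OF D(1), where \<theta> = 0 and \<beta> = \<beta>, folded c_def s_def]
  have neg: "weak_partial D i (\<lambda>x. - 1 * m x $ 1) (\<lambda>x. - 1 * g x $ i $ 1)" for i
    using wp[of i 1] by (simp add: weak_partial_def)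
  obtain c1 where c1: "AE x in lebesgue_on D. c x * m x $ 1 + s x * m x $ 2 = c1"
  proof (rule weak_partials_zero_imp_AE_const[OF D(1,3)])
    show "weak_partial D i (\<lambda>x. c x * m x $ 1 + s x * m x $ 2)
        (\<lambda>x. (c x * g x $ i $ 1 + - s x * (\<beta> * axis i 1 $ 3) * m x $ 1) + (s x * g x $ i $ 2 + c x * (\<beta> * axis i 1 $ 3) * m x $ 2))" for i
      by (intro weak_partial_add[OF D(1)] cm sm wp)
    show "AE x in lebesgue_on D. (c x * g x $ i $ 1 + - s x * (\<beta> * axis i 1 $ 3) * m x $ 1) + (s x * g x $ i $ 2 + c x * (\<beta> * axis i 1 $ 3) * m x $ 2) = 0" for i
      using g_entries by eventually_elim (simp add: algebra_simps)
  qed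
  obtain c2 where c2: "AE x in lebesgue_on D. c x * m x $ 2 + s x * (- 1 * m x $ 1) = c2"
  proof (rule weak_partials_zero_imp_AE_const[OF D(1,3)])
    show "weak_partial D i (\<lambda>x. c x * m x $ 2 + s x * (- 1 * m x $ 1))
        (\<lambda>x. (c x * g x $ i $ 2 + - s x * (\<beta> * axis i 1 $ 3) * m x $ 2) + (s x * (- 1 * g x $ i $ 1) + c x * (\<beta> * axis i 1 $ 3) * (- 1 * m x $ 1)))" for i
      by (intro weak_partial_add[OF D(1)] cm sm wp neg)
    show "AE x in lebesgue_on D. (c x * g x $ i $ 2 + - s x * (\<beta> * axis i 1 $ 3) * m x $ 2) + (s x * (- 1 * g x $ i $ 1) + c x * (\<beta> * axis i 1 $ 3) * (- 1 * m x $ 1)) = 0" for i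
      using g_entries by eventually_elim (simp add: algebra_simps)
  qed
  have cs: "(c x)\<^sup>2 + (s x)\<^sup>2 = 1" for x by (simp add: c_def s_def)
  have sol: "AE x in lebesgue_on D. m x $ 1 = c x * c1 - s x * c2 \<and> m x $ 2 = s x * c1 + c x * c2 \<and> m x $ 3 = 0 \<and> c1\<^sup>2 + c2\<^sup>2 = 1"
    using c1 c2 eqs unit
  proof eventually_elim
    case (elim x)
    have m1: "c x * c1 - s x * c2 = ((c x)\<^sup>2 + (s x)\<^sup>2) * m x $ 1" "s x * c1 + c x * c2 = ((c x)\<^sup>2 + (s x)\<^sup>2) * m x $ 2"
      unfolding elim(1)[symmetric] elim(2)[symmetric] by (simp_all add: algebra_simps power2_eq_square)
    have "c1\<^sup>2 + c2\<^sup>2 = ((c x)\<^sup>2 + (s x)\<^sup>2) * ((m x $ 1)\<^sup>2 + (m x $ 2)\<^sup>2)"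
      unfolding elim(1)[symmetric] elim(2)[symmetric] by (simp add: algebra_simps power2_eq_square)
    moreover have "(m x $ 1)\<^sup>2 + (m x $ 2)\<^sup>2 = 1" using norm_vec3[of "m x"] elim by simp
    ultimately show ?case using m1 elim(3) by (simp add: cs)
  qed
  show ?thesis
  proof (cases "c1\<^sup>2 + c2\<^sup>2 = 1")
    case True
    then obtain \<theta> where \<theta>: "c1 = cos \<theta>" "c2 = sin \<theta>" by (rule sincos_total_2pi)
    have "AE x in lebesgue_on D. m x = helix \<beta> \<theta> x"
      using sol
    proof eventually_elim
      case (elim x)
      then show ?case
        by (simp add: vec_eq_iff forall_3 helix_components \<theta> c_def s_def cos_add sin_add algebra_simps)
    qed
    then show ?thesis by (rule that)
  next
    case False
    \<comment> \<open>Here \<open>D\<close> is a null set and any phase will do.\<close>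
    with sol have "AE x in lebesgue_on D. m x = helix \<beta> 0 x" by (auto elim!: eventually_mono)
    then show ?thesis by (rule that)
  qed
qed

section \<open>The minimizers\<close>

theorem theorem1p2:
  fixes M :: "'w::metric_space measure"
    and T :: "real^3 \<Rightarrow> 'w \<Rightarrow> 'w"
    and a \<kappa> :: "'w \<Rightarrow> real"
    and \<Theta>\<^sub>a \<Theta>\<^sub>\<kappa> :: "'w \<Rightarrow> real^3^3"
    and c_ex C_ex C_DMI h :: real
    and D' :: "(real^2) set"
    and D :: "(real^3) set"
  assumes system: "ergodic_system M T"
    and a_measurable: "a \<in> borel_measurable M"
    and \<kappa>_measurable: "\<kappa> \<in> borel_measurable M"
    and constants_pos: "0 < c_ex" "0 < C_ex" "0 < C_DMI"
    and a_bounds: "\<And>w. c_ex \<le> a w \<and> a w \<le> C_ex"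
    and \<kappa>_bound: "\<And>w. \<bar>\<kappa> w\<bar> \<le> C_DMI"
    and \<Theta>\<^sub>a: "is_corrector M T a a \<Theta>\<^sub>a"
    and \<Theta>\<^sub>\<kappa>: "is_corrector M T a \<kappa> \<Theta>\<^sub>\<kappa>"
    and h_pos: "0 < h"
    and D': "open D'" "bounded D'" "measure lebesgue D' = 1"
    and D_cylinder: "D = cylinder D' h"
    and D: "open D" "bounded D" "connected D" "Lipschitz_boundary D"
    and T_layered: "\<And>x\<^sub>1 x\<^sub>2 x\<^sub>3. T (vector [x\<^sub>1, x\<^sub>2, x\<^sub>3]) = T (vector [0, 0, x\<^sub>3])"
    and \<kappa>_mean: "(\<integral>w. \<kappa> w \<partial>M) = 0"
  shows "(\<forall>m. (\<exists>\<theta>\<^sub>0. AE x in lebesgue_on D. m x = m_star M a \<kappa> \<theta>\<^sub>0 x)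
            \<longrightarrow> is_arg_min (G_hom M a \<kappa> \<Theta>\<^sub>a \<Theta>\<^sub>\<kappa> D) (\<lambda>m. m \<in> H1_sphere D) m) \<and>
         (\<not> (AE w in M. \<kappa> w = 0) \<longrightarrow>
            (\<forall>m. is_arg_min (G_hom M a \<kappa> \<Theta>\<^sub>a \<Theta>\<^sub>\<kappa> D) (\<lambda>m. m \<in> H1_sphere D) m
            \<longrightarrow> (\<exists>\<theta>\<^sub>0. AE x in lebesgue_on D. m x = m_star M a \<kappa> \<theta>\<^sub>0 x)))"
proof -
  interpret ergodic_system M T by (rule system)
  have layered: "T x = T (x $ 3 *\<^sub>R axis 3 1)" for x
  proof -
    have "vector [x $ 1, x $ 2, x $ 3] = x" "vector [0, 0, x $ 3] = x $ 3 *\<^sub>R (axis 3 1 :: real^3)"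
      by (simp_all add: vec_eq_iff forall_3 axis_def)
    then show ?thesis using T_layered[of "x $ 1" "x $ 2" "x $ 3"] by simp
  qed
  define A where "A = (\<integral>w. a w \<partial>M)"
  define \<alpha> where "\<alpha> = 1 / (\<integral>w. 1 / a w \<partial>M)"
  define \<beta> where "\<beta> = (\<integral>w. \<kappa> w / a w \<partial>M)"
  define K where "K = (\<integral>w. (\<kappa> w)\<^sup>2 / a w \<partial>M)"
  note coeff = homogenized_coefficients[OF layered a_measurable a_bounds constants_pos(1) \<kappa>_measurable \<kappa>_bound \<kappa>_mean \<Theta>\<^sub>a \<Theta>\<^sub>\<kappa>,
      folded A_def \<alpha>_def \<beta>_def K_def]
  define G where "G = G_hom M a \<kappa> \<Theta>\<^sub>a \<Theta>\<^sub>\<kappa> D"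
  define defect where "defect m x = energy_defect A \<alpha> \<beta> K (m x) (weak_grad D m x)" for m x
  define G_min where "G_min = - (1/2 * K * measure lebesgue D)"
  have int: "integrable (lebesgue_on D) (defect m)" and G: "G m = 1/2 * (\<integral>x. defect m x \<partial>lebesgue_on D) + G_min"
    if "m \<in> H1_sphere D" for m
    using G_hom_eq_defect[OF D(1,2) that coeff(5-7)] by (simp_all add: defect_def[abs_def] G_def G_min_def)
  have nonneg: "AE x in lebesgue_on D. 0 \<le> defect m x" if "m \<in> H1_sphere D" for m
  proof -
    have "AE x in lebesgue_on D. norm (m x) = 1" using that by (simp add: H1_sphere_def)
    then show ?thesis
      by eventually_elim (use coeff(1-3) in \<open>simp add: defect_def energy_defect_nonneg\<close>)
  qed
  have lower: "G_min \<le> G m" if "m \<in> H1_sphere D" for m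
    using integral_nonneg_AE[OF nonneg[OF that]] G[OF that] by simp
  have helix_min: "m \<in> H1_sphere D" "G m = G_min" if "AE x in lebesgue_on D. m x = helix \<beta> \<theta> x" for m \<theta>
  proof -
    show m: "m \<in> H1_sphere D" by (rule AE_helix_H1_sphere[OF D(1,2) that])
    have "AE x in lebesgue_on D. defect m x = 0"
      unfolding defect_def by (rule AE_helix_defect_eq_0[OF D(1,2) that])
    then have "(\<integral>x. defect m x \<partial>lebesgue_on D) = 0" by (rule integral_eq_zero_AE)
    then show "G m = G_min" using G[OF m] by simp
  qed
  show ?thesis
    unfolding m_star_eq_helix \<beta>_def[symmetric] G_def[symmetric]
  proof (intro conjI allI impI)
    fix m assume "\<exists>\<theta>\<^sub>0. AE x in lebesgue_on D. m x = helix \<beta> \<theta>\<^sub>0 x"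
    then obtain \<theta> where "AE x in lebesgue_on D. m x = helix \<beta> \<theta> x" by blast
    from helix_min[OF this] lower show "is_arg_min G (\<lambda>m. m \<in> H1_sphere D) m"
      by (auto simp: is_arg_min_def not_less)
  next
    fix m assume \<kappa>: "\<not> (AE w in M. \<kappa> w = 0)" and "is_arg_min G (\<lambda>m. m \<in> H1_sphere D) m"
    then have m: "m \<in> H1_sphere D" and le: "\<And>m'. m' \<in> H1_sphere D \<Longrightarrow> G m \<le> G m'"
      by (auto simp: is_arg_min_def not_less)
    have "G m \<le> G_min"
      using le[of "helix \<beta> 0"] helix_min[of "helix \<beta> 0" 0] by simp
    then have "(\<integral>x. defect m x \<partial>lebesgue_on D) = 0"
      using G[OF m] integral_nonneg_AE[OF nonneg[OF m]] by simp
    then have "AE x in lebesgue_on D. defect m x = 0"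
      using integral_nonneg_eq_0_iff_AE[OF int[OF m] nonneg[OF m]] by simp
    moreover have "0 < K" using coeff(3,4) \<kappa> by (cases "K = 0") auto
    ultimately show "\<exists>\<theta>\<^sub>0. AE x in lebesgue_on D. m x = helix \<beta> \<theta>\<^sub>0 x"
      using defect_eq_0_imp_AE_helix[OF D(1-3) m coeff(1,2)] unfolding defect_def by blast
  qed
qed

end
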